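(* The following two statements are equivalent. (A) (Polynomial Freiman--Ruzsa conjecture over $\mathbb{F}_2$.) There exists an absolute constant $C>0$ such that for every $n\ge 1$, every real $K\ge 1$ and every nonempty set $S\subset\mathbb{F}_2^n$ with $|S+S|\le K|S|$, there is a subset $S'\subset S$ with $|S'|\ge C^{-1}K^{-C}|S|$ and $|\mathrm{Span}(S')|\le C K^{C}|S|$. (B) (Polynomial inverse Gowers conjecture for $U^3$ over $\mathbb{F}_2$.) There exists an absolute constant $C>0$ such that for every $n\ge 1$, every $0<\epsilon\le 1$ and every function $f:\mathbb{F}_2^n\to\mathbb{F}_2$ with $\|(-1)^f\|_{U^3}\ge\epsilon$, there exists a polynomial $p:\mathbb{F}_2^n\to\mathbb{F}_2$ of degree at most $2$ such that $\Pr_{x\in\mathbb{F}_2^n}[f(x)=p(x)]\ge\frac12+C^{-1}\epsilon^{C}$.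
   Context: For $S\subset\mathbb{F}_2^n$, $S+S=\{x+y:x,y\in S\}$ and $\mathrm{Span}(S)$ is the $\mathbb{F}_2$-linear span of $S$. Probabilities and expectations are with respect to the uniform distribution. For $G:\mathbb{F}_2^n\to\mathbb{C}$, the derivative in direction $y$ is $G_y(x)=G(x+y)\overline{G(x)}$, and iterated derivatives are $G_{y_1,\ldots,y_d}=(G_{y_1,\ldots,y_{d-1}})_{y_d}$. The $d$-th Gowers norm is $\|G\|_{U^d}=\left(\mathbb{E}_{x,y_1,\ldots,y_d\in\mathbb{F}_2^n}[G_{y_1,\ldots,y_d}(x)]\right)^{1/2^d}$. For $f:\mathbb{F}_2^n\to\mathbb{F}_2$, $(-1)^f$ denotes the function $x\mapsto(-1)^{f(x)}$; thus $\|(-1)^f\|_{U^3}^8=\mathbb{E}_{x,y_1,y_2,y_3}\left[(-1)^{\sum_{I\subseteq\{1,2,3\}}f(x+\sum_{i\in I}y_i)}\right]$. *)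

theory Defs
  imports
    "HOL-Probability.Probability"
    "HOL-Library.Z2"
    "HOL-Library.Function_Algebras"
    "HOL-Library.Set_Algebras"
begin

text \<open>
  The dimension \<open>n\<close> is quantified inside the statement, so the space of \<open>n\<close>-dimensional vectors over the
  two-element field \<^typ>\<open>bit\<close> is a set: the sequences that vanish from index \<open>n\<close> on. Vector addition is
  the pointwise addition of functions, and \<open>S + T\<close> on sets is the Minkowski sum.
\<close>

definition F2n :: "nat \<Rightarrow> (nat \<Rightarrow> bit) set"
  where "F2n n = {x. \<forall>i\<ge>n. x i = 0}"

definition F2_scale :: "bit \<Rightarrow> (nat \<Rightarrow> bit) \<Rightarrow> nat \<Rightarrow> bit"
  where "F2_scale c v = (\<lambda>i. c * v i)"

interpretation F2: vector_space F2_scale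
  by unfold_locales (auto simp: F2_scale_def fun_eq_iff algebra_simps)

lemma subspace_F2n: "F2.subspace (F2n n)"
  by (auto simp: F2.subspace_def F2n_def F2_scale_def)

lemma F2n_eq_PiE_image:
  "F2n n = (\<lambda>g i. if i < n then g i else 0) ` (PiE {..<n} (\<lambda>_. UNIV))"
proof (intro equalityI subsetI)
  fix x assume x: "x \<in> F2n n"
  show "x \<in> (\<lambda>g i. if i < n then g i else 0) ` (PiE {..<n} (\<lambda>_. UNIV))"
    by (rule image_eqI[where x="restrict x {..<n}"]) (use x in \<open>auto simp: F2n_def fun_eq_iff\<close>)
next
  fix x :: "nat \<Rightarrow> bit"
  assume "x \<in> (\<lambda>g i. if i < n then g i else 0) ` (PiE {..<n} (\<lambda>_. UNIV))"
  then show "x \<in> F2n n" by (elim imageE) (simp add: F2n_def)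
qed

lemma finite_F2n: "finite (F2n n)"
proof -
  have "(UNIV :: bit set) \<subseteq> {0, 1}"
  proof
    fix a :: bit
    show "a \<in> {0, 1}" by (cases a) simp_all
  qed
  then have "finite (UNIV :: bit set)"
    by (rule finite_subset) (intro finite.intros)
  then show ?thesis
    unfolding F2n_eq_PiE_image by (intro finite_imageI finite_PiE finite_lessThan)
qed

lemma F2n_nonempty: "F2n n \<noteq> {}"
proof -
  have "0 \<in> F2n n" by (rule F2.subspace_0[OF subspace_F2n])
  then show ?thesis by (metis empty_iff)
qed

definition mult_deriv :: "((nat \<Rightarrow> bit) \<Rightarrow> complex) \<Rightarrow> (nat \<Rightarrow> bit) \<Rightarrow> (nat \<Rightarrow> bit) \<Rightarrow> complex"
  where "mult_deriv G y = (\<lambda>x. G (x + y) * cnj (G x))"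

definition iter_deriv :: "((nat \<Rightarrow> bit) \<Rightarrow> complex) \<Rightarrow> (nat \<Rightarrow> bit) list \<Rightarrow> (nat \<Rightarrow> bit) \<Rightarrow> complex"
  where "iter_deriv G ys = foldl mult_deriv G ys"

definition gowers_mean :: "nat \<Rightarrow> nat \<Rightarrow> ((nat \<Rightarrow> bit) \<Rightarrow> complex) \<Rightarrow> complex"
  where "gowers_mean n d G =
    measure_pmf.expectation
      (pmf_of_set (F2n n \<times> {ys. set ys \<subseteq> F2n n \<and> length ys = d}))
      (\<lambda>(x, ys). iter_deriv G ys x)"

text \<open>
  For \<open>d \<ge> 1\<close> the mean is a nonnegative real number (see \<open>gowers_mean_nonneg\<close> below), so taking its real
  part loses nothing and the real root is the intended one.
\<close>

definition gowers_norm :: "nat \<Rightarrow> nat \<Rightarrow> ((nat \<Rightarrow> bit) \<Rightarrow> complex) \<Rightarrow> real"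
  where "gowers_norm n d G = root (2 ^ d) (Re (gowers_mean n d G))"

definition sign_fun :: "((nat \<Rightarrow> bit) \<Rightarrow> bit) \<Rightarrow> (nat \<Rightarrow> bit) \<Rightarrow> complex"
  where "sign_fun f = (\<lambda>x. if f x = 0 then 1 else -1)"

lemma gowers_mean_nonneg:
  "\<exists>r\<ge>0. gowers_mean n (Suc d) G = complex_of_real r"
proof -
  let ?V = "F2n n" and ?L = "\<lambda>d. {ys. set ys \<subseteq> F2n n \<and> length ys = d}"
  have finL: "finite (?L d)" for d
    using finite_lists_length_eq[OF finite_F2n] by simp
  have neL: "?L d \<noteq> {}" for d
  proof -
    have "replicate d 0 \<in> ?L d"
      using F2.subspace_0[OF subspace_F2n] by auto
    then show ?thesis by blast
  qed
  have fin: "finite (?V \<times> ?L (Suc d))" and ne: "?V \<times> ?L (Suc d) \<noteq> {}"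
    using finL neL finite_F2n F2n_nonempty by blast+
  have invol: "x + (x + y) = y" for x y :: "nat \<Rightarrow> bit"
    by (auto simp: fun_eq_iff)
  have shift: "(\<Sum>y\<in>?V. H (x + y)) = sum H ?V" if "x \<in> ?V" for x and H :: "_ \<Rightarrow> complex"
    by (rule sum.reindex_bij_witness[where i="\<lambda>y. x + y" and j="\<lambda>y. x + y"])
      (use that F2.subspace_add[OF subspace_F2n] in \<open>auto simp: invol\<close>)
  have bij: "bij_betw (\<lambda>(ys, y). ys @ [y]) (?L d \<times> ?V) (?L (Suc d))"
  proof (rule bij_betwI[where g="\<lambda>zs. (butlast zs, last zs)"])
    show "(\<lambda>zs. (butlast zs, last zs)) \<in> ?L (Suc d) \<rightarrow> ?L d \<times> ?V"
    proof
      fix zs assume "zs \<in> ?L (Suc d)"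
      moreover from this have "zs \<noteq> []" by auto
      ultimately show "(butlast zs, last zs) \<in> ?L d \<times> ?V"
        by (auto dest: in_set_butlastD)
    qed
  next
    fix zs assume "zs \<in> ?L (Suc d)"
    then have "zs \<noteq> []" by auto
    then show "(case (butlast zs, last zs) of (ys, y) \<Rightarrow> ys @ [y]) = zs" by simp
  qed auto
  have "(\<Sum>(x, zs)\<in>?V \<times> ?L (Suc d). iter_deriv G zs x)
      = (\<Sum>zs\<in>?L (Suc d). \<Sum>x\<in>?V. iter_deriv G zs x)"
    by (subst sum.swap) (simp add: sum.cartesian_product)
  also have "\<dots> = (\<Sum>(ys, y)\<in>?L d \<times> ?V. \<Sum>x\<in>?V. iter_deriv G (ys @ [y]) x)"
    by (subst sum.reindex_bij_betw[OF bij, symmetric]) (simp add: case_prod_beta)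
  also have "\<dots> = (\<Sum>ys\<in>?L d. \<Sum>y\<in>?V. \<Sum>x\<in>?V. iter_deriv G ys (x + y) * cnj (iter_deriv G ys x))"
    by (simp add: iter_deriv_def mult_deriv_def flip: sum.cartesian_product)
  also have "\<dots> = (\<Sum>ys\<in>?L d. \<Sum>x\<in>?V. sum (iter_deriv G ys) ?V * cnj (iter_deriv G ys x))"
  proof (rule sum.cong[OF refl])
    fix ys
    have "(\<Sum>y\<in>?V. \<Sum>x\<in>?V. iter_deriv G ys (x + y) * cnj (iter_deriv G ys x))
        = (\<Sum>x\<in>?V. \<Sum>y\<in>?V. iter_deriv G ys (x + y) * cnj (iter_deriv G ys x))"
      by (rule sum.swap)
    also have "\<dots> = (\<Sum>x\<in>?V. sum (iter_deriv G ys) ?V * cnj (iter_deriv G ys x))"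
      by (rule sum.cong[OF refl]) (simp add: shift flip: sum_distrib_right)
    finally show "(\<Sum>y\<in>?V. \<Sum>x\<in>?V. iter_deriv G ys (x + y) * cnj (iter_deriv G ys x))
        = (\<Sum>x\<in>?V. sum (iter_deriv G ys) ?V * cnj (iter_deriv G ys x))" .
  qed
  also have "\<dots> = (\<Sum>ys\<in>?L d. complex_of_real ((cmod (sum (iter_deriv G ys) ?V))\<^sup>2))"
    by (rule sum.cong[OF refl]) (simp only: complex_norm_square cnj_sum flip: sum_distrib_left)
  finally have sum_eq: "(\<Sum>(x, zs)\<in>?V \<times> ?L (Suc d). iter_deriv G zs x)
      = (\<Sum>ys\<in>?L d. complex_of_real ((cmod (sum (iter_deriv G ys) ?V))\<^sup>2))" .
  have "gowers_mean n (Suc d) G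
      = (\<Sum>a\<in>?V \<times> ?L (Suc d). (1 / card (?V \<times> ?L (Suc d))) *\<^sub>R (\<lambda>(x, ys). iter_deriv G ys x) a)"
    unfolding gowers_mean_def
    by (subst integral_measure_pmf[OF fin]) (use fin ne in \<open>simp_all del: card_cartesian_product\<close>)
  also have "\<dots> = (1 / card (?V \<times> ?L (Suc d))) *\<^sub>R (\<Sum>(x, zs)\<in>?V \<times> ?L (Suc d). iter_deriv G zs x)"
    by (rule scaleR_sum_right[symmetric])
  finally have "gowers_mean n (Suc d) G = complex_of_real
      ((\<Sum>ys\<in>?L d. (cmod (sum (iter_deriv G ys) ?V))\<^sup>2) / card (?V \<times> ?L (Suc d)))"
    unfolding sum_eq by (simp only: scaleR_conv_of_real of_real_sum of_real_divide of_real_1) simp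
  moreover have "0 \<le> (\<Sum>ys\<in>?L d. (cmod (sum (iter_deriv G ys) ?V))\<^sup>2) / card (?V \<times> ?L (Suc d))"
    by (intro divide_nonneg_nonneg sum_nonneg zero_le_power2 of_nat_0_le_iff)
  ultimately show ?thesis by blast
qed

definition exponents :: "nat \<Rightarrow> nat \<Rightarrow> (nat \<Rightarrow> nat) set"
  where "exponents n d = {m. (\<forall>i\<ge>n. m i = 0) \<and> (\<Sum>i<n. m i) \<le> d}"

lemma finite_exponents: "finite (exponents n d)"
proof (rule finite_subset)
  show "exponents n d \<subseteq> (\<lambda>g i. if i < n then g i else 0) ` (PiE {..<n} (\<lambda>_. {..d}))"
  proof
    fix m assume m: "m \<in> exponents n d"
    have "m i \<le> d" if "i < n" for i
      using m member_le_sum[of i "{..<n}" m] that by (auto simp: exponents_def)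
    then have "restrict m {..<n} \<in> PiE {..<n} (\<lambda>_. {..d})" by auto
    moreover have "m = (\<lambda>i. if i < n then restrict m {..<n} i else 0)"
      using m by (auto simp: exponents_def fun_eq_iff)
    ultimately show "m \<in> (\<lambda>g i. if i < n then g i else 0) ` (PiE {..<n} (\<lambda>_. {..d}))"
      by blast
  qed
qed (intro finite_imageI finite_PiE finite_lessThan finite_atMost)

text \<open>
  The function \<open>p\<close> agrees on \<^term>\<open>F2n n\<close> with a polynomial in the \<open>n\<close> coordinates of total degree at
  most \<open>d\<close>; \<open>c m\<close> is the coefficient of the monomial with exponent vector \<open>m\<close>.
\<close>

definition poly_of_degree_le :: "nat \<Rightarrow> nat \<Rightarrow> ((nat \<Rightarrow> bit) \<Rightarrow> bit) \<Rightarrow> bool"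
  where "poly_of_degree_le n d p \<longleftrightarrow>
    (\<exists>c. \<forall>x\<in>F2n n. p x = (\<Sum>m\<in>exponents n d. c m * (\<Prod>i<n. x i ^ m i)))"

end

theory Submission
  imports Defs
begin

text \<open>
  From Freiman--Ruzsa to Gowers: for \<open>F = (-1)\<^sup>f\<close>, let \<open>W(y, a)\<close> be the square of the Fourier coefficient at \<open>a\<close>
  of the derivative of \<open>F\<close> in direction \<open>y\<close>. Up to a factor, the Fourier transform of \<open>W\<close> is \<open>W\<close> with its
  arguments exchanged, so a large \<open>U\<^sup>3\<close> norm gives the set where \<open>W\<close> is large a large additive energy.
  Balog--Szemeredi--Gowers and Freiman--Ruzsa then produce an additive \<open>L\<close> such that \<open>W(y, L y + u)\<close> is large on
  average. By Cauchy--Schwarz the bilinear form of \<open>L\<close> is nearly symmetric; hence it differs by small rank from an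
  alternating form, and after dividing \<open>F\<close> by the corresponding quadratic phase a single Fourier coefficient is large.

  From Gowers to Freiman--Ruzsa: a Freiman model \<open>g\<close> of \<open>S\<close>, defined on a dense set, turns into the phase
  \<open>(x, z) \<mapsto> \<langle>g x, z\<rangle>\<close> with large \<open>U\<^sup>3\<close> norm. A correlating quadratic polynomial makes \<open>g\<close> agree with an affine
  map on a dense set, and the values of \<open>g\<close> on a slice of that set lie in a small coset and meet a translate
  of \<open>S\<close> in many points.
\<close>

text \<open>Both reductions may lose only powers of their parameter. Hence Pluennecke's inequality
  and Balog--Szemeredi--Gowers are proved with polynomial bounds. In the first direction every loss
  is a power of one \<open>t\<close> that is at most 1/2, so numerical factors are absorbed by
  raising the exponent; the large exponents are sums of such losses. Characteristic two shapes the
  symmetrisation: the polarisation of a quadratic polynomial is alternating, and symmetry alone does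
  not make a form alternating. But the diagonal of a symmetric form is additive, so a subgroup of
  index at most two removes it. The form left over has small rank and is paid for by a pigeonhole
  over few frequencies. In the converse, (B) concerns scalar functions while a Freiman model is
  vector valued; the variable \<open>z\<close> encodes all functionals of \<open>g x\<close> at
  once, at the price of doubling the dimension. Off its dense set the model takes values in
  \<open>4S\<close>, so the structured values that are found need not lie in \<open>S\<close>; this
  is why a translate is taken.\<close>

section \<open>Groups of exponent two\<close>

text \<open>These rules would turn sums and products of bits into Boolean operations.\<close>

declare add_bit_eq_xor [simp del] mult_bit_eq_and [simp del] power_bit_unfold [simp del]

text \<open>One class for bits, vectors and pairs of vectors: the same sumset and Fourier lemmas
  then serve \<open>F2n n\<close> and the graph space \<open>F2n n \<times> F2n n\<close>, and
  subtraction is addition.\<close>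

class exponent_two_group = ab_group_add +
  assumes add_self [simp]: "a + a = 0"
begin

lemma add_self_left [simp]: "a + (a + b) = b"
  by (simp flip: add.assoc)

lemma add_eq_0_iff_eq: "a + b = 0 \<longleftrightarrow> a = b"
  by (metis add_self add_self_left add_0_right)

end

instance bit :: exponent_two_group
proof
  show "a + a = 0" for a :: bit by (cases a) (simp_all add: add_bit_eq_xor)
qed

instance "fun" :: (type, exponent_two_group) exponent_two_group
  by standard (simp add: fun_eq_iff)

instance prod :: (exponent_two_group, exponent_two_group) exponent_two_group
  by standard (simp add: plus_prod_def zero_prod_def)

text \<open>Each element is its own inverse, so the two conditions describe a subgroup, and for
  vectors over the two-element field a subspace.\<close>

definition add_subgroup :: "'a::exponent_two_group set \<Rightarrow> bool"
  where "add_subgroup H \<longleftrightarrow> 0 \<in> H \<and> (\<forall>x\<in>H. \<forall>y\<in>H. x + y \<in> H)"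

lemma add_subgroup_0: "add_subgroup H \<Longrightarrow> 0 \<in> H"
  and add_subgroup_add: "add_subgroup H \<Longrightarrow> x \<in> H \<Longrightarrow> y \<in> H \<Longrightarrow> x + y \<in> H"
  by (auto simp: add_subgroup_def)

text \<open>Take \<open>Z\<close> maximal. If \<open>v\<close> lies outside \<open>Z\<close>, the
  union of \<open>Z\<close> and \<open>v + Z\<close> is a larger subgroup, so it meets
  \<open>P\<close> in a nonzero element, which must lie in \<open>v + Z\<close>. With a subgroup as
  \<open>P\<close> this produces a complement; with a fourfold sumset it produces the Freiman
  model.\<close>

lemma subgroup_avoiding:
  fixes G Z0 P :: "'a::exponent_two_group set"
  assumes "finite G" "add_subgroup G" "add_subgroup Z0" "Z0 \<subseteq> G" "Z0 \<inter> P \<subseteq> {0}"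
  obtains Z where "add_subgroup Z" "Z0 \<subseteq> Z" "Z \<subseteq> G" "Z \<inter> P \<subseteq> {0}"
    "\<And>v. v \<in> G \<Longrightarrow> \<exists>p\<in>insert 0 P. v + p \<in> Z"
proof -
  define F where "F = {Z. add_subgroup Z \<and> Z0 \<subseteq> Z \<and> Z \<subseteq> G \<and> Z \<inter> P \<subseteq> {0}}"
  have "finite F"
    by (rule finite_subset[of _ "Pow G"]) (auto simp: F_def assms)
  moreover have "Z0 \<in> F" using assms by (auto simp: F_def)
  ultimately obtain Z where Z: "Z \<in> F" and max: "\<And>Z'. Z' \<in> F \<Longrightarrow> Z \<subseteq> Z' \<Longrightarrow> Z = Z'"
    using finite_has_maximal[of F] by (metis empty_iff)
  have sZ: "add_subgroup Z" using Z by (simp add: F_def)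
  have "\<exists>p\<in>insert 0 P. v + p \<in> Z" if v: "v \<in> G" for v
  proof (cases "v \<in> Z")
    case True
    then show ?thesis by (intro bexI[of _ 0]) auto
  next
    case False
    define Z' where "Z' = Z \<union> (+) v ` Z"
    have sub: "add_subgroup Z'"
      unfolding add_subgroup_def
    proof (intro conjI ballI)
      show "0 \<in> Z'" using add_subgroup_0[OF sZ] by (simp add: Z'_def)
      fix x y assume "x \<in> Z'" "y \<in> Z'"
      then obtain a b where "a \<in> Z" "b \<in> Z" "x = a \<or> x = v + a" "y = b \<or> y = v + b"
        by (auto simp: Z'_def)
      moreover have "(v + a) + (v + b) = a + b" "a + (v + b) = v + (a + b)" "v + a + b = v + (a + b)"
        by (simp_all add: ac_simps)
      ultimately have "a + b \<in> Z" "x + y = a + b \<or> x + y = v + (a + b)"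
        using add_subgroup_add[OF sZ] by metis+
      then show "x + y \<in> Z'"
        by (auto simp: Z'_def)
    qed
    have "v \<in> Z'" using add_subgroup_0[OF sZ] by (force simp: Z'_def)
    then have "Z' \<notin> F" using max[of Z'] False by (auto simp: Z'_def)
    moreover have "Z0 \<subseteq> Z'" "Z' \<subseteq> G"
      using Z v add_subgroup_add[OF assms(2)] by (auto simp: F_def Z'_def)
    ultimately obtain p where p: "p \<in> Z'" "p \<in> P" "p \<noteq> 0"
      using sub by (auto simp: F_def)
    then have "p \<notin> Z" using Z by (auto simp: F_def)
    then obtain z where "z \<in> Z" "p = v + z" using p by (auto simp: Z'_def)
    then show ?thesis using p by (intro bexI[of _ p]) auto
  qed
  with that Z show ?thesis by (auto simp: F_def)
qed

text \<open>A complement \<open>Z0\<close> of the vertical part of \<open>H\<close> inside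
  \<open>H\<close> is the graph of a partial additive map. Extended to a complement \<open>Z\<close>
  of the vertical axis \<open>{0} \<times> G'\<close>, it becomes the graph of a total one. Elements
  of \<open>H\<close> differ from that graph by vertical elements of \<open>H\<close>.\<close>

lemma additive_of_subgroup:
  fixes G :: "'a::exponent_two_group set" and G' :: "'b::exponent_two_group set"
  assumes G: "finite G" "add_subgroup G" and G': "finite G'" "add_subgroup G'"
    and H: "add_subgroup H" "H \<subseteq> G \<times> G'"
  obtains L where "\<And>x. x \<in> G \<Longrightarrow> L x \<in> G'" "\<And>x y. x \<in> G \<Longrightarrow> y \<in> G \<Longrightarrow> L (x + y) = L x + L y"
    "\<And>y a. (y, a) \<in> H \<Longrightarrow> (0, a + L y) \<in> H"
proof -
  have finH: "finite H" using H G G' by (meson finite_SigmaI finite_subset)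
  have s0: "add_subgroup {0 :: 'a \<times> 'b}" by (simp add: add_subgroup_def)
  obtain Z0 where Z0: "add_subgroup Z0" "Z0 \<subseteq> H" "Z0 \<inter> {p \<in> H. fst p = 0} \<subseteq> {0}"
    "\<And>v. v \<in> H \<Longrightarrow> \<exists>p\<in>insert 0 {p \<in> H. fst p = 0}. v + p \<in> Z0"
    using subgroup_avoiding[OF finH H(1) s0, of "{p \<in> H. fst p = 0}"] add_subgroup_0[OF H(1)]
    by (metis (no_types, lifting) Int_lower1 empty_subsetI insert_subset)
  have GG': "finite (G \<times> G')" "add_subgroup (G \<times> G')"
    using G G' by (auto simp: add_subgroup_def zero_prod_def)
  obtain Z where Z: "add_subgroup Z" "Z0 \<subseteq> Z" "Z \<subseteq> G \<times> G'" "Z \<inter> ({0} \<times> G') \<subseteq> {0}"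
    "\<And>v. v \<in> G \<times> G' \<Longrightarrow> \<exists>p\<in>insert 0 ({0} \<times> G'). v + p \<in> Z"
  proof -
    have "Z0 \<subseteq> G \<times> G'" using Z0 H by blast
    moreover have "Z0 \<inter> {0} \<times> G' \<subseteq> {0}" using Z0 by auto
    ultimately show thesis
      using subgroup_avoiding[OF GG' Z0(1), of "{0} \<times> G'"] that by metis
  qed
  have ex: "\<exists>a. (y, a) \<in> Z" if "y \<in> G" for y
    using Z(5)[of "(y, 0)"] that add_subgroup_0[OF G'(2)] by (auto simp: zero_prod_def)
  have uniq: "a = b" if "(y, a) \<in> Z" "(y, b) \<in> Z" for y a b
  proof -
    have "(0, a + b) \<in> Z" using add_subgroup_add[OF Z(1) that] by simp
    then have "a + b = 0" using Z(3,4) by (auto simp: zero_prod_def)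
    then show ?thesis by (simp add: add_eq_0_iff_eq)
  qed
  define L where "L y = (SOME a. (y, a) \<in> Z)" for y
  have L: "(y, L y) \<in> Z" if "y \<in> G" for y
    unfolding L_def by (rule someI_ex[OF ex[OF that]])
  have L_eq: "L y = a" if "(y, a) \<in> Z" for y a
    using uniq[OF that] L[of y] that Z(3) by blast
  show ?thesis
  proof (rule that)
    show "L x \<in> G'" if "x \<in> G" for x using L[OF that] Z(3) by blast
    show "L (x + y) = L x + L y" if "x \<in> G" "y \<in> G" for x y
      by (rule L_eq) (use add_subgroup_add[OF Z(1) L[OF that(1)] L[OF that(2)]] in simp)
    fix y a assume ya: "(y, a) \<in> H"
    obtain p where p: "p = 0 \<or> (p \<in> H \<and> fst p = 0)" "(y, a) + p \<in> Z0"
      using Z0(4)[OF ya] by blast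
    then have pH: "p \<in> H" and "fst p = 0" using add_subgroup_0[OF H(1)] by auto
    then obtain u where u: "p = (0, u)" by (cases p) auto
    have "(y, a + u) \<in> Z" using p(2) Z(2) u by auto
    then have "L y = a + u" by (rule L_eq)
    then show "(0, a + L y) \<in> H" using pH u by simp
  qed
qed

lemma card_direct_sum:
  fixes A H :: "'a::exponent_two_group set"
  assumes "\<And>a a'. a \<in> A \<Longrightarrow> a' \<in> A \<Longrightarrow> a + a' \<in> H \<Longrightarrow> a = a'" "add_subgroup H"
  shows "card (A + H) = card A * card H"
proof -
  have "inj_on (\<lambda>(a, h). a + h) (A \<times> H)"
  proof (rule inj_onI, clarify)
    fix a h a' h' assume *: "a \<in> A" "h \<in> H" "a' \<in> A" "h' \<in> H" "a + h = a' + h'"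
    then have "a + a' = h + h'" by (metis add.assoc add.commute add_self_left)
    then have "a = a'" using assms * add_subgroup_add by metis
    with * show "a = a' \<and> h = h'" by simp
  qed
  moreover have "A + H = (\<lambda>(a, h). a + h) ` (A \<times> H)"
    by (auto simp: set_plus_def)
  ultimately show ?thesis by (simp add: card_image card_cartesian_product)
qed

lemma card_set_plus_le:
  fixes A B :: "'a::ab_group_add set"
  assumes "finite A" "finite B"
  shows "card (A + B) \<le> card A * card B"
proof -
  have "A + B = (\<lambda>(a, b). a + b) ` (A \<times> B)"
    by (auto simp: set_plus_def)
  then show ?thesis
    using card_image_le[of "A \<times> B" "\<lambda>(a, b). a + b"] assms by (simp add: card_cartesian_product)
qed

section \<open>Sumset estimates\<close>

lemma card_translate: "card ((\<lambda>y. x + y) ` A) = card A" for x :: "'a::ab_group_add"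
  by (intro card_image inj_onI) simp

text \<open>Petridis' argument: choose \<open>X\<close> to minimise the ratio of
  \<open>card (X + S)\<close> to \<open>card X\<close> among nonempty subsets of \<open>S\<close>,
  and induct on \<open>C\<close>.\<close>

lemma petridis:
  fixes S :: "'a::ab_group_add set" and K :: real
  assumes S: "finite S" "S \<noteq> {}" and K: "real (card (S + S)) \<le> K * real (card S)"
  obtains X where "X \<subseteq> S" "X \<noteq> {}"
    "\<And>C. finite C \<Longrightarrow> real (card (X + S + C)) \<le> K * real (card (X + C))"
proof -
  define q where "q X = real (card (X + S)) / real (card X)" for X
  define F where "F = Pow S - {{}}"
  have "finite F" "F \<noteq> {}" using S by (auto simp: F_def)
  then obtain X where X: "X \<in> F" and min: "\<And>Y. Y \<in> F \<Longrightarrow> q X \<le> q Y"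
    using arg_min_least[where f=q and S=F] arg_min_if_finite(1)[where f=q and S=F] by blast
  have finX: "finite X" and X0: "X \<noteq> {}" and XS: "X \<subseteq> S" using X S by (auto simp: F_def intro: finite_subset)
  define k where "k = q X"
  have k0: "k \<ge> 0" by (simp add: k_def q_def)
  have kX: "real (card (X + S)) = k * real (card X)"
    using finX X0 by (simp add: k_def q_def)
  have kY: "k * real (card Y) \<le> real (card (Y + S))" if "Y \<subseteq> X" for Y
  proof (cases "Y = {}")
    case False
    have "finite Y" using that finX finite_subset by blast
    moreover have "k \<le> q Y" unfolding k_def by (rule min) (use that XS False in \<open>auto simp: F_def\<close>)
    ultimately show ?thesis using False by (simp add: q_def pos_le_divide_eq card_gt_0_iff)
  qed simp
  have "S \<in> F" using S by (auto simp: F_def)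
  then have "k \<le> q S" unfolding k_def by (rule min)
  also have "q S \<le> K"
  proof -
    have "0 < real (card S)" using S by (simp add: card_gt_0_iff)
    then show ?thesis unfolding q_def using K by (subst pos_divide_le_eq)
  qed
  finally have kK: "k \<le> K" .
  have main: "real (card (X + S + C)) \<le> k * real (card (X + C))" if "finite C" for C
    using that
  proof (induction C rule: finite_induct)
    case empty
    show ?case by (simp add: set_plus_def)
  next
    case (insert x C)
    \<comment> \<open>When \<open>x\<close> joins \<open>C\<close>, the points
      \<open>x + y + s\<close> with \<open>y\<close> in \<open>Y\<close> already lie in
      \<open>X + S + C\<close>, while \<open>X + C\<close> gains exactly the translate by
      \<open>x\<close> of the difference set \<open>X - Y\<close>. Minimality applied to
      \<open>Y\<close> balances the two changes.\<close>
    define Y where "Y = {y \<in> X. x + y \<in> X + C}"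
    have YX: "Y \<subseteq> X" by (auto simp: Y_def)
    have finS: "finite (X + C)" "finite (X + S + C)" "finite (X + S)"
      using finX S insert by (auto intro!: finite_set_plus)
    have "X + S + insert x C \<subseteq> (X + S + C) \<union> ((\<lambda>y. x + y) ` (X + S) - (\<lambda>y. x + y) ` (Y + S))"
    proof
      fix z assume "z \<in> X + S + insert x C"
      then obtain a s c where *: "a \<in> X" "s \<in> S" "c \<in> insert x C" "z = a + s + c"
        by (auto simp: set_plus_def)
      show "z \<in> (X + S + C) \<union> ((\<lambda>y. x + y) ` (X + S) - (\<lambda>y. x + y) ` (Y + S))"
      proof (cases "z \<in> X + S + C")
        case False
        have "c = x" using * False by auto
        then have "z = x + (a + s)" using * by (simp add: ac_simps)
        moreover have "z \<notin> (\<lambda>y. x + y) ` (Y + S)"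
        proof
          assume "z \<in> (\<lambda>y. x + y) ` (Y + S)"
          then obtain y t where y: "y \<in> Y" "t \<in> S" "z = x + (y + t)" by (auto simp: set_plus_def)
          then obtain a' c' where "x + y = a' + c'" "a' \<in> X" "c' \<in> C"
            by (auto simp: Y_def set_plus_def)
          then have "z = (a' + t) + c'" using y by (metis add.assoc add.commute)
          then show False using False \<open>a' \<in> X\<close> \<open>c' \<in> C\<close> y(2) by blast
        qed
        ultimately show ?thesis using * by auto
      qed simp
    qed
    then have "card (X + S + insert x C)
        \<le> card ((X + S + C) \<union> ((\<lambda>y. x + y) ` (X + S) - (\<lambda>y. x + y) ` (Y + S)))"
      by (rule card_mono[rotated]) (use finS in auto)
    also have "\<dots> \<le> card (X + S + C) + card ((\<lambda>y. x + y) ` (X + S) - (\<lambda>y. x + y) ` (Y + S))"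
      by (rule card_Un_le)
    also have "card ((\<lambda>y. x + y) ` (X + S) - (\<lambda>y. x + y) ` (Y + S)) = card (X + S) - card (Y + S)"
    proof (subst card_Diff_subset)
      have "Y + S \<subseteq> X + S" using YX by (rule set_plus_mono2) simp
      then show "(\<lambda>y. x + y) ` (Y + S) \<subseteq> (\<lambda>y. x + y) ` (X + S)" "finite ((\<lambda>y. x + y) ` (Y + S))"
        using finS(3) by (auto intro: finite_subset)
    qed (simp add: card_translate)
    also have "real (card (X + S + C) + (card (X + S) - card (Y + S)))
        = real (card (X + S + C)) + (real (card (X + S)) - real (card (Y + S)))"
      using card_mono[OF finS(3) set_plus_mono2[OF YX order_refl, of S]] by simp
    finally have 1: "real (card (X + S + insert x C))
        \<le> real (card (X + S + C)) + (real (card (X + S)) - real (card (Y + S)))"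
      by simp
    have "X + insert x C = (X + C) \<union> (\<lambda>y. x + y) ` (X - Y)"
      unfolding Y_def set_plus_def by (auto simp: add.commute)
    moreover have "(X + C) \<inter> (\<lambda>y. x + y) ` (X - Y) = {}"
      by (auto simp: Y_def)
    ultimately have "card (X + insert x C) = card (X + C) + card (X - Y)"
      using finS finX by (simp add: card_Un_disjoint card_translate)
    then have 2: "real (card (X + insert x C)) = real (card (X + C)) + (real (card X) - real (card Y))"
      using card_mono[OF finX YX] by (simp add: card_Diff_subset[OF finite_subset[OF YX finX] YX] of_nat_diff)
    have "real (card (X + S + C)) + (real (card (X + S)) - real (card (Y + S)))
        \<le> k * real (card (X + C)) + (k * real (card X) - k * real (card Y))"
      using insert.IH kX kY[OF YX] by simp
    also have "\<dots> = k * real (card (X + insert x C))"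
      unfolding 2 by (simp add: right_diff_distrib distrib_left)
    finally show ?case using 1 by linarith
  qed
  show ?thesis
  proof (rule that[OF XS X0])
    fix C :: "'a set" assume "finite C"
    from main[OF this] show "real (card (X + S + C)) \<le> K * real (card (X + C))"
      by (meson kK mult_right_mono of_nat_0_le_iff order_trans)
  qed
qed

primrec iter_sumset :: "nat \<Rightarrow> 'a::comm_monoid_add set \<Rightarrow> 'a set"
  where "iter_sumset 0 S = {0}"
  | "iter_sumset (Suc k) S = S + iter_sumset k S"

lemma finite_iter_sumset: "finite S \<Longrightarrow> finite (iter_sumset k S)"
  by (induction k) (auto intro: finite_set_plus)

text \<open>Pluennecke's inequality: by \<open>petridis\<close> each summand \<open>S\<close> added
  to \<open>X\<close> costs one factor \<open>K\<close>, and \<open>X + iter_sumset k S\<close>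
  contains a translate of \<open>iter_sumset k S\<close>.\<close>

lemma card_iter_sumset_le:
  fixes S :: "'a::ab_group_add set" and K :: real
  assumes S: "finite S" "S \<noteq> {}" and K: "real (card (S + S)) \<le> K * real (card S)" "K \<ge> 1"
  shows "real (card (iter_sumset k S)) \<le> K ^ k * real (card S)"
proof -
  obtain X where X: "X \<subseteq> S" "X \<noteq> {}"
    "\<And>C. finite C \<Longrightarrow> real (card (X + S + C)) \<le> K * real (card (X + C))"
    using petridis[OF S K(1)] by metis
  have finX: "finite X" using X S finite_subset by blast
  have *: "real (card (X + iter_sumset k S)) \<le> K ^ k * real (card X)" for k
  proof (induction k)
    case 0
    show ?case by (simp add: set_plus_def)
  next
    case (Suc k)
    have "real (card (X + iter_sumset (Suc k) S)) = real (card (X + S + iter_sumset k S))"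
      by (simp add: add.assoc)
    also have "\<dots> \<le> K * real (card (X + iter_sumset k S))"
      by (rule X(3)[OF finite_iter_sumset[OF S(1)]])
    also have "\<dots> \<le> K * (K ^ k * real (card X))"
      by (rule mult_left_mono[OF Suc]) (use K in simp)
    finally show ?case by simp
  qed
  obtain x where x: "x \<in> X" using X by blast
  have "card (iter_sumset k S) = card ((\<lambda>y. x + y) ` iter_sumset k S)"
    by (simp add: card_translate)
  also have "\<dots> \<le> card (X + iter_sumset k S)"
    by (rule card_mono) (use x finX finite_iter_sumset[OF S(1)] in \<open>auto intro!: finite_set_plus\<close>)
  finally have "real (card (iter_sumset k S)) \<le> K ^ k * real (card X)"
    using *[of k] by linarith
  also have "\<dots> \<le> K ^ k * real (card S)"
    by (intro mult_left_mono) (use X S K in \<open>auto intro: card_mono\<close>)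
  finally show ?thesis .
qed

section \<open>The Balog--Szemeredi--Gowers theorem\<close>

text \<open>Choosing \<open>p\<close> in \<open>P\<close> fixes the other summand
  \<open>x + p\<close>, so the cardinality counts the representations of \<open>x\<close> as an
  ordered sum of two elements of \<open>P\<close>.\<close>

definition popular_sums :: "'a::exponent_two_group set \<Rightarrow> real \<Rightarrow> 'a set"
  where "popular_sums P t = {x. t \<le> real (card {p \<in> P. x + p \<in> P})}"

text \<open>Each popular \<open>x\<close> owns at least \<open>t\<close> pairs
  \<open>(p, x + p)\<close> in \<open>P \<times> P\<close>, and different \<open>x\<close> own
  different pairs.\<close>

lemma card_popular_sums:
  fixes P :: "'a::exponent_two_group set"
  assumes P: "finite P" and t: "t > 0"
  shows "finite (popular_sums P t)" "real (card (popular_sums P t)) \<le> (real (card P))\<^sup>2 / t"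
proof -
  let ?D = "popular_sums P t"
  have "?D \<subseteq> P + P"
  proof
    fix x assume "x \<in> ?D"
    then have "card {p \<in> P. x + p \<in> P} \<noteq> 0" using t by (auto simp only: popular_sums_def mem_Collect_eq)
    then have "{p \<in> P. x + p \<in> P} \<noteq> {}" by (metis card.empty)
    then obtain p where p: "p \<in> P" "x + p \<in> P" by blast
    then have "(x + p) + p \<in> P + P" by blast
    then show "x \<in> P + P" by (simp add: add.assoc)
  qed
  then show fin: "finite ?D" using finite_set_plus[OF P P] finite_subset by blast
  have "t * real (card ?D) = (\<Sum>x\<in>?D. t)" by simp
  also have "\<dots> \<le> (\<Sum>x\<in>?D. real (card {p \<in> P. x + p \<in> P}))"
    by (rule sum_mono) (simp add: popular_sums_def)
  also have "\<dots> = real (card (SIGMA x:?D. {p \<in> P. x + p \<in> P}))"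
    using fin P by (simp add: card_SigmaI)
  also have "\<dots> \<le> real (card (P \<times> P))"
  proof (rule of_nat_mono, rule card_inj_on_le)
    show "inj_on (\<lambda>(x, p). (p, x + p)) (SIGMA x:?D. {p \<in> P. x + p \<in> P})"
      by (auto simp: inj_on_def)
  qed (use P in auto)
  finally show "real (card ?D) \<le> (real (card P))\<^sup>2 / t"
    using t by (simp add: field_simps power2_eq_square card_cartesian_product)
qed

lemma sum_card_swap:
  assumes "finite A" "finite B"
  shows "(\<Sum>a\<in>A. card {b \<in> B. R a b}) = (\<Sum>b\<in>B. card {a \<in> A. R a b})"
proof -
  have "(\<Sum>a\<in>A. card {b \<in> B. R a b}) = (\<Sum>a\<in>A. \<Sum>b\<in>B. if R a b then 1 else 0)"
    using assms by (simp add: sum.If_cases Int_def)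
  also have "\<dots> = (\<Sum>b\<in>B. \<Sum>a\<in>A. if R a b then 1 else 0)"
    by (rule sum.swap)
  also have "\<dots> = (\<Sum>b\<in>B. card {a \<in> A. R a b})"
    using assms by (simp add: sum.If_cases Int_def)
  finally show ?thesis .
qed

lemma power2_sum_le:
  fixes f :: "'a \<Rightarrow> real"
  assumes "finite A"
  shows "(sum f A)\<^sup>2 \<le> real (card A) * (\<Sum>a\<in>A. (f a)\<^sup>2)"
  using Cauchy_Schwarz_ineq_sum[of f "\<lambda>_. 1" A] by (simp add: mult.commute)

text \<open>A common neighbour \<open>v\<close> yields the representation
  \<open>a + b = (a + v) + (b + v)\<close>; vertices with many common neighbours thus have a popular
  sum.\<close>

lemma card_vertex_codegree:
  fixes A :: "'a::exponent_two_group set"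
  assumes "finite D"
  shows "card {v \<in> A. a + v \<in> D \<and> b + v \<in> D} \<le> card {p \<in> D. (a + b) + p \<in> D}"
proof (rule card_inj_on_le)
  show "inj_on ((+) a) {v \<in> A. a + v \<in> D \<and> b + v \<in> D}" by (auto simp: inj_on_def)
  have "(a + b) + (a + v) = b + v" for v by (metis add.assoc add.commute add_self_left)
  then show "(+) a ` {v \<in> A. a + v \<in> D \<and> b + v \<in> D} \<subseteq> {p \<in> D. (a + b) + p \<in> D}"
    by (auto simp only: image_iff mem_Collect_eq)
qed (use assms in simp)

text \<open>
  Dependent random choice in the Cayley graph of the popular sums \<open>D1\<close>: for a suitable vertex \<open>v\<close>, all
  but few pairs of neighbours of \<open>v\<close> differ by an element of \<open>D2\<close>, a popular sum of popular sums.
\<close>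

theorem balog_szemeredi_gowers:
  fixes A :: "'a::exponent_two_group set" and k :: real
  assumes A: "finite A" "A \<noteq> {}" and k: "k > 0"
    and energy: "k * real (card A) ^ 3 \<le> (\<Sum>a\<in>A. \<Sum>b\<in>A. real (card {c \<in> A. a + b + c \<in> A}))"
  obtains B where "B \<subseteq> A" "real (card B) \<ge> k / 8 * real (card A)"
    "real (card (B + B)) \<le> 2 ^ 19 / k ^ 9 * real (card A)"
proof -
  define m where "m = real (card A)"
  have m: "m > 0" using A by (simp add: m_def card_gt_0_iff)
  define D1 where "D1 = popular_sums A (k * m / 2)"
  have D1: "finite D1" "real (card D1) \<le> 2 * m / k"
    using card_popular_sums[OF A(1), of "k * m / 2"] m k
    by (auto simp: D1_def field_simps power2_eq_square simp flip: m_def)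
  define D2 where "D2 = popular_sums D1 (k\<^sup>2 * m / 64)"
  have D2: "finite D2" "real (card D2) \<le> 256 * m / k ^ 4"
  proof -
    show "finite D2" using card_popular_sums[OF D1(1), of "k\<^sup>2 * m / 64"] m k by (simp add: D2_def)
    have "real (card D2) \<le> (real (card D1))\<^sup>2 / (k\<^sup>2 * m / 64)"
      using card_popular_sums[OF D1(1), of "k\<^sup>2 * m / 64"] m k by (simp add: D2_def)
    also have "\<dots> \<le> (2 * m / k)\<^sup>2 / (k\<^sup>2 * m / 64)"
      by (intro divide_right_mono power_mono D1) (use m k in auto)
    also have "\<dots> = 256 * m / k ^ 4"
      using m k by (simp add: field_simps power2_eq_square eval_nat_numeral)
    finally show "real (card D2) \<le> 256 * m / k ^ 4" .
  qed
  define N where "N v = {a \<in> A. a + v \<in> D1}" for v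
  have finN: "finite (N v)" for v using A by (simp add: N_def)
  define bad where "bad v = (\<Sum>a\<in>N v. card {b \<in> N v. a + b \<notin> D2})" for v
  \<comment> \<open>Pairs with \<open>a + b\<close> outside \<open>D1\<close> carry at most half of
    the energy, and each remaining pair carries at most \<open>m\<close>.\<close>
  have edges: "k * m\<^sup>2 / 2 \<le> (\<Sum>v\<in>A. real (card (N v)))"
  proof -
    have "k * m ^ 3 \<le> (\<Sum>a\<in>A. \<Sum>b\<in>A. real (card {c \<in> A. a + b + c \<in> A}))"
      using energy by (simp add: m_def)
    also have "\<dots> \<le> (\<Sum>a\<in>A. \<Sum>b\<in>A. k * m / 2 + (if a + b \<in> D1 then m else 0))"
    proof (intro sum_mono)
      fix a b
      have "real (card {c \<in> A. a + b + c \<in> A}) \<le> m"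
        unfolding m_def by (intro of_nat_mono card_mono) (use A in auto)
      then show "real (card {c \<in> A. a + b + c \<in> A}) \<le> k * m / 2 + (if a + b \<in> D1 then m else 0)"
        using mult_pos_pos[OF k m] by (auto simp: D1_def popular_sums_def)
    qed
    also have "\<dots> = k * m ^ 3 / 2 + m * (\<Sum>a\<in>A. real (card (N a)))"
      using A by (simp add: sum.distrib sum.If_cases N_def Int_def add.commute sum_distrib_left
          power2_eq_square eval_nat_numeral mult_ac flip: m_def)
    finally have "k * m ^ 3 / 2 \<le> m * (\<Sum>a\<in>A. real (card (N a)))" by simp
    then show ?thesis using m by (simp add: eval_nat_numeral mult_ac)
  qed
  \<comment> \<open>A pair with \<open>a + b\<close> outside \<open>D2\<close> has fewer than
    \<open>k\<^sup>2 * m / 64\<close> common neighbours, so it is counted for few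
    \<open>v\<close>.\<close>
  have sumbad: "(\<Sum>v\<in>A. real (bad v)) \<le> k\<^sup>2 * m ^ 3 / 64"
  proof -
    have "(\<Sum>v\<in>A. real (bad v)) = (\<Sum>v\<in>A. \<Sum>a\<in>A. \<Sum>b\<in>A.
        if a + v \<in> D1 \<and> b + v \<in> D1 \<and> a + b \<notin> D2 then 1 else 0)"
    proof (rule sum.cong[OF refl])
      fix v
      have *: "real (card {b \<in> N v. a + b \<notin> D2}) = (\<Sum>b\<in>A. if b + v \<in> D1 \<and> a + b \<notin> D2 then 1 else 0)" for a
        using A by (simp add: sum.If_cases N_def Int_def conj_ac)
      have "real (bad v) = (\<Sum>a\<in>A. if a + v \<in> D1 then \<Sum>b\<in>A. if b + v \<in> D1 \<and> a + b \<notin> D2 then 1 else 0 else 0)"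
        unfolding bad_def of_nat_sum * using A by (simp only: sum.inter_filter N_def)
      also have "\<dots> = (\<Sum>a\<in>A. \<Sum>b\<in>A. if a + v \<in> D1 \<and> b + v \<in> D1 \<and> a + b \<notin> D2 then 1 else 0)"
        by (intro sum.cong) auto
      finally show "real (bad v) = (\<Sum>a\<in>A. \<Sum>b\<in>A. if a + v \<in> D1 \<and> b + v \<in> D1 \<and> a + b \<notin> D2 then 1 else 0)" .
    qed
    also have "\<dots> = (\<Sum>a\<in>A. \<Sum>v\<in>A. \<Sum>b\<in>A. if a + v \<in> D1 \<and> b + v \<in> D1 \<and> a + b \<notin> D2 then 1 else 0)"
      by (rule sum.swap)
    also have "\<dots> = (\<Sum>a\<in>A. \<Sum>b\<in>A. \<Sum>v\<in>A. if a + v \<in> D1 \<and> b + v \<in> D1 \<and> a + b \<notin> D2 then 1 else 0)"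
      by (intro sum.cong refl sum.swap)
    also have "\<dots> \<le> (\<Sum>a\<in>A. \<Sum>b\<in>A. k\<^sup>2 * m / 64)"
    proof (intro sum_mono)
      fix a b
      show "(\<Sum>v\<in>A. if a + v \<in> D1 \<and> b + v \<in> D1 \<and> a + b \<notin> D2 then 1 else 0) \<le> k\<^sup>2 * m / 64"
      proof (cases "a + b \<in> D2")
        case False
        then have "real (card {v \<in> A. a + v \<in> D1 \<and> b + v \<in> D1}) \<le> k\<^sup>2 * m / 64"
          using card_vertex_codegree[OF D1(1), of A a b] by (auto simp: D2_def popular_sums_def)
        then show ?thesis using False A by (simp add: sum.If_cases Int_def)
      qed (use m in simp)
    qed
    also have "\<dots> = k\<^sup>2 * m ^ 3 / 64"
      by (simp add: eval_nat_numeral mult_ac flip: m_def)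
    finally show ?thesis .
  qed
  \<comment> \<open>By Cauchy--Schwarz the squared degrees sum to at least
    \<open>k\<^sup>2 * m ^ 3 / 4\<close>, and eight times the bad pairs account for at most half of
    that. The weight 8 ensures that at most one eighth of the pairs of neighbours of
    \<open>v\<close> are bad.\<close>
  have "\<exists>v\<in>A. (real (card (N v)))\<^sup>2 - 8 * real (bad v) \<ge> k\<^sup>2 * m\<^sup>2 / 8"
  proof (rule ccontr)
    assume "\<not> ?thesis"
    then have "(\<Sum>v\<in>A. (real (card (N v)))\<^sup>2 - 8 * real (bad v)) < (\<Sum>v\<in>A. k\<^sup>2 * m\<^sup>2 / 8)"
      by (intro sum_strict_mono) (use A in auto)
    then have "(\<Sum>v\<in>A. (real (card (N v)))\<^sup>2) < m * (k\<^sup>2 * m\<^sup>2 / 8) + 8 * (\<Sum>v\<in>A. real (bad v))"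
      by (simp add: sum_subtractf sum_distrib_left flip: m_def)
    also have "\<dots> \<le> m * (k\<^sup>2 * m\<^sup>2 / 8) + 8 * (k\<^sup>2 * m ^ 3 / 64)" using sumbad by simp
    also have "\<dots> = k\<^sup>2 * m ^ 3 / 4" by (simp add: field_simps eval_nat_numeral)
    finally have "m * (\<Sum>v\<in>A. (real (card (N v)))\<^sup>2) < m * (k\<^sup>2 * m ^ 3 / 4)"
      using m by (rule mult_strict_left_mono)
    also have "\<dots> = (k * m\<^sup>2 / 2)\<^sup>2" by (simp add: field_simps eval_nat_numeral)
    also have "\<dots> \<le> (\<Sum>v\<in>A. real (card (N v)))\<^sup>2"
      by (intro power_mono edges) (use k m in simp)
    also have "\<dots> \<le> m * (\<Sum>v\<in>A. (real (card (N v)))\<^sup>2)"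
      unfolding m_def by (rule power2_sum_le[OF A(1)])
    finally show False by simp
  qed
  then obtain v where v: "v \<in> A" "(real (card (N v)))\<^sup>2 - 8 * real (bad v) \<ge> k\<^sup>2 * m\<^sup>2 / 8" by blast
  define U where "U = N v"
  define u where "u = real (card U)"
  have finU: "finite U" and UA: "U \<subseteq> A" using finN by (auto simp: U_def N_def)
  have u2: "k\<^sup>2 * m\<^sup>2 / 8 \<le> u\<^sup>2" using v by (simp add: u_def U_def)
  moreover have "(k * m / 4)\<^sup>2 = k\<^sup>2 * m\<^sup>2 / 16" by (simp add: power_mult_distrib power_divide)
  ultimately have "(k * m / 4)\<^sup>2 \<le> u\<^sup>2" using zero_le_power2[of u] by linarith
  then have u_ge: "k * m / 4 \<le> u" by (rule power2_le_imp_le) (simp add: u_def)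
  then have u: "u > 0" using k m by (smt (verit) divide_pos_pos mult_pos_pos)
  have bad_le: "real (bad v) \<le> u\<^sup>2 / 8"
  proof -
    have "0 \<le> k\<^sup>2 * m\<^sup>2 / 8" by simp
    then show ?thesis using v(2) unfolding u_def U_def by linarith
  qed
  \<comment> \<open>Dropping the vertices whose bad partners exceed a quarter of \<open>U\<close>
    leaves half of \<open>U\<close>; two remaining vertices share at least \<open>u / 2\<close> good
    partners, which makes their sum popular over \<open>D2\<close>.\<close>
  define B where "B = {a \<in> U. real (card {b \<in> U. a + b \<notin> D2}) \<le> u / 4}"
  have BU: "B \<subseteq> U" by (auto simp: B_def)
  have cardB: "real (card B) \<ge> u / 2"
  proof -
    have "u / 4 * real (card (U - B)) = (\<Sum>a\<in>U - B. u / 4)" by simp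
    also have "\<dots> \<le> (\<Sum>a\<in>U - B. real (card {b \<in> U. a + b \<notin> D2}))"
      by (rule sum_mono) (auto simp: B_def)
    also have "\<dots> \<le> (\<Sum>a\<in>U. real (card {b \<in> U. a + b \<notin> D2}))"
      by (rule sum_mono2) (use finU in auto)
    also have "\<dots> = real (bad v)" by (simp add: bad_def U_def)
    finally have "u / 4 * real (card (U - B)) \<le> u / 4 * (u / 2)"
      using bad_le by (simp add: power2_eq_square)
    then have "real (card (U - B)) \<le> u / 2" using u by simp
    moreover have "real (card (U - B)) = u - real (card B)"
      using BU finU by (simp add: u_def card_Diff_subset finite_subset[OF BU] card_mono of_nat_diff)
    ultimately show ?thesis by simp
  qed
  define D3 where "D3 = popular_sums D2 (u / 2)"
  have D3: "finite D3" "real (card D3) \<le> (real (card D2))\<^sup>2 / (u / 2)"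
    using card_popular_sums[OF D2(1), of "u / 2"] u by (auto simp: D3_def)
  have "B + B \<subseteq> D3"
  proof
    fix x assume "x \<in> B + B"
    then obtain a b where ab: "a \<in> B" "b \<in> B" "x = a + b" by (auto simp: set_plus_def)
    have "U \<subseteq> {c \<in> U. a + c \<in> D2 \<and> b + c \<in> D2} \<union> ({c \<in> U. a + c \<notin> D2} \<union> {c \<in> U. b + c \<notin> D2})"
      by auto
    then have "card U \<le> card ({c \<in> U. a + c \<in> D2 \<and> b + c \<in> D2} \<union> ({c \<in> U. a + c \<notin> D2} \<union> {c \<in> U. b + c \<notin> D2}))"
      by (rule card_mono[rotated]) (use finU in auto)
    also have "\<dots> \<le> card {c \<in> U. a + c \<in> D2 \<and> b + c \<in> D2} + (card {c \<in> U. a + c \<notin> D2} + card {c \<in> U. b + c \<notin> D2})"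
      by (meson add_left_mono card_Un_le order_trans)
    finally have "u \<le> real (card {c \<in> U. a + c \<in> D2 \<and> b + c \<in> D2}) + (u / 4 + u / 4)"
      using ab by (simp add: B_def u_def)
    then have "u / 2 \<le> real (card {c \<in> U. a + c \<in> D2 \<and> b + c \<in> D2})" by simp
    also have "\<dots> \<le> real (card {p \<in> D2. x + p \<in> D2})"
      unfolding ab(3) by (rule of_nat_mono) (rule card_vertex_codegree[OF D2(1)])
    finally show "x \<in> D3" by (simp add: D3_def popular_sums_def)
  qed
  then have "real (card (B + B)) \<le> real (card D3)" by (intro of_nat_mono card_mono D3)
  also have "\<dots> \<le> (real (card D2))\<^sup>2 / (u / 2)" by (rule D3)
  also have "\<dots> \<le> (256 * m / k ^ 4)\<^sup>2 / (k * m / 4 / 2)"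
  proof (rule frac_le)
    show "(real (card D2))\<^sup>2 \<le> (256 * m / k ^ 4)\<^sup>2" by (intro power_mono D2) simp
    show "0 < k * m / 4 / 2" using k m by simp
    show "k * m / 4 / 2 \<le> u / 2" using u_ge by simp
  qed simp
  also have "\<dots> = 2 ^ 19 / k ^ 9 * m"
    using k m by (simp add: field_simps eval_nat_numeral)
  finally have "real (card (B + B)) \<le> 2 ^ 19 / k ^ 9 * m" .
  moreover have "real (card B) \<ge> k / 8 * m" using cardB u_ge by simp
  ultimately show ?thesis using that BU UA unfolding m_def by blast
qed

section \<open>Fourier analysis on groups of exponent two\<close>

definition sg :: "bit \<Rightarrow> real"
  where "sg b = (if b = 0 then 1 else - 1)"

lemma sg_0 [simp]: "sg 0 = 1" and sg_1 [simp]: "sg 1 = - 1"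
  by (simp_all add: sg_def)

lemma sg_add: "sg (a + b) = sg a * sg b"
  by (cases a; cases b) simp_all

lemma sg_mult_self [simp]: "sg a * sg a = 1"
  by (cases a) simp_all

lemma abs_sg [simp]: "\<bar>sg a\<bar> = 1"
  by (cases a) simp_all

lemma sg_power2 [simp]: "(sg a)\<^sup>2 = 1"
  by (cases a) simp_all

lemma sum_translate:
  fixes G :: "'a::exponent_two_group set"
  assumes "add_subgroup G" "a \<in> G"
  shows "(\<Sum>x\<in>G. f (x + a)) = (\<Sum>x\<in>G. f x)"
proof (rule sum.reindex_bij_witness[where i="\<lambda>x. x + a" and j="\<lambda>x. x + a"])
  show "x + a + a = x" for x by (simp add: add.assoc)
qed (use assms add_subgroup_add in auto)

text \<open>Translating by some \<open>a\<close> with \<open>\<phi> a = 1\<close> reverses the sign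
  of the sum.\<close>

lemma sum_sg_additive:
  fixes G :: "'a::exponent_two_group set"
  assumes G: "add_subgroup G" and ad: "\<And>x y. x \<in> G \<Longrightarrow> y \<in> G \<Longrightarrow> \<phi> (x + y) = \<phi> x + \<phi> y"
  shows "(\<Sum>x\<in>G. sg (\<phi> x)) = (if \<forall>x\<in>G. \<phi> x = 0 then real (card G) else 0)"
proof (cases "\<forall>x\<in>G. \<phi> x = 0")
  case False
  then obtain a where a: "a \<in> G" "\<phi> a = 1" by auto
  have "(\<Sum>x\<in>G. sg (\<phi> x)) = (\<Sum>x\<in>G. sg (\<phi> (x + a)))"
    by (rule sum_translate[OF G a(1), symmetric])
  also have "\<dots> = (\<Sum>x\<in>G. - sg (\<phi> x))"
    by (rule sum.cong) (use a ad in \<open>auto simp: sg_add\<close>)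
  finally have "(\<Sum>x\<in>G. sg (\<phi> x)) = 0" by (simp add: sum_negf)
  with False show ?thesis by auto
qed simp

text \<open>Unnormalised: sums instead of averages, so the powers of \<open>card G\<close> appear
  explicitly in all later statements.\<close>

definition fourier :: "'a set \<Rightarrow> ('a \<Rightarrow> 'a \<Rightarrow> bit) \<Rightarrow> ('a \<Rightarrow> real) \<Rightarrow> 'a \<Rightarrow> real"
  where "fourier G e f a = (\<Sum>x\<in>G. f x * sg (e a x))"

text \<open>The pairing identifies \<open>G\<close> with its dual, so frequencies are again elements
  of \<open>G\<close>. The locale is instantiated both with \<open>F2n n\<close> and with its
  square.\<close>

locale paired_group =
  fixes G :: "'a::exponent_two_group set" and e :: "'a \<Rightarrow> 'a \<Rightarrow> bit"
  assumes finite_G: "finite G" and subgroup_G: "add_subgroup G"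
    and e_commute: "e a x = e x a"
    and e_add_right: "e a (x + y) = e a x + e a y"
    and e_nondegenerate: "a \<in> G \<Longrightarrow> a \<noteq> 0 \<Longrightarrow> \<exists>x\<in>G. e a x = 1"
begin

lemma e_add_left: "e (a + b) x = e a x + e b x"
  by (simp add: e_commute[of _ x] e_add_right)

lemma e_0_right [simp]: "e a 0 = 0"
  using e_add_right[of a 0 0] by simp

lemma e_0_left [simp]: "e 0 a = 0"
  by (simp add: e_commute[of 0])

lemma card_G_pos: "0 < real (card G)"
  using finite_G add_subgroup_0[OF subgroup_G] by (auto simp: card_gt_0_iff)

lemma sum_sg_e:
  assumes "a \<in> G"
  shows "(\<Sum>x\<in>G. sg (e a x)) = (if a = 0 then real (card G) else 0)"
proof -
  have "(\<forall>x\<in>G. e a x = 0) \<longleftrightarrow> a = 0"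
    using e_nondegenerate[OF assms] by force
  then show ?thesis
    by (simp add: sum_sg_additive[OF subgroup_G] e_add_right)
qed

lemma fourier_inversion:
  assumes h: "h \<in> G"
  shows "(\<Sum>a\<in>G. fourier G e f a * sg (e a h)) = real (card G) * f h"
proof -
  have "(\<Sum>a\<in>G. fourier G e f a * sg (e a h)) = (\<Sum>a\<in>G. \<Sum>x\<in>G. f x * sg (e (x + h) a))"
    unfolding fourier_def sum_distrib_right
    by (intro sum.cong refl) (simp add: e_commute e_add_right sg_add)
  also have "\<dots> = (\<Sum>x\<in>G. \<Sum>a\<in>G. f x * sg (e (x + h) a))"
    by (rule sum.swap)
  also have "\<dots> = (\<Sum>x\<in>G. f x * (if x + h = 0 then real (card G) else 0))"
    by (rule sum.cong) (use h add_subgroup_add[OF subgroup_G] sum_sg_e in \<open>auto simp flip: sum_distrib_left\<close>)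
  also have "\<dots> = (\<Sum>x\<in>G. if x = h then real (card G) * f h else 0)"
    by (rule sum.cong) (auto simp: add_eq_0_iff_eq)
  also have "\<dots> = real (card G) * f h"
    using h finite_G by simp
  finally show ?thesis .
qed

lemma parseval: "(\<Sum>a\<in>G. (fourier G e f a)\<^sup>2) = real (card G) * (\<Sum>x\<in>G. (f x)\<^sup>2)"
proof -
  have "(\<Sum>a\<in>G. (fourier G e f a)\<^sup>2) = (\<Sum>a\<in>G. \<Sum>x\<in>G. f x * (fourier G e f a * sg (e a x)))"
    by (rule sum.cong) (simp_all add: power2_eq_square sum_distrib_left fourier_def[of G e f] mult_ac)
  also have "\<dots> = (\<Sum>x\<in>G. \<Sum>a\<in>G. f x * (fourier G e f a * sg (e a x)))"
    by (rule sum.swap)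
  also have "\<dots> = (\<Sum>x\<in>G. real (card G) * (f x)\<^sup>2)"
    by (rule sum.cong) (simp_all add: fourier_inversion power2_eq_square flip: sum_distrib_left)
  finally show ?thesis by (simp add: sum_distrib_left)
qed

lemma fourier_correlation:
  assumes "a \<in> G"
  shows "fourier G e (\<lambda>y. \<Sum>x\<in>G. f x * g (x + y)) a = fourier G e f a * fourier G e g a"
proof -
  have "fourier G e (\<lambda>y. \<Sum>x\<in>G. f x * g (x + y)) a = (\<Sum>y\<in>G. \<Sum>x\<in>G. f x * g (x + y) * sg (e a y))"
    by (simp add: fourier_def sum_distrib_right)
  also have "\<dots> = (\<Sum>x\<in>G. \<Sum>y\<in>G. f x * g (x + y) * sg (e a y))"
    by (rule sum.swap)
  also have "\<dots> = (\<Sum>x\<in>G. \<Sum>y\<in>G. f x * g y * sg (e a (x + y)))"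
  proof (rule sum.cong[OF refl])
    fix x assume x: "x \<in> G"
    have "(\<Sum>y\<in>G. f x * g (x + y) * sg (e a y)) = (\<Sum>y\<in>G. f x * g (x + (y + x)) * sg (e a (y + x)))"
      by (rule sum_translate[OF subgroup_G x, symmetric])
    also have "\<dots> = (\<Sum>y\<in>G. f x * g y * sg (e a (x + y)))"
      by (simp add: add.commute[of _ x])
    finally show "(\<Sum>y\<in>G. f x * g (x + y) * sg (e a y)) = (\<Sum>y\<in>G. f x * g y * sg (e a (x + y)))" .
  qed
  also have "\<dots> = fourier G e f a * fourier G e g a"
    by (simp add: fourier_def sum_product e_add_right sg_add mult_ac)
  finally show ?thesis .
qed

lemma sum_correlation_power2:
  "(\<Sum>y\<in>G. (\<Sum>x\<in>G. f x * g (x + y))\<^sup>2) = (\<Sum>a\<in>G. (fourier G e f a)\<^sup>2 * (fourier G e g a)\<^sup>2) / real (card G)"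
proof -
  have "real (card G) * (\<Sum>y\<in>G. (\<Sum>x\<in>G. f x * g (x + y))\<^sup>2) = (\<Sum>a\<in>G. (fourier G e f a)\<^sup>2 * (fourier G e g a)\<^sup>2)"
    by (simp add: fourier_correlation power_mult_distrib flip: parseval)
  then show ?thesis using card_G_pos by (simp add: nonzero_eq_divide_eq mult.commute)
qed

text \<open>Replacing \<open>r\<close> by \<open>r + p\<close> turns the sum over quadruples into
  the sum of the squared autocorrelations of \<open>w\<close>, and the transform of an
  autocorrelation is the square of the transform of \<open>w\<close>.\<close>

lemma sum_quadruples:
  "(\<Sum>p\<in>G. \<Sum>q\<in>G. \<Sum>r\<in>G. w p * w q * w r * w (p + q + r)) = (\<Sum>a\<in>G. (fourier G e w a) ^ 4) / real (card G)"
proof -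
  have "(\<Sum>p\<in>G. \<Sum>q\<in>G. \<Sum>r\<in>G. w p * w q * w r * w (p + q + r))
      = (\<Sum>p\<in>G. \<Sum>q\<in>G. \<Sum>r\<in>G. w p * w (p + r) * (w q * w (q + r)))"
  proof (rule sum.cong[OF refl], rule sum.cong[OF refl])
    fix p q assume p: "p \<in> G"
    have "(\<Sum>r\<in>G. w p * w q * w r * w (p + q + r)) = (\<Sum>r\<in>G. w p * w q * w (r + p) * w (p + q + (r + p)))"
      by (rule sum_translate[OF subgroup_G p, symmetric])
    also have "\<dots> = (\<Sum>r\<in>G. w p * w (p + r) * (w q * w (q + r)))"
    proof (rule sum.cong[OF refl])
      fix r
      have "p + q + (r + p) = q + r" by (metis add.assoc add.commute add_self_left)
      then have "w p * w q * w (r + p) * w (p + q + (r + p)) = w p * w q * w (p + r) * w (q + r)"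
        by (simp only: add.commute[of r p])
      then show "w p * w q * w (r + p) * w (p + q + (r + p)) = w p * w (p + r) * (w q * w (q + r))"
        by (simp only: mult_ac)
    qed
    finally show "(\<Sum>r\<in>G. w p * w q * w r * w (p + q + r)) = (\<Sum>r\<in>G. w p * w (p + r) * (w q * w (q + r)))" .
  qed
  also have "\<dots> = (\<Sum>p\<in>G. \<Sum>r\<in>G. \<Sum>q\<in>G. w p * w (p + r) * (w q * w (q + r)))"
    by (intro sum.cong refl sum.swap)
  also have "\<dots> = (\<Sum>r\<in>G. \<Sum>p\<in>G. \<Sum>q\<in>G. w p * w (p + r) * (w q * w (q + r)))"
    by (rule sum.swap)
  also have "\<dots> = (\<Sum>r\<in>G. (\<Sum>p\<in>G. w p * w (p + r))\<^sup>2)"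
    by (simp add: power2_eq_square sum_product)
  also have "\<dots> = (\<Sum>a\<in>G. (fourier G e w a) ^ 4) / real (card G)"
    by (simp add: sum_correlation_power2 flip: power_add)
  finally show ?thesis .
qed

end

lemma paired_group_prod:
  assumes "paired_group G e"
  shows "paired_group (G \<times> G) (\<lambda>p q. e (fst p) (fst q) + e (snd p) (snd q))"
proof -
  interpret paired_group G e by fact
  show ?thesis
  proof
    show "finite (G \<times> G)" using finite_G by simp
    show "add_subgroup (G \<times> G)"
      using subgroup_G by (auto simp: add_subgroup_def zero_prod_def)
    show "e (fst a) (fst x) + e (snd a) (snd x) = e (fst x) (fst a) + e (snd x) (snd a)" for a x
      by (simp add: e_commute[of "fst a"] e_commute[of "snd a"])
    show "e (fst a) (fst (x + y)) + e (snd a) (snd (x + y))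
        = e (fst a) (fst x) + e (snd a) (snd x) + (e (fst a) (fst y) + e (snd a) (snd y))" for a x y
      by (simp add: e_add_right ac_simps)
    fix a :: "'a \<times> 'a" assume a: "a \<in> G \<times> G" "a \<noteq> 0"
    show "\<exists>x\<in>G \<times> G. e (fst a) (fst x) + e (snd a) (snd x) = 1"
    proof (cases "fst a = 0")
      case True
      then have "snd a \<in> G" "snd a \<noteq> 0" using a by (auto simp: prod_eq_iff)
      then obtain x where "x \<in> G" "e (snd a) x = 1" using e_nondegenerate by blast
      then show ?thesis using add_subgroup_0[OF subgroup_G] by (intro bexI[of _ "(0, x)"]) auto
    next
      case False
      then obtain x where "x \<in> G" "e (fst a) x = 1" using e_nondegenerate[of "fst a"] a by auto
      then show ?thesis using add_subgroup_0[OF subgroup_G] by (intro bexI[of _ "(x, 0)"]) auto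
    qed
  qed
qed

definition dot :: "nat \<Rightarrow> (nat \<Rightarrow> bit) \<Rightarrow> (nat \<Rightarrow> bit) \<Rightarrow> bit"
  where "dot n a x = (\<Sum>i<n. a i * x i)"

definition unit_vec :: "nat \<Rightarrow> nat \<Rightarrow> bit"
  where "unit_vec i = (\<lambda>j. if j = i then 1 else 0)"

lemma unit_vec_in_F2n: "i < n \<Longrightarrow> unit_vec i \<in> F2n n"
  by (auto simp: unit_vec_def F2n_def)

lemma dot_unit_vec: "i < n \<Longrightarrow> dot n a (unit_vec i) = a i"
  by (simp add: dot_def unit_vec_def if_distrib cong: if_cong)

lemma add_subgroup_F2n: "add_subgroup (F2n n)"
  using F2.subspace_0[OF subspace_F2n] F2.subspace_add[OF subspace_F2n] by (auto simp: add_subgroup_def)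

lemma paired_group_F2n: "paired_group (F2n n) (dot n)"
proof
  show "finite (F2n n)" by (rule finite_F2n)
  show "add_subgroup (F2n n)" by (rule add_subgroup_F2n)
  show "dot n a x = dot n x a" for a x
    by (simp add: dot_def mult.commute)
  show "dot n a (x + y) = dot n a x + dot n a y" for a x y
    by (simp add: dot_def distrib_left sum.distrib)
  fix a assume a: "a \<in> F2n n" "a \<noteq> 0"
  then obtain i where i: "a i \<noteq> 0" by (auto simp: fun_eq_iff)
  then have "i < n" using a(1) unfolding F2n_def by (metis (mono_tags, lifting) mem_Collect_eq not_le)
  then show "\<exists>x\<in>F2n n. dot n a x = 1"
    using i by (intro bexI[of _ "unit_vec i"]) (simp_all add: dot_unit_vec unit_vec_in_F2n)
qed

section \<open>The spectrum of the derivatives\<close>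

text \<open>The autocorrelation at shift \<open>h\<close> of the derivative of \<open>F\<close> in
  direction \<open>y\<close>. The summand is the product of \<open>F\<close> over a parallelogram
  with sides \<open>y\<close> and \<open>h\<close>, hence symmetric in them; this symmetry is what
  makes the spectrum self-dual.\<close>

definition deriv_corr :: "nat \<Rightarrow> ((nat \<Rightarrow> bit) \<Rightarrow> real) \<Rightarrow> (nat \<Rightarrow> bit) \<Rightarrow> (nat \<Rightarrow> bit) \<Rightarrow> real"
  where "deriv_corr n F y h = (\<Sum>x\<in>F2n n. F x * F (x + y) * (F (x + h) * F (x + h + y)))"

text \<open>The weight \<open>W\<close> of the overview, taken on pairs because the energy estimates
  are applied to it in the graph space.\<close>

definition deriv_spec :: "nat \<Rightarrow> ((nat \<Rightarrow> bit) \<Rightarrow> real) \<Rightarrow> (nat \<Rightarrow> bit) \<times> (nat \<Rightarrow> bit) \<Rightarrow> real"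
  where "deriv_spec n F p = (fourier (F2n n) (dot n) (\<lambda>x. F x * F (x + fst p)) (snd p))\<^sup>2"

lemma deriv_corr_commute: "deriv_corr n F y h = deriv_corr n F h y"
  by (simp add: deriv_corr_def ac_simps)

context
  fixes n :: nat and F :: "(nat \<Rightarrow> bit) \<Rightarrow> real"
begin

interpretation paired_group "F2n n" "dot n" by (rule paired_group_F2n)

lemma deriv_spec_nonneg: "deriv_spec n F p \<ge> 0"
  by (simp add: deriv_spec_def)

lemma deriv_spec_eq_fourier:
  assumes "a \<in> F2n n"
  shows "deriv_spec n F (y, a) = fourier (F2n n) (dot n) (deriv_corr n F y) a"
  using fourier_correlation[OF assms, of "\<lambda>x. F x * F (x + y)" "\<lambda>x. F x * F (x + y)"]
  by (simp add: deriv_spec_def deriv_corr_def[abs_def] power2_eq_square)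

text \<open>Transforming in \<open>a\<close> recovers \<open>deriv_corr n F y h\<close> by
  inversion. Since this is symmetric, the remaining transform in \<open>y\<close> is again a
  spectrum, now of the derivative in direction \<open>h\<close>.\<close>

lemma fourier_deriv_spec:
  assumes "b \<in> F2n n" "h \<in> F2n n"
  shows "fourier (F2n n \<times> F2n n) (\<lambda>p q. dot n (fst p) (fst q) + dot n (snd p) (snd q)) (deriv_spec n F) (b, h)
    = real (card (F2n n)) * deriv_spec n F (h, b)"
proof -
  have "fourier (F2n n \<times> F2n n) (\<lambda>p q. dot n (fst p) (fst q) + dot n (snd p) (snd q)) (deriv_spec n F) (b, h)
    = (\<Sum>y\<in>F2n n. \<Sum>a\<in>F2n n. deriv_spec n F (y, a) * (sg (dot n b y) * sg (dot n h a)))"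
    by (simp add: fourier_def sum.cartesian_product sg_add case_prod_unfold)
  also have "\<dots> = (\<Sum>y\<in>F2n n. sg (dot n b y) * (\<Sum>a\<in>F2n n. fourier (F2n n) (dot n) (deriv_corr n F y) a * sg (dot n a h)))"
    by (simp add: deriv_spec_eq_fourier sum_distrib_left mult_ac e_commute[of h])
  also have "\<dots> = (\<Sum>y\<in>F2n n. real (card (F2n n)) * (deriv_corr n F h y * sg (dot n b y)))"
    unfolding fourier_inversion[OF assms(2)] by (intro sum.cong refl) (simp only: deriv_corr_commute[of n F h] mult_ac)
  also have "\<dots> = real (card (F2n n)) * deriv_spec n F (h, b)"
    by (simp add: deriv_spec_eq_fourier[OF assms(1)] fourier_def sum_distrib_left)
  finally show ?thesis .
qed

lemma sum_deriv_spec_power2: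
  "(\<Sum>p\<in>F2n n \<times> F2n n. (deriv_spec n F p)\<^sup>2)
    = real (card (F2n n)) * (\<Sum>y\<in>F2n n. \<Sum>h\<in>F2n n. (deriv_corr n F y h)\<^sup>2)"
proof -
  have "(\<Sum>p\<in>F2n n \<times> F2n n. (deriv_spec n F p)\<^sup>2)
    = (\<Sum>y\<in>F2n n. \<Sum>a\<in>F2n n. (fourier (F2n n) (dot n) (deriv_corr n F y) a)\<^sup>2)"
  proof -
    have "(\<Sum>p\<in>F2n n \<times> F2n n. (deriv_spec n F p)\<^sup>2) = (\<Sum>y\<in>F2n n. \<Sum>a\<in>F2n n. (deriv_spec n F (y, a))\<^sup>2)"
      by (simp add: sum.cartesian_product)
    then show ?thesis by (simp add: deriv_spec_eq_fourier)
  qed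
  then show ?thesis by (simp add: parseval sum_distrib_left)
qed

text \<open>The energy of a weight is the fourth moment of its transform; self-duality turns it into
  the fourth moment of the weight itself.\<close>

lemma sum_quadruples_deriv_spec:
  "(\<Sum>p\<in>F2n n \<times> F2n n. \<Sum>q\<in>F2n n \<times> F2n n. \<Sum>r\<in>F2n n \<times> F2n n.
      deriv_spec n F p * deriv_spec n F q * deriv_spec n F r * deriv_spec n F (p + q + r))
    = (real (card (F2n n)))\<^sup>2 * (\<Sum>p\<in>F2n n \<times> F2n n. (deriv_spec n F p) ^ 4)"
proof -
  have "(\<Sum>p\<in>F2n n \<times> F2n n. \<Sum>q\<in>F2n n \<times> F2n n. \<Sum>r\<in>F2n n \<times> F2n n.
      deriv_spec n F p * deriv_spec n F q * deriv_spec n F r * deriv_spec n F (p + q + r))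
    = (\<Sum>p\<in>F2n n \<times> F2n n. (fourier (F2n n \<times> F2n n) (\<lambda>p q. dot n (fst p) (fst q) + dot n (snd p) (snd q)) (deriv_spec n F) p) ^ 4)
      / real (card (F2n n \<times> F2n n))"
    by (rule paired_group.sum_quadruples[OF paired_group_prod[OF paired_group_F2n]])
  also have "(\<Sum>p\<in>F2n n \<times> F2n n. (fourier (F2n n \<times> F2n n) (\<lambda>p q. dot n (fst p) (fst q) + dot n (snd p) (snd q)) (deriv_spec n F) p) ^ 4)
    = (\<Sum>p\<in>F2n n \<times> F2n n. (real (card (F2n n)) * deriv_spec n F (prod.swap p)) ^ 4)"
    by (rule sum.cong) (auto simp: fourier_deriv_spec)
  also have "\<dots> = (\<Sum>p\<in>F2n n \<times> F2n n. (real (card (F2n n)) * deriv_spec n F p) ^ 4)"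
    by (rule sum.reindex_bij_witness[where i=prod.swap and j=prod.swap]) auto
  also have "\<dots> / real (card (F2n n \<times> F2n n)) = (real (card (F2n n)))\<^sup>2 * (\<Sum>p\<in>F2n n \<times> F2n n. (deriv_spec n F p) ^ 4)"
    using card_G_pos unfolding power_mult_distrib sum_distrib_left[symmetric]
    by (simp add: card_cartesian_product power4_eq_xxxx power2_eq_square)
  finally show ?thesis .
qed

context
  assumes F1: "\<And>x. F x * F x = 1"
begin

text \<open>Parseval for a derivative with values of modulus one. It bounds the weight pointwise
  and, later, limits the number of large frequencies for each direction.\<close>

lemma sum_deriv_spec_fibre:
  "(\<Sum>a\<in>F2n n. deriv_spec n F (y, a)) = (real (card (F2n n)))\<^sup>2"
proof -
  have "(F x * F (x + y))\<^sup>2 = 1" for x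
    using F1 by (simp add: power2_eq_square) (metis mult.assoc mult.commute mult_1_left)
  then show ?thesis
    by (simp add: deriv_spec_def parseval) (simp add: power2_eq_square)
qed

lemma sum_deriv_spec: "(\<Sum>p\<in>F2n n \<times> F2n n. deriv_spec n F p) = (real (card (F2n n))) ^ 3"
proof -
  have "(\<Sum>p\<in>F2n n \<times> F2n n. deriv_spec n F p) = (\<Sum>y\<in>F2n n. \<Sum>a\<in>F2n n. deriv_spec n F (y, a))"
    by (simp add: sum.cartesian_product)
  then show ?thesis by (simp add: sum_deriv_spec_fibre eval_nat_numeral)
qed

lemma deriv_spec_le:
  assumes "p \<in> F2n n \<times> F2n n"
  shows "deriv_spec n F p \<le> (real (card (F2n n)))\<^sup>2"
proof -
  have "deriv_spec n F p \<le> (\<Sum>a\<in>F2n n. deriv_spec n F (fst p, a))"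
    using member_le_sum[of "snd p" "F2n n" "\<lambda>a. deriv_spec n F (fst p, a)"] assms
    by (auto simp: deriv_spec_nonneg finite_F2n)
  then show ?thesis by (simp add: sum_deriv_spec_fibre)
qed

text \<open>The tangent inequality \<open>w\<^sup>3 \<ge> 3 t\<^sup>2 w - 2 t\<^sup>3\<close>, times \<open>w\<close>, replaces Hoelder's inequality.\<close>

lemma quadruples_deriv_spec_ge:
  assumes \<delta>: "\<delta> \<ge> 0"
    and U3: "\<delta> * real (card (F2n n)) ^ 4 \<le> (\<Sum>y\<in>F2n n. \<Sum>h\<in>F2n n. (deriv_corr n F y h)\<^sup>2)"
  shows "\<delta> ^ 3 * real (card (F2n n)) ^ 11 \<le> (\<Sum>p\<in>F2n n \<times> F2n n. \<Sum>q\<in>F2n n \<times> F2n n. \<Sum>r\<in>F2n n \<times> F2n n.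
      deriv_spec n F p * deriv_spec n F q * deriv_spec n F r * deriv_spec n F (p + q + r))"
proof -
  define N where "N = real (card (F2n n))"
  \<comment> \<open>The tangent point is the lower bound for the mean of the weight with respect to
    itself: its squares sum to at least \<open>\<delta> * N ^ 5\<close>, while the weight sums to
    \<open>N ^ 3\<close>.\<close>
  define t where "t = \<delta> * N\<^sup>2"
  have N: "N > 0" and t: "t \<ge> 0" using card_G_pos \<delta> by (auto simp: N_def t_def)
  have tangent: "3 * t\<^sup>2 * w\<^sup>2 - 2 * t ^ 3 * w \<le> w ^ 4" if w: "w \<ge> 0" for w :: real
  proof -
    have "w ^ 4 - (3 * t\<^sup>2 * w\<^sup>2 - 2 * t ^ 3 * w) = w * ((w - t)\<^sup>2 * (w + 2 * t))"
      by (simp add: algebra_simps eval_nat_numeral)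
    also have "\<dots> \<ge> 0" using w t by simp
    finally show ?thesis by simp
  qed
  have "\<delta> ^ 3 * N ^ 9 = 3 * t\<^sup>2 * (N * (\<delta> * N ^ 4)) - 2 * t ^ 3 * N ^ 3"
    by (simp add: t_def algebra_simps eval_nat_numeral)
  also have "\<dots> \<le> 3 * t\<^sup>2 * (\<Sum>p\<in>F2n n \<times> F2n n. (deriv_spec n F p)\<^sup>2) - 2 * t ^ 3 * N ^ 3"
    using U3 N unfolding sum_deriv_spec_power2 N_def[symmetric] by (simp add: mult_left_mono)
  also have "\<dots> = (\<Sum>p\<in>F2n n \<times> F2n n. 3 * t\<^sup>2 * (deriv_spec n F p)\<^sup>2 - 2 * t ^ 3 * deriv_spec n F p)"
    by (simp add: sum_subtractf sum_deriv_spec N_def flip: sum_distrib_left)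
  also have "\<dots> \<le> (\<Sum>p\<in>F2n n \<times> F2n n. (deriv_spec n F p) ^ 4)"
    by (intro sum_mono tangent deriv_spec_nonneg)
  finally have "N\<^sup>2 * (\<delta> ^ 3 * N ^ 9) \<le> N\<^sup>2 * (\<Sum>p\<in>F2n n \<times> F2n n. (deriv_spec n F p) ^ 4)"
    by (rule mult_left_mono) simp
  then show ?thesis
    unfolding sum_quadruples_deriv_spec N_def[symmetric] by (simp add: eval_nat_numeral mult_ac)
qed

end

end

section \<open>Freiman--Ruzsa in the graph space\<close>

text \<open>Statement (A) for a fixed constant, in exactly the form of the final theorem so that it
  can be folded there.\<close>

definition pfr_constant :: "real \<Rightarrow> bool"
  where "pfr_constant C \<longleftrightarrow> (\<forall>n\<ge>(1::nat). \<forall>K::real. \<forall>S. K \<ge> 1 \<and> S \<subseteq> F2n n \<and> S \<noteq> {} \<and>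
            real (card (S + S)) \<le> K * real (card S) \<longrightarrow>
          (\<exists>S'\<subseteq>S. real (card S') \<ge> inverse C * K powr (- C) * real (card S) \<and>
                   real (card (F2.span S')) \<le> C * K powr C * real (card S)))"

text \<open>The assumptions concern a single space \<open>F2n n\<close>; this isomorphism moves
  pairs into \<open>F2n (2 * n)\<close>. Alternating the coordinates instead of concatenating them
  makes it independent of \<open>n\<close> and bijective on all sequences.\<close>

definition interleave :: "(nat \<Rightarrow> bit) \<times> (nat \<Rightarrow> bit) \<Rightarrow> nat \<Rightarrow> bit"
  where "interleave p = (\<lambda>i. if even i then fst p (i div 2) else snd p (i div 2))"

definition deinterleave :: "(nat \<Rightarrow> bit) \<Rightarrow> (nat \<Rightarrow> bit) \<times> (nat \<Rightarrow> bit)"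
  where "deinterleave z = (\<lambda>i. z (2 * i), \<lambda>i. z (2 * i + 1))"

lemma deinterleave_interleave [simp]: "deinterleave (interleave p) = p"
  by (simp add: interleave_def deinterleave_def)

lemma interleave_deinterleave [simp]: "interleave (deinterleave z) = z"
  by (auto simp: interleave_def deinterleave_def fun_eq_iff)

lemma inj_interleave: "inj interleave"
  by (metis deinterleave_interleave injI)

lemma interleave_add: "interleave (p + q) = interleave p + interleave q"
  by (auto simp: interleave_def fun_eq_iff)

lemma interleave_0 [simp]: "interleave 0 = 0"
  by (auto simp: interleave_def fun_eq_iff)

lemma interleave_in_F2n: "interleave p \<in> F2n (2 * n) \<longleftrightarrow> p \<in> F2n n \<times> F2n n"
proof
  assume *: "interleave p \<in> F2n (2 * n)"
  have "fst p i = 0" "snd p i = 0" if "i \<ge> n" for i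
  proof -
    have "interleave p (2 * i) = 0" "interleave p (2 * i + 1) = 0"
      using * that by (simp_all only: F2n_def mem_Collect_eq)
    then show "fst p i = 0" "snd p i = 0" by (simp_all add: interleave_def)
  qed
  then show "p \<in> F2n n \<times> F2n n" by (cases p) (simp add: F2n_def)
next
  assume "p \<in> F2n n \<times> F2n n"
  then show "interleave p \<in> F2n (2 * n)" by (cases p) (auto simp: F2n_def interleave_def)
qed

lemma interleave_image: "interleave ` (F2n n \<times> F2n n) = F2n (2 * n)"
proof
  show "F2n (2 * n) \<subseteq> interleave ` (F2n n \<times> F2n n)"
  proof
    fix z assume "z \<in> F2n (2 * n)"
    then have "deinterleave z \<in> F2n n \<times> F2n n"
      using interleave_in_F2n[of "deinterleave z" n] by simp
    then show "z \<in> interleave ` (F2n n \<times> F2n n)" by (rule image_eqI[rotated]) simp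
  qed
qed (use interleave_in_F2n in blast)

lemma subspace_iff_add_subgroup: "F2.subspace H \<longleftrightarrow> add_subgroup H"
proof -
  have "F2_scale c x \<in> H" if "0 \<in> H" "x \<in> H" for c x
  proof (cases c)
    case zero
    then have "F2_scale c x = 0" by (simp add: F2_scale_def fun_eq_iff)
    then show ?thesis using that by metis
  next
    case one
    then have "F2_scale c x = x" by (simp add: F2_scale_def fun_eq_iff)
    then show ?thesis using that by metis
  qed
  then show ?thesis unfolding F2.subspace_def add_subgroup_def by blast
qed

lemma pfr_pairs:
  assumes C: "pfr_constant C" and n: "n \<ge> 1" and K: "K \<ge> 1"
    and A: "A \<subseteq> F2n n \<times> F2n n" "A \<noteq> {}" "real (card (A + A)) \<le> K * real (card A)"
  obtains S H where "S \<subseteq> A" "S \<subseteq> H" "H \<subseteq> F2n n \<times> F2n n" "add_subgroup H"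
    "real (card S) \<ge> inverse C * K powr (- C) * real (card A)"
    "real (card H) \<le> C * K powr C * real (card A)"
proof -
  have card_interleave: "card (interleave ` X) = card X" for X
    using inj_interleave by (intro card_image) (auto intro: inj_on_subset)
  have plus: "interleave ` A + interleave ` A = interleave ` (A + A)"
  proof
    show "interleave ` A + interleave ` A \<subseteq> interleave ` (A + A)"
      by (auto simp: set_plus_def simp flip: interleave_add)
    show "interleave ` (A + A) \<subseteq> interleave ` A + interleave ` A"
      by (auto simp only: interleave_add elim!: set_plus_elim intro!: set_plus_intro imageI)
  qed
  have "interleave ` A \<subseteq> F2n (2 * n)" using A interleave_image by blast
  then obtain S0 where S0: "S0 \<subseteq> interleave ` A"
    "real (card S0) \<ge> inverse C * K powr (- C) * real (card A)"
    "real (card (F2.span S0)) \<le> C * K powr C * real (card A)"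
    using C[unfolded pfr_constant_def, rule_format, of "2 * n" K "interleave ` A"] n K A
    unfolding plus card_interleave by auto
  define S where "S = {p \<in> A. interleave p \<in> S0}"
  define H where "H = {p. interleave p \<in> F2.span S0}"
  have "interleave ` S = S0" using S0(1) by (auto simp: S_def)
  then have cS: "card S = card S0" using card_interleave by metis
  have "interleave ` H = F2.span S0"
  proof
    show "F2.span S0 \<subseteq> interleave ` H"
    proof
      fix z assume "z \<in> F2.span S0"
      then have "deinterleave z \<in> H" by (simp add: H_def)
      then show "z \<in> interleave ` H" by (rule image_eqI[rotated]) simp
    qed
  qed (auto simp: H_def)
  then have cH: "card H = card (F2.span S0)" using card_interleave by metis
  have "F2.span S0 \<subseteq> F2n (2 * n)"
    by (rule F2.span_minimal[OF _ subspace_F2n]) (use S0 A interleave_image in blast)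
  then have HV: "H \<subseteq> F2n n \<times> F2n n" unfolding H_def using interleave_in_F2n by blast
  have "add_subgroup H"
    by (auto simp: add_subgroup_def H_def interleave_add F2.span_zero F2.span_add)
  then show ?thesis
    using that[of S H] cS cH S0 HV F2.span_superset[of S0] by (auto simp: S_def H_def)
qed

section \<open>An additive function in the spectrum\<close>

text \<open>Either all four factors reach the threshold \<open>s\<close>, or one of them is at most
  \<open>s\<close> and is replaced by it.\<close>

lemma quadruple_product_le:
  fixes a b c d :: real
  assumes "0 \<le> a" "0 \<le> b" "0 \<le> c" "0 \<le> d" "a \<le> m" "b \<le> m" "c \<le> m" "d \<le> m" "0 \<le> s"
  shows "a * b * c * d \<le> (if s \<le> a \<and> s \<le> b \<and> s \<le> c \<and> s \<le> d then m ^ 4 else 0)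
    + s * (b * c * d + a * c * d + a * b * d + a * b * c)"
proof -
  have nn: "0 \<le> s * (b * c * d)" "0 \<le> s * (a * c * d)" "0 \<le> s * (a * b * d)" "0 \<le> s * (a * b * c)"
    using assms by simp_all
  show ?thesis
  proof (cases "s \<le> a \<and> s \<le> b \<and> s \<le> c \<and> s \<le> d")
    case True
    have "a * b * c * d \<le> m * m * m * m" by (intro mult_mono mult_nonneg_nonneg) (use assms in auto)
    then show ?thesis using True nn by (simp add: power4_eq_xxxx distrib_left)
  next
    case False
    then consider "a \<le> s" | "b \<le> s" | "c \<le> s" | "d \<le> s" by linarith
    then have "a * b * c * d \<le> s * (b * c * d + a * c * d + a * b * d + a * b * c)"
    proof cases
      case 1
      then have "a * (b * c * d) \<le> s * (b * c * d)" using assms by (intro mult_right_mono) auto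
      then show ?thesis using nn by (simp add: distrib_left mult_ac)
    next
      case 2
      then have "b * (a * c * d) \<le> s * (a * c * d)" using assms by (intro mult_right_mono) auto
      then show ?thesis using nn by (simp add: distrib_left mult_ac)
    next
      case 3
      then have "c * (a * b * d) \<le> s * (a * b * d)" using assms by (intro mult_right_mono) auto
      then show ?thesis using nn by (simp add: distrib_left mult_ac)
    next
      case 4
      then have "d * (a * b * c) \<le> s * (a * b * c)" using assms by (intro mult_right_mono) auto
      then show ?thesis using nn by (simp add: distrib_left mult_ac)
    qed
    then show ?thesis using False by auto
  qed
qed

text \<open>Any three of \<open>p\<close>, \<open>q\<close>, \<open>r\<close>,
  \<open>p + q + r\<close> can vary freely and determine the fourth, so replacing one weight by
  \<open>s\<close> leaves \<open>s\<close> times the cube of the total. The four choices give the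
  factor 4; quadruples inside \<open>A\<close> are counted by the energy of
  \<open>A\<close>.\<close>

lemma sum_quadruples_le:
  fixes G :: "'a::exponent_two_group set" and w :: "'a \<Rightarrow> real"
  assumes G: "finite G" "add_subgroup G" and s: "s \<ge> 0"
    and w: "\<And>p. p \<in> G \<Longrightarrow> 0 \<le> w p" "\<And>p. p \<in> G \<Longrightarrow> w p \<le> m"
  defines "A \<equiv> {p \<in> G. s \<le> w p}"
  shows "(\<Sum>p\<in>G. \<Sum>q\<in>G. \<Sum>r\<in>G. w p * w q * w r * w (p + q + r))
    \<le> m ^ 4 * (\<Sum>a\<in>A. \<Sum>b\<in>A. real (card {c \<in> A. a + b + c \<in> A})) + 4 * s * (sum w G) ^ 3"
proof -
  define T where "T = sum w G"
  have tr: "(\<Sum>r\<in>G. w (p + r)) = T" if "p \<in> G" for p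
    using sum_translate[OF G(2) that, of w] by (simp add: add.commute T_def)
  have add_swap: "(p + r) + q = p + q + r" and add_swap': "(q + r) + p = p + q + r" for p q r :: 'a
    by (simp_all add: ac_simps)
  have in_G: "p + q + r \<in> G" if "p \<in> G" "q \<in> G" "r \<in> G" for p q r
    using that add_subgroup_add[OF G(2)] by blast
  have T3: "(\<Sum>p\<in>G. \<Sum>q\<in>G. w p * w q * T) = T ^ 3"
  proof -
    have "T ^ 3 = (\<Sum>p\<in>G. \<Sum>q\<in>G. w p * w q) * T"
      unfolding sum_product[symmetric] by (simp add: T_def power3_eq_cube)
    then show ?thesis by (simp only: sum_distrib_right)
  qed
  define I where "I p q r = (if p \<in> A \<and> q \<in> A \<and> r \<in> A \<and> p + q + r \<in> A then m ^ 4 else 0)" for p q r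
  have "(\<Sum>p\<in>G. \<Sum>q\<in>G. \<Sum>r\<in>G. w p * w q * w r * w (p + q + r))
    \<le> (\<Sum>p\<in>G. \<Sum>q\<in>G. \<Sum>r\<in>G. I p q r + s * (w q * w r * w (p + q + r) + w p * w r * w (p + q + r)
        + w p * w q * w (p + q + r) + w p * w q * w r))"
  proof (intro sum_mono)
    fix p q r assume *: "p \<in> G" "q \<in> G" "r \<in> G"
    show "w p * w q * w r * w (p + q + r) \<le> I p q r + s * (w q * w r * w (p + q + r)
        + w p * w r * w (p + q + r) + w p * w q * w (p + q + r) + w p * w q * w r)"
      using quadruple_product_le[of "w p" "w q" "w r" "w (p + q + r)" m s] w * in_G[OF *] s
      by (simp add: I_def A_def)
  qed
  also have "\<dots> = (\<Sum>p\<in>G. \<Sum>q\<in>G. \<Sum>r\<in>G. I p q r)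
      + s * ((\<Sum>p\<in>G. \<Sum>q\<in>G. \<Sum>r\<in>G. w q * w r * w (p + q + r))
        + (\<Sum>p\<in>G. \<Sum>q\<in>G. \<Sum>r\<in>G. w p * w r * w (p + q + r))
        + (\<Sum>p\<in>G. \<Sum>q\<in>G. \<Sum>r\<in>G. w p * w q * w (p + q + r))
        + (\<Sum>p\<in>G. \<Sum>q\<in>G. \<Sum>r\<in>G. w p * w q * w r))"
    by (simp add: sum.distrib sum_distrib_left distrib_left)
  also have "(\<Sum>p\<in>G. \<Sum>q\<in>G. \<Sum>r\<in>G. w p * w q * w r) = T ^ 3"
    by (simp only: sum_distrib_left[symmetric] T_def[symmetric] T3)
  also have "(\<Sum>p\<in>G. \<Sum>q\<in>G. \<Sum>r\<in>G. w p * w q * w (p + q + r)) = (\<Sum>p\<in>G. \<Sum>q\<in>G. w p * w q * T)"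
    by (intro sum.cong refl) (simp add: tr add_subgroup_add[OF G(2)] flip: sum_distrib_left)
  also have "\<dots> = T ^ 3"
    by (rule T3)
  also have "(\<Sum>p\<in>G. \<Sum>q\<in>G. \<Sum>r\<in>G. w p * w r * w (p + q + r)) = (\<Sum>p\<in>G. \<Sum>r\<in>G. \<Sum>q\<in>G. w p * w r * w ((p + r) + q))"
  proof (rule sum.cong[OF refl])
    fix p
    have "(\<Sum>q\<in>G. \<Sum>r\<in>G. w p * w r * w (p + q + r)) = (\<Sum>r\<in>G. \<Sum>q\<in>G. w p * w r * w (p + q + r))"
      by (rule sum.swap)
    then show "(\<Sum>q\<in>G. \<Sum>r\<in>G. w p * w r * w (p + q + r)) = (\<Sum>r\<in>G. \<Sum>q\<in>G. w p * w r * w ((p + r) + q))"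
      by (simp only: add_swap[of p])
  qed
  also have "\<dots> = (\<Sum>p\<in>G. \<Sum>r\<in>G. w p * w r * T)"
    by (intro sum.cong refl) (simp add: tr add_subgroup_add[OF G(2)] flip: sum_distrib_left)
  also have "\<dots> = T ^ 3"
    by (rule T3)
  also have "(\<Sum>p\<in>G. \<Sum>q\<in>G. \<Sum>r\<in>G. w q * w r * w (p + q + r)) = (\<Sum>q\<in>G. \<Sum>p\<in>G. \<Sum>r\<in>G. w q * w r * w (p + q + r))"
    by (rule sum.swap)
  also have "\<dots> = (\<Sum>q\<in>G. \<Sum>r\<in>G. \<Sum>p\<in>G. w q * w r * w ((q + r) + p))"
  proof (rule sum.cong[OF refl])
    fix q
    have "(\<Sum>p\<in>G. \<Sum>r\<in>G. w q * w r * w (p + q + r)) = (\<Sum>r\<in>G. \<Sum>p\<in>G. w q * w r * w (p + q + r))"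
      by (rule sum.swap)
    then show "(\<Sum>p\<in>G. \<Sum>r\<in>G. w q * w r * w (p + q + r)) = (\<Sum>r\<in>G. \<Sum>p\<in>G. w q * w r * w ((q + r) + p))"
      by (simp only: add_swap'[of q])
  qed
  also have "\<dots> = (\<Sum>p\<in>G. \<Sum>r\<in>G. w p * w r * T)"
    by (intro sum.cong refl) (simp add: tr add_subgroup_add[OF G(2)] flip: sum_distrib_left)
  also have "\<dots> = T ^ 3"
    by (rule T3)
  also have "(\<Sum>p\<in>G. \<Sum>q\<in>G. \<Sum>r\<in>G. I p q r) = m ^ 4 * (\<Sum>a\<in>A. \<Sum>b\<in>A. real (card {c \<in> A. a + b + c \<in> A}))"
  proof -
    have AG: "A \<subseteq> G" by (auto simp: A_def)
    have finA: "finite A" using AG G finite_subset by blast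
    have "(\<Sum>r\<in>G. I p q r) = (if p \<in> A \<and> q \<in> A then m ^ 4 * real (card {c \<in> A. p + q + c \<in> A}) else 0)" for p q
    proof -
      have "(\<Sum>r\<in>G. I p q r) = (\<Sum>r\<in>A. I p q r)"
        by (rule sum.mono_neutral_right) (use G AG in \<open>auto simp: I_def\<close>)
      then show ?thesis using finA by (cases "p \<in> A"; cases "q \<in> A") (simp_all add: I_def sum.If_cases Int_def)
    qed
    then have "(\<Sum>p\<in>G. \<Sum>q\<in>G. \<Sum>r\<in>G. I p q r)
        = (\<Sum>p\<in>G. \<Sum>q\<in>G. if p \<in> A \<and> q \<in> A then m ^ 4 * real (card {c \<in> A. p + q + c \<in> A}) else 0)"
      by simp
    also have "\<dots> = (\<Sum>p\<in>G. \<Sum>q\<in>A. if p \<in> A \<and> q \<in> A then m ^ 4 * real (card {c \<in> A. p + q + c \<in> A}) else 0)"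
      by (intro sum.cong refl sum.mono_neutral_right) (use G AG in auto)
    also have "\<dots> = (\<Sum>p\<in>A. \<Sum>q\<in>A. if p \<in> A \<and> q \<in> A then m ^ 4 * real (card {c \<in> A. p + q + c \<in> A}) else 0)"
      by (rule sum.mono_neutral_right) (use G AG in \<open>auto intro!: sum.neutral\<close>)
    also have "\<dots> = m ^ 4 * (\<Sum>a\<in>A. \<Sum>b\<in>A. real (card {c \<in> A. a + b + c \<in> A}))"
      by (simp add: sum_distrib_left)
    finally show ?thesis .
  qed
  finally show ?thesis by (simp add: T_def)
qed

text \<open>Lets a numerical constant \<open>D\<close> be absorbed into
  \<open>t ^ D\<close>.\<close>

lemma power_le_inverse_of_nat:
  fixes t :: real
  assumes "0 < t" "t \<le> 1 / 2"
  shows "t ^ D * real D \<le> 1"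
proof -
  have "t ^ D * real D \<le> (1 / 2) ^ D * 2 ^ D"
    using assms of_nat_less_two_power[of D, where 'a=real] by (intro mult_mono power_mono) auto
  then show ?thesis by (simp add: power_divide)
qed

text \<open>With doubling at most \<open>K = inverse (t ^ k)\<close>, the factor
  \<open>K powr C\<close> costs \<open>k * D\<close> powers of \<open>t\<close>, and the constant
  \<open>C\<close> in front costs \<open>D\<close> more.\<close>

lemma pfr_pairs_power:
  assumes C: "pfr_constant C" "0 < C" "C \<le> real D" and n: "n \<ge> 1" and t: "0 < t" "t \<le> 1 / 2"
    and A: "A \<subseteq> F2n n \<times> F2n n" "A \<noteq> {}" "t ^ k * real (card (A + A)) \<le> real (card A)"
  obtains S H where "S \<subseteq> A" "S \<subseteq> H" "H \<subseteq> F2n n \<times> F2n n" "add_subgroup H"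
    "real (card S) \<ge> t ^ ((k + 1) * D) * real (card A)"
    "t ^ ((k + 1) * D) * real (card H) \<le> real (card A)"
proof -
  define K where "K = inverse (t ^ k)"
  have K: "K \<ge> 1"
    unfolding K_def by (intro one_le_inverse zero_less_power power_le_one) (use t in auto)
  have tk: "t ^ k > 0" using t by simp
  have "real (card (A + A)) \<le> K * real (card A)"
    using A(3) tk by (simp add: K_def field_simps)
  from pfr_pairs[OF C(1) n K A(1,2) this] obtain S H where SH: "S \<subseteq> A" "S \<subseteq> H" "H \<subseteq> F2n n \<times> F2n n" "add_subgroup H"
    "real (card S) \<ge> inverse C * K powr (- C) * real (card A)"
    "real (card H) \<le> C * K powr C * real (card A)" by metis
  have "K powr C \<le> K powr real D" by (rule powr_mono) (use C K in auto)
  also have "\<dots> = K ^ D" using K by (intro powr_realpow) simp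
  also have "\<dots> = inverse (t ^ (k * D))"
    by (simp add: K_def power_inverse power_mult)
  finally have "C * K powr C \<le> real D * inverse (t ^ (k * D))"
    using C by (intro mult_mono) auto
  also have "\<dots> \<le> inverse (t ^ D) * inverse (t ^ (k * D))"
    by (rule mult_right_mono) (use power_le_inverse_of_nat[OF t, of D] t in \<open>auto simp: field_simps\<close>)
  also have "\<dots> = inverse (t ^ ((k + 1) * D))"
    by (simp add: power_add distrib_right)
  finally have CK: "C * K powr C \<le> inverse (t ^ ((k + 1) * D))" .
  have tD: "t ^ ((k + 1) * D) > 0" using t by simp
  have "real (card H) \<le> inverse (t ^ ((k + 1) * D)) * real (card A)"
    using SH(6) mult_right_mono[OF CK, of "real (card A)"] by linarith
  then have "t ^ ((k + 1) * D) * real (card H) \<le> t ^ ((k + 1) * D) * (inverse (t ^ ((k + 1) * D)) * real (card A))"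
    by (rule mult_left_mono) (use tD in simp)
  also have "\<dots> = real (card A)" using t unfolding mult.assoc[symmetric] by (subst right_inverse) auto
  finally have 1: "t ^ ((k + 1) * D) * real (card H) \<le> real (card A)" .
  have "0 < C * K powr C" using C K by simp
  from le_imp_inverse_le[OF CK this] have "t ^ ((k + 1) * D) \<le> inverse C * K powr (- C)"
    by (simp add: powr_minus)
  then have 2: "t ^ ((k + 1) * D) * real (card A) \<le> real (card S)"
    using SH(5) by (meson mult_right_mono of_nat_0_le_iff order_trans)
  show ?thesis using that SH(1-4) 1 2 by blast
qed

lemma card_F2n_pos: "0 < real (card (F2n n))"
  using finite_F2n F2n_nonempty by (simp add: card_gt_0_iff)

context
  fixes n :: nat and F :: "(nat \<Rightarrow> bit) \<Rightarrow> real"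
  assumes F1: "\<And>x. F x * F x = 1"
begin

text \<open>The threshold \<open>t ^ 27\<close> is chosen so that quadruples with a small weight
  contribute at most \<open>4 * t ^ 27\<close>, hence at most half of the available
  \<open>t ^ 24\<close>. The upper bound on \<open>A\<close> comes from the total weight, the lower
  one from the trivial bound \<open>card A ^ 3\<close> for the energy.\<close>

lemma popular_spectrum:
  assumes t: "0 < t" "t \<le> 1 / 2"
    and U3: "t ^ 8 * real (card (F2n n)) ^ 4 \<le> (\<Sum>y\<in>F2n n. \<Sum>h\<in>F2n n. (deriv_corr n F y h)\<^sup>2)"
  defines "A \<equiv> {p \<in> F2n n \<times> F2n n. t ^ 27 * (real (card (F2n n)))\<^sup>2 \<le> deriv_spec n F p}"
  shows "t ^ 25 * real (card (F2n n)) ^ 3 \<le> (\<Sum>a\<in>A. \<Sum>b\<in>A. real (card {c \<in> A. a + b + c \<in> A}))"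
    and "t ^ 27 * real (card A) \<le> real (card (F2n n))"
    and "t ^ 9 * real (card (F2n n)) \<le> real (card A)"
proof -
  define N where "N = real (card (F2n n))"
  define Q where "Q = (\<Sum>a\<in>A. \<Sum>b\<in>A. real (card {c \<in> A. a + b + c \<in> A}))"
  have N: "N > 0" using card_F2n_pos by (simp add: N_def)
  have fin: "finite (F2n n \<times> F2n n)" "finite A" by (auto simp: A_def finite_F2n)
  have sub: "add_subgroup (F2n n \<times> F2n n)"
    using add_subgroup_F2n by (auto simp: add_subgroup_def zero_prod_def)
  have t3: "t ^ 3 \<le> (1 / 2) ^ 3" by (rule power_mono) (use t in auto)
  have t27: "4 * t ^ 27 \<le> t ^ 24 / 2"
  proof -
    have "t ^ 24 * t ^ 3 \<le> t ^ 24 * (1 / 2) ^ 3" by (rule mult_left_mono[OF t3]) (use t in simp)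
    then show ?thesis by (simp add: power_divide flip: power_add)
  qed
  have t25: "t ^ 25 \<le> t ^ 24 / 2"
    using mult_left_mono[OF t(2), of "t ^ 24"] t by (simp flip: power_Suc2)
  have "(t ^ 8) ^ 3 * N ^ 11 \<le> (N\<^sup>2) ^ 4 * Q + 4 * (t ^ 27 * N\<^sup>2) * (N ^ 3) ^ 3"
    using quadruples_deriv_spec_ge[OF F1 _ U3]
      sum_quadruples_le[OF fin(1) sub, of "t ^ 27 * N\<^sup>2" "deriv_spec n F" "N\<^sup>2"] t
    unfolding sum_deriv_spec[OF F1] Q_def A_def
    by (force simp: N_def deriv_spec_nonneg deriv_spec_le[OF F1])
  also have "\<dots> = N ^ 8 * Q + (4 * t ^ 27) * N ^ 11"
    by (simp flip: power_mult power_add)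
  also have "\<dots> \<le> N ^ 8 * Q + t ^ 24 / 2 * N ^ 11"
    by (intro add_left_mono mult_right_mono t27) (use N in simp)
  finally have "N ^ 8 * (t ^ 24 / 2 * N ^ 3) \<le> N ^ 8 * Q" by (simp add: mult_ac flip: power_mult power_add)
  moreover have "N ^ 8 > 0" using N by simp
  ultimately have "t ^ 24 / 2 * N ^ 3 \<le> Q" by (rule mult_left_le_imp_le)
  moreover have "t ^ 25 * N ^ 3 \<le> t ^ 24 / 2 * N ^ 3" by (rule mult_right_mono[OF t25]) (use N in simp)
  ultimately have Q: "t ^ 25 * N ^ 3 \<le> Q" by linarith
  then show "t ^ 25 * real (card (F2n n)) ^ 3 \<le> (\<Sum>a\<in>A. \<Sum>b\<in>A. real (card {c \<in> A. a + b + c \<in> A}))"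
    by (simp add: N_def Q_def)
  have "N\<^sup>2 * (t ^ 27 * real (card A)) = (\<Sum>p\<in>A. t ^ 27 * N\<^sup>2)" by simp
  also have "\<dots> \<le> (\<Sum>p\<in>A. deriv_spec n F p)" by (rule sum_mono) (simp add: A_def N_def)
  also have "\<dots> \<le> (\<Sum>p\<in>F2n n \<times> F2n n. deriv_spec n F p)"
    by (rule sum_mono2) (use fin in \<open>auto simp: A_def deriv_spec_nonneg\<close>)
  also have "\<dots> = N\<^sup>2 * N" by (simp add: sum_deriv_spec[OF F1] N_def eval_nat_numeral)
  finally show "t ^ 27 * real (card A) \<le> real (card (F2n n))" using N by (simp add: N_def)
  \<comment> \<open>The exponent 25 is weakened to 27 to have a cube.\<close>
  have "(t ^ 9 * N) ^ 3 = t ^ 27 * N ^ 3" by (simp add: power_mult_distrib flip: power_mult)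
  also have "\<dots> \<le> t ^ 25 * N ^ 3" by (intro mult_right_mono power_decreasing) (use t N in auto)
  also have "\<dots> \<le> (\<Sum>a\<in>A. \<Sum>b\<in>A. real (card A))"
    using Q unfolding Q_def
    by (rule order_trans) (intro sum_mono of_nat_mono card_mono, use fin in auto)
  also have "\<dots> = (real (card A)) ^ 3" by (simp add: eval_nat_numeral)
  finally show "t ^ 9 * real (card (F2n n)) \<le> real (card A)"
    using t N unfolding N_def[symmetric] by (subst (asm) power_mono_iff) auto
qed

text \<open>The popular set is nearly a graph: over each \<open>y\<close> it has at most
  \<open>inverse (t ^ 27)\<close> points. A subgroup \<open>H\<close> of comparable size that
  contains a large part of it can therefore have only a small vertical part \<open>H0\<close>, and
  few translates of the graph of one additive \<open>L\<close> cover that part.\<close>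

lemma additive_function_in_spectrum:
  assumes C: "pfr_constant C" "0 < C" "C \<le> real D" and n: "n \<ge> 1" and t: "0 < t" "t \<le> 1 / 2"
    and U3: "t ^ 8 * real (card (F2n n)) ^ 4 \<le> (\<Sum>y\<in>F2n n. \<Sum>h\<in>F2n n. (deriv_corr n F y h)\<^sup>2)"
  obtains L u where "\<And>x. x \<in> F2n n \<Longrightarrow> L x \<in> F2n n" "u \<in> F2n n"
    "\<And>x y. x \<in> F2n n \<Longrightarrow> y \<in> F2n n \<Longrightarrow> L (x + y) = L x + L y"
    "t ^ (3249 * D + 281) * real (card (F2n n)) ^ 3 \<le> (\<Sum>y\<in>F2n n. deriv_spec n F (y, L y + u))"
proof -
  define N where "N = real (card (F2n n))"
  \<comment> \<open>1082 is the exponent of the doubling of \<open>B\<close> below: 109 for the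
    density of \<open>B\<close> in \<open>A\<close>, 19 for the factor \<open>2 ^ 19\<close>, and 9
    times 106.\<close>
  define E where "E = (1082 + 1) * D"
  define A where "A = {p \<in> F2n n \<times> F2n n. t ^ 27 * (real (card (F2n n)))\<^sup>2 \<le> deriv_spec n F p}"
  note pop = popular_spectrum[OF t U3, folded A_def N_def]
  have N: "N > 0" using card_F2n_pos by (simp add: N_def)
  have finV2: "finite (F2n n \<times> F2n n)" by (simp add: finite_F2n)
  have AV: "A \<subseteq> F2n n \<times> F2n n" and finA: "finite A" by (auto simp: A_def finite_F2n)
  have "0 < t ^ 9 * N" using t N by simp
  then have cardA: "0 < real (card A)" using pop(3) by linarith
  then have A0: "A \<noteq> {}" by auto
  \<comment> \<open>25 from the energy bound, and 3 times 27 for replacing \<open>N\<close> by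
    \<open>card A\<close>.\<close>
  have "t ^ 106 * real (card A) ^ 3 = t ^ 25 * (t ^ 27 * real (card A)) ^ 3"
    by (simp add: power_mult_distrib flip: power_mult power_add)
  also have "\<dots> \<le> t ^ 25 * N ^ 3"
    by (intro mult_left_mono power_mono pop) (use t in auto)
  also note pop(1)
  finally have energy: "t ^ 106 * real (card A) ^ 3 \<le> (\<Sum>a\<in>A. \<Sum>b\<in>A. real (card {c \<in> A. a + b + c \<in> A}))" .
  have t106: "t ^ 106 > 0" using t by simp
  obtain B where B: "B \<subseteq> A" "real (card B) \<ge> t ^ 106 / 8 * real (card A)"
    "real (card (B + B)) \<le> 2 ^ 19 / (t ^ 106) ^ 9 * real (card A)"
    by (rule balog_szemeredi_gowers[OF finA A0 t106 energy])
  have t3: "t ^ 3 \<le> 1 / 8" using power_mono[OF t(2), of 3] t by (simp add: power_divide)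
  have B109: "t ^ 109 * real (card A) \<le> real (card B)"
  proof -
    have "t ^ 106 * t ^ 3 \<le> t ^ 106 * (1 / 8)" by (rule mult_left_mono[OF t3]) (use t in simp)
    then have "t ^ 109 \<le> t ^ 106 / 8" by (simp flip: power_add)
    then have "t ^ 109 * real (card A) \<le> t ^ 106 / 8 * real (card A)" by (rule mult_right_mono) simp
    then show ?thesis using B(2) by linarith
  qed
  have BB: "t ^ 1082 * real (card (B + B)) \<le> real (card B)"
  proof -
    have "t ^ 19 * 2 ^ 19 = (t * 2) ^ 19" by (simp add: power_mult_distrib)
    also have "\<dots> \<le> 1" by (rule power_le_one) (use t in auto)
    finally have t19: "t ^ 19 * 2 ^ 19 \<le> 1" .
    have "t ^ 1082 * real (card (B + B)) \<le> t ^ 1082 * (2 ^ 19 / (t ^ 106) ^ 9 * real (card A))"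
      by (rule mult_left_mono[OF B(3)]) (use t in simp)
    also have "t ^ 1082 = t ^ 109 * t ^ 19 * (t ^ 106) ^ 9"
      by (simp flip: power_mult power_add)
    also have "t ^ 109 * t ^ 19 * (t ^ 106) ^ 9 * (2 ^ 19 / (t ^ 106) ^ 9 * real (card A))
        = (t ^ 19 * 2 ^ 19) * (t ^ 109 * real (card A))"
    proof -
      have "a * b * c * (e / c * d) = (b * e) * (a * d)" if "c \<noteq> 0" for a b c d e :: real
        using that by simp
      then show ?thesis by this (use t in simp)
    qed
    also have "\<dots> \<le> 1 * real (card B)"
      by (rule mult_mono[OF t19 B109]) (use t in auto)
    finally show ?thesis by simp
  qed
  have "0 < t ^ 109 * real (card A)" using cardA t by simp
  then have B0: "B \<noteq> {}" using B109 by auto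
  have BV: "B \<subseteq> F2n n \<times> F2n n" using B AV by blast
  obtain S H where SH: "S \<subseteq> B" "S \<subseteq> H" "H \<subseteq> F2n n \<times> F2n n" "add_subgroup H"
    "real (card S) \<ge> t ^ E * real (card B)" "t ^ E * real (card H) \<le> real (card B)"
    unfolding E_def by (rule pfr_pairs_power[OF C n t BV B0 BB])
  have SA: "S \<subseteq> A" using SH B by blast
  have finS: "finite S" and finH: "finite H" using SA finA SH finV2 finite_subset by metis+
  obtain L where L: "\<And>x. x \<in> F2n n \<Longrightarrow> L x \<in> F2n n"
    "\<And>x y. x \<in> F2n n \<Longrightarrow> y \<in> F2n n \<Longrightarrow> L (x + y) = L x + L y"
    "\<And>y a. (y, a) \<in> H \<Longrightarrow> (0, a + L y) \<in> H"
    using additive_of_subgroup[OF finite_F2n add_subgroup_F2n finite_F2n add_subgroup_F2n SH(4,3)] by metis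
  \<comment> \<open>The vertical part of \<open>H\<close>. Choosing one point of \<open>S\<close>
    over each element of its projection \<open>P\<close> embeds \<open>P \<times> H0\<close> into
    \<open>H\<close>.\<close>
  define H0 where "H0 = {u \<in> F2n n. (0, u) \<in> H}"
  have finH0: "finite H0" using finite_F2n by (simp add: H0_def)
  have "(0, 0) \<in> H" using add_subgroup_0[OF SH(4)] by (simp add: zero_prod_def)
  then have "0 \<in> H0" using add_subgroup_0[OF add_subgroup_F2n] by (simp add: H0_def)
  then have cH0: "0 < real (card H0)" using finH0 by (auto simp: card_gt_0_iff)
  define P where "P = fst ` S"
  have PH: "card P * card H0 \<le> card H"
  proof -
    have "\<forall>y\<in>P. \<exists>a. (y, a) \<in> S" by (auto simp: P_def)
    then obtain c where c: "\<And>y. y \<in> P \<Longrightarrow> (y, c y) \<in> S" by metis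
    have "card (P \<times> H0) \<le> card H"
    proof (rule card_inj_on_le[OF _ _ finH])
      show "inj_on (\<lambda>(y, u). (y, c y + u)) (P \<times> H0)" by (auto simp: inj_on_def)
      show "(\<lambda>(y, u). (y, c y + u)) ` (P \<times> H0) \<subseteq> H"
      proof clarify
        fix y u assume "y \<in> P" "u \<in> H0"
        then have "(y, c y) \<in> H" "(0, u) \<in> H" using c SH(2) by (auto simp: H0_def)
        from add_subgroup_add[OF SH(4) this] show "(y, c y + u) \<in> H" by simp
      qed
    qed
    then show ?thesis by (simp add: card_cartesian_product)
  qed
  have SP: "t ^ 27 * real (card S) \<le> real (card P)"
  proof -
    have fib: "t ^ 27 * real (card {a \<in> F2n n. (y, a) \<in> A}) \<le> 1" for y
    proof -
      have "N\<^sup>2 * (t ^ 27 * real (card {a \<in> F2n n. (y, a) \<in> A})) = (\<Sum>a\<in>{a \<in> F2n n. (y, a) \<in> A}. t ^ 27 * N\<^sup>2)"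
        by simp
      also have "\<dots> \<le> (\<Sum>a\<in>{a \<in> F2n n. (y, a) \<in> A}. deriv_spec n F (y, a))"
        by (rule sum_mono) (simp add: A_def N_def)
      also have "\<dots> \<le> (\<Sum>a\<in>F2n n. deriv_spec n F (y, a))"
        by (rule sum_mono2) (auto simp: finite_F2n deriv_spec_nonneg)
      also have "\<dots> = N\<^sup>2 * 1" by (simp add: sum_deriv_spec_fibre[OF F1] N_def)
      finally show ?thesis using N by simp
    qed
    have "card S \<le> card (SIGMA y:P. {a \<in> F2n n. (y, a) \<in> A})"
    proof (rule card_mono)
      show "finite (SIGMA y:P. {a \<in> F2n n. (y, a) \<in> A})" using finS finite_F2n by (simp add: P_def)
      show "S \<subseteq> (SIGMA y:P. {a \<in> F2n n. (y, a) \<in> A})" using SA AV by (force simp: P_def)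
    qed
    also have "\<dots> = (\<Sum>y\<in>P. card {a \<in> F2n n. (y, a) \<in> A})"
      using finS finite_F2n by (simp add: P_def)
    finally have "t ^ 27 * real (card S) \<le> t ^ 27 * (\<Sum>y\<in>P. real (card {a \<in> F2n n. (y, a) \<in> A}))"
      using t by (simp flip: of_nat_sum)
    also have "\<dots> \<le> (\<Sum>y\<in>P. 1)" unfolding sum_distrib_left by (intro sum_mono fib)
    finally show ?thesis by simp
  qed
  have SA2: "t ^ (E + 109) * real (card A) \<le> real (card S)"
  proof -
    have "t ^ (E + 109) * real (card A) = t ^ E * (t ^ 109 * real (card A))" by (simp add: power_add)
    also have "\<dots> \<le> t ^ E * real (card B)" by (rule mult_left_mono[OF B109]) (use t in simp)
    finally show ?thesis using SH(5) by linarith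
  qed
  \<comment> \<open>One \<open>E\<close> for the size of \<open>H\<close>, another with 109 for the
    density of \<open>S\<close> in \<open>A\<close>, and 27 for passing from \<open>S\<close> to its
    projection.\<close>
  have H0: "t ^ (2 * E + 136) * real (card H0) \<le> 1"
  proof -
    have "t ^ (2 * E + 136) * real (card H0) * real (card A)
        = t ^ E * (t ^ 27 * (t ^ (E + 109) * real (card A)) * real (card H0))"
      by (simp add: mult_2 mult_ac flip: power_add)
    also have "\<dots> \<le> t ^ E * (t ^ 27 * real (card S) * real (card H0))"
      by (intro mult_left_mono mult_right_mono SA2) (use t in auto)
    also have "\<dots> \<le> t ^ E * (real (card P) * real (card H0))"
      by (intro mult_left_mono mult_right_mono SP) (use t in auto)
    also have "\<dots> \<le> t ^ E * real (card H)"
      by (rule mult_left_mono) (use PH t in \<open>auto simp flip: of_nat_mult\<close>)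
    also have "\<dots> \<le> 1 * real (card A)" using SH(6) card_mono[OF finA B(1)] by simp
    finally show ?thesis using cardA by simp
  qed
  \<comment> \<open>The part of \<open>S\<close> on the graph of \<open>L\<close> translated by
    \<open>u\<close>; the parts with \<open>u\<close> in \<open>H0\<close> cover \<open>S\<close>,
    so one of them is large.\<close>
  define T where "T u = {p \<in> S. snd p + L (fst p) = u}" for u
  have finT: "finite (T u)" for u using finS by (simp add: T_def)
  have "S \<subseteq> (\<Union>u\<in>H0. T u)"
  proof
    fix p assume p: "p \<in> S"
    then have "(0, snd p + L (fst p)) \<in> H" using L(3)[of "fst p" "snd p"] SH(2) by auto
    then show "p \<in> (\<Union>u\<in>H0. T u)" using p SH(3) by (auto simp: H0_def T_def)
  qed
  then have "card S \<le> card (\<Union>u\<in>H0. T u)" by (rule card_mono[rotated]) (use finH0 finT in auto)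
  also have "\<dots> \<le> (\<Sum>u\<in>H0. card (T u))" by (rule card_UN_le[OF finH0])
  finally have ST: "real (card S) \<le> (\<Sum>u\<in>H0. real (card (T u)))" by (simp flip: of_nat_sum)
  have "\<exists>u\<in>H0. t ^ (2 * E + 136) * real (card S) \<le> real (card (T u))"
  proof (rule ccontr)
    assume "\<not> ?thesis"
    then have "(\<Sum>u\<in>H0. real (card (T u))) < (\<Sum>u\<in>H0. t ^ (2 * E + 136) * real (card S))"
      using finH0 \<open>0 \<in> H0\<close> by (intro sum_strict_mono) auto
    also have "\<dots> = (t ^ (2 * E + 136) * real (card H0)) * real (card S)" by simp
    also have "\<dots> \<le> 1 * real (card S)" by (rule mult_right_mono[OF H0]) simp
    finally show False using ST by simp
  qed
  then obtain u where u: "u \<in> H0" "t ^ (2 * E + 136) * real (card S) \<le> real (card (T u))" by blast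
  \<comment> \<open>The exponents add up to \<open>3 * E + 281\<close>: the threshold 27, the
    pigeonhole over \<open>H0\<close>, the density of \<open>S\<close> in \<open>A\<close>, and 9
    for the size of \<open>A\<close>.\<close>
  have "t ^ (3249 * D + 281) * N ^ 3 = t ^ 27 * N\<^sup>2 * (t ^ (2 * E + 136) * (t ^ (E + 109) * (t ^ 9 * N)))"
    by (simp add: E_def power3_eq_cube power2_eq_square mult_ac add.commute flip: power_add)
  also have "\<dots> \<le> t ^ 27 * N\<^sup>2 * (t ^ (2 * E + 136) * (t ^ (E + 109) * real (card A)))"
    by (intro mult_left_mono pop(3)) (use t N in auto)
  also have "\<dots> \<le> t ^ 27 * N\<^sup>2 * (t ^ (2 * E + 136) * real (card S))"
    by (intro mult_left_mono SA2) (use t N in auto)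
  also have "\<dots> \<le> t ^ 27 * N\<^sup>2 * real (card (T u))"
    by (rule mult_left_mono[OF u(2)]) (use t in simp)
  also have "\<dots> = t ^ 27 * N\<^sup>2 * real (card (fst ` T u))"
  proof -
    have "inj_on fst (T u)"
      by (rule inj_onI) (auto simp: T_def prod_eq_iff)
    then show ?thesis by (simp add: card_image)
  qed
  also have "\<dots> = (\<Sum>y\<in>fst ` T u. t ^ 27 * N\<^sup>2)" by simp
  also have "\<dots> \<le> (\<Sum>y\<in>fst ` T u. deriv_spec n F (y, L y + u))"
  proof (rule sum_mono)
    fix y assume "y \<in> fst ` T u"
    then obtain a where a: "(y, a) \<in> S" "a + L y = u" by (auto simp: T_def)
    then have "L y + u = a" by (metis add.commute add_self_left)
    then show "t ^ 27 * N\<^sup>2 \<le> deriv_spec n F (y, L y + u)"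
      using a SA by (auto simp: A_def N_def)
  qed
  also have "\<dots> \<le> (\<Sum>y\<in>F2n n. deriv_spec n F (y, L y + u))"
    by (rule sum_mono2) (use SA AV finite_F2n in \<open>auto simp: T_def deriv_spec_nonneg\<close>)
  finally show ?thesis
    using that[of L u] L u by (simp add: H0_def N_def)
qed

end

section \<open>Symmetrising the additive function\<close>

lemma card_kernel_ge_half:
  fixes R :: "'a::exponent_two_group set" and \<phi> :: "'a \<Rightarrow> bit"
  assumes R: "finite R" "add_subgroup R"
    and ad: "\<And>x y. x \<in> R \<Longrightarrow> y \<in> R \<Longrightarrow> \<phi> (x + y) = \<phi> x + \<phi> y"
  shows "card R \<le> 2 * card {x \<in> R. \<phi> x = 0}"
proof (cases "\<forall>x\<in>R. \<phi> x = 0")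
  case True
  then have "{x \<in> R. \<phi> x = 0} = R" by auto
  then show ?thesis by simp
next
  case False
  then obtain a where a: "a \<in> R" "\<phi> a = 1" by auto
  have "R \<subseteq> {x \<in> R. \<phi> x = 0} \<union> (+) a ` {x \<in> R. \<phi> x = 0}"
  proof
    fix x assume x: "x \<in> R"
    show "x \<in> {x \<in> R. \<phi> x = 0} \<union> (+) a ` {x \<in> R. \<phi> x = 0}"
    proof (cases "\<phi> x = 0")
      case False
      then have "a + x \<in> {x \<in> R. \<phi> x = 0}" using a x ad add_subgroup_add[OF R(2)] by simp
      then have "a + (a + x) \<in> (+) a ` {x \<in> R. \<phi> x = 0}" by (rule imageI)
      then show ?thesis by simp
    qed (use x in simp)
  qed
  then have "card R \<le> card ({x \<in> R. \<phi> x = 0} \<union> (+) a ` {x \<in> R. \<phi> x = 0})"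
    by (rule card_mono[rotated]) (use R in simp)
  also have "\<dots> \<le> card {x \<in> R. \<phi> x = 0} + card ((+) a ` {x \<in> R. \<phi> x = 0})" by (rule card_Un_le)
  finally show ?thesis by (simp add: card_translate)
qed

text \<open>Cauchy--Schwarz in \<open>a\<close> removes \<open>\<phi>\<close>. After expanding the
  square, orthogonality in \<open>a\<close> keeps only pairs \<open>c\<close>, \<open>c'\<close>
  whose sum lies in the radical of \<open>D\<close>.\<close>

lemma bilinear_sign_sum_le:
  fixes G :: "'a::exponent_two_group set" and \<phi> \<psi> :: "'a \<Rightarrow> real"
  assumes G: "finite G" "add_subgroup G"
    and D1: "\<And>a b c. a \<in> G \<Longrightarrow> b \<in> G \<Longrightarrow> c \<in> G \<Longrightarrow> D (a + b) c = D a c + D b c"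
    and D2: "\<And>a b c. a \<in> G \<Longrightarrow> b \<in> G \<Longrightarrow> c \<in> G \<Longrightarrow> D a (b + c) = D a b + D a c"
    and \<phi>: "\<And>a. a \<in> G \<Longrightarrow> \<bar>\<phi> a\<bar> \<le> 1" and \<psi>: "\<And>a. a \<in> G \<Longrightarrow> \<bar>\<psi> a\<bar> \<le> 1"
  shows "(\<Sum>a\<in>G. \<Sum>c\<in>G. \<phi> a * \<psi> c * sg (D a c))\<^sup>2 \<le> real (card G) ^ 3 * real (card {c \<in> G. \<forall>a\<in>G. D a c = 0})"
proof -
  define N where "N = real (card G)"
  define R where "R = {c \<in> G. \<forall>a\<in>G. D a c = 0}"
  define X where "X a = (\<Sum>c\<in>G. \<psi> c * sg (D a c))" for a
  have "(\<Sum>a\<in>G. (X a)\<^sup>2) = (\<Sum>a\<in>G. \<Sum>c\<in>G. \<Sum>c'\<in>G. \<psi> c * \<psi> c' * sg (D a (c + c')))"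
    unfolding X_def power2_eq_square sum_product
    by (intro sum.cong refl) (simp add: D2 sg_add mult_ac)
  also have "\<dots> = (\<Sum>c\<in>G. \<Sum>a\<in>G. \<Sum>c'\<in>G. \<psi> c * \<psi> c' * sg (D a (c + c')))"
    by (rule sum.swap)
  also have "\<dots> = (\<Sum>c\<in>G. \<Sum>c'\<in>G. \<Sum>a\<in>G. \<psi> c * \<psi> c' * sg (D a (c + c')))"
    by (rule sum.cong[OF refl]) (rule sum.swap)
  also have "\<dots> \<le> (\<Sum>c\<in>G. \<Sum>c'\<in>G. if c' + c \<in> R then N else 0)"
  proof (intro sum_mono)
    fix c c' assume c: "c \<in> G" "c' \<in> G"
    then have cc: "c + c' \<in> G" using add_subgroup_add[OF G(2)] by blast
    have "(\<Sum>a\<in>G. sg (D a (c + c'))) = (if \<forall>a\<in>G. D a (c + c') = 0 then N else 0)"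
      unfolding N_def by (rule sum_sg_additive[OF G(2)]) (use D1 cc in blast)
    then have eq: "(\<Sum>a\<in>G. \<psi> c * \<psi> c' * sg (D a (c + c'))) = \<psi> c * \<psi> c' * (if c' + c \<in> R then N else 0)"
      using cc by (simp add: R_def add.commute flip: sum_distrib_left)
    have "\<bar>\<psi> c * \<psi> c'\<bar> \<le> 1" unfolding abs_mult by (rule mult_le_one) (use \<psi> c in auto)
    then have "\<psi> c * \<psi> c' \<le> 1" by linarith
    then have "\<psi> c * \<psi> c' * (if c' + c \<in> R then N else 0) \<le> 1 * (if c' + c \<in> R then N else 0)"
      by (rule mult_right_mono) (simp add: N_def)
    then show "(\<Sum>a\<in>G. \<psi> c * \<psi> c' * sg (D a (c + c'))) \<le> (if c' + c \<in> R then N else 0)"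
      unfolding eq by simp
  qed
  also have "\<dots> = (\<Sum>c\<in>G. \<Sum>c'\<in>G. if c' \<in> R then N else 0)"
    by (rule sum.cong[OF refl]) (rule sum_translate[OF G(2)])
  also have "\<dots> = N * N * real (card R)"
  proof -
    have "G \<inter> R = R" by (auto simp: R_def)
    then show ?thesis using G by (simp add: sum.If_cases Int_def N_def flip: mult.assoc)
  qed
  finally have X2: "(\<Sum>a\<in>G. (X a)\<^sup>2) \<le> N * N * real (card R)" .
  have "(\<Sum>a\<in>G. \<Sum>c\<in>G. \<phi> a * \<psi> c * sg (D a c))\<^sup>2 = (\<Sum>a\<in>G. \<phi> a * X a)\<^sup>2"
    by (simp add: X_def sum_distrib_left mult.assoc)
  also have "\<dots> \<le> N * (\<Sum>a\<in>G. (\<phi> a * X a)\<^sup>2)"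
    unfolding N_def by (rule power2_sum_le[OF G(1)])
  also have "\<dots> \<le> N * (\<Sum>a\<in>G. (X a)\<^sup>2)"
  proof (intro mult_left_mono sum_mono)
    fix a assume "a \<in> G"
    then have "(\<phi> a)\<^sup>2 \<le> 1" using \<phi> by (simp add: abs_square_le_1)
    then show "(\<phi> a * X a)\<^sup>2 \<le> (X a)\<^sup>2"
      by (simp add: power_mult_distrib mult_left_le_one_le)
  qed (simp add: N_def)
  also have "\<dots> \<le> N * (N * N * real (card R))"
    by (rule mult_left_mono[OF X2]) (simp add: N_def)
  finally have "(\<Sum>a\<in>G. \<Sum>c\<in>G. \<phi> a * \<psi> c * sg (D a c))\<^sup>2 \<le> N * (N * N * real (card R))" .
  then show ?thesis by (simp add: N_def R_def power3_eq_cube mult_ac)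
qed

text \<open>Evaluate the sum of \<open>sg (e a x)\<close> over \<open>a\<close> in \<open>G\<close>
  and \<open>x\<close> in \<open>K\<close> in both orders.\<close>

lemma (in paired_group) card_annihilator:
  assumes K: "add_subgroup K" "K \<subseteq> G"
  shows "card K * card {a \<in> G. \<forall>x\<in>K. e a x = 0} = card G"
proof -
  have fK: "finite K" using K finite_G finite_subset by blast
  have "real (card K) * real (card {a \<in> G. \<forall>x\<in>K. e a x = 0}) = (\<Sum>a\<in>G. if \<forall>x\<in>K. e a x = 0 then real (card K) else 0)"
    using finite_G by (simp add: sum.If_cases Int_def)
  also have "\<dots> = (\<Sum>a\<in>G. \<Sum>x\<in>K. sg (e a x))"
    by (simp add: sum_sg_additive[OF K(1)] e_add_right)
  also have "\<dots> = (\<Sum>x\<in>K. \<Sum>a\<in>G. sg (e a x))"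
    by (rule sum.swap)
  also have "\<dots> = (\<Sum>x\<in>K. if x = 0 then real (card G) else 0)"
    by (rule sum.cong) (use K sum_sg_e e_commute in auto)
  also have "\<dots> = real (card G)"
    using fK add_subgroup_0[OF K(1)] by simp
  finally show ?thesis by (simp flip: of_nat_mult)
qed

section \<open>Quadratic forms with a given alternating polarisation\<close>

definition vec_of :: "nat \<Rightarrow> ((nat \<Rightarrow> bit) \<Rightarrow> bit) \<Rightarrow> nat \<Rightarrow> bit"
  where "vec_of n \<phi> = (\<lambda>j. if j < n then \<phi> (unit_vec j) else 0)"

lemma vec_of_in_F2n: "vec_of n \<phi> \<in> F2n n"
  by (simp add: vec_of_def F2n_def)

text \<open>Switch on the coordinates of \<open>y\<close> one at a time; \<open>z k\<close> keeps
  the first \<open>k\<close> of them.\<close>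

lemma dot_vec_of:
  assumes ad: "\<And>x y. x \<in> F2n n \<Longrightarrow> y \<in> F2n n \<Longrightarrow> \<phi> (x + y) = \<phi> x + \<phi> y" and y: "y \<in> F2n n"
  shows "dot n (vec_of n \<phi>) y = \<phi> y"
proof -
  have 0: "0 \<in> F2n n" by (rule add_subgroup_0[OF add_subgroup_F2n])
  have \<phi>0: "\<phi> 0 = 0" using ad[OF 0 0] by simp
  define z where "z k = (\<lambda>i. if i < k then y i else 0)" for k
  have zV: "z k \<in> F2n n" for k using y by (simp add: z_def F2n_def)
  have "k \<le> n \<Longrightarrow> \<phi> (z k) = (\<Sum>i<k. \<phi> (unit_vec i) * y i)" for k
  proof (induction k)
    case 0
    have "z 0 = 0" by (simp add: z_def fun_eq_iff)
    then have "\<phi> (z 0) = 0" using \<phi>0 by metis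
    then show ?case by simp
  next
    case (Suc k)
    have "\<phi> (z (Suc k)) = \<phi> (z k) + \<phi> (unit_vec k) * y k"
    proof (cases "y k")
      case zero
      then have "z (Suc k) = z k" by (auto simp: z_def fun_eq_iff less_Suc_eq)
      then show ?thesis by (simp add: zero)
    next
      case one
      then have "z (Suc k) = z k + unit_vec k" by (auto simp: z_def fun_eq_iff less_Suc_eq unit_vec_def)
      then show ?thesis using ad[OF zV unit_vec_in_F2n, of k k] Suc.prems by (simp add: one)
    qed
    then show ?case using Suc by simp
  qed
  from this[of n] have "\<phi> (z n) = dot n (vec_of n \<phi>) y" by (simp add: dot_def vec_of_def)
  moreover have "z n = y" using y by (force simp: z_def fun_eq_iff F2n_def)
  ultimately show ?thesis by simp
qed

text \<open>Only the part of \<open>B\<close> strictly below the diagonal enters: one half of a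
  symmetric form cannot be obtained by dividing by two here, and with this choice the polarisation
  is \<open>B\<close> itself when \<open>B\<close> is alternating.\<close>

definition quad_form :: "nat \<Rightarrow> (nat \<Rightarrow> nat \<Rightarrow> bit) \<Rightarrow> (nat \<Rightarrow> bit) \<Rightarrow> bit"
  where "quad_form n B x = (\<Sum>i<n. \<Sum>j<i. x i * x j * B i j)"

lemma quad_form_add:
  assumes "\<And>i j. B i j = B j i" "\<And>i. B i i = 0"
  shows "quad_form n B (x + y) = quad_form n B x + quad_form n B y + (\<Sum>i<n. \<Sum>j<n. x i * y j * B i j)"
proof -
  have "(\<Sum>i<n. \<Sum>j<n. x i * y j * B i j) = (\<Sum>i<n. \<Sum>j<i. (x i * y j + x j * y i) * B i j)"
  proof (induction n)
    case (Suc n)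
    have "(\<Sum>i<Suc n. \<Sum>j<Suc n. x i * y j * B i j)
      = (\<Sum>i<n. \<Sum>j<n. x i * y j * B i j) + (\<Sum>j<n. x j * y n * B n j) + (\<Sum>j<n. x n * y j * B n j)"
      by (simp add: sum.distrib assms(2) assms(1)[of _ n])
    moreover have "(\<Sum>i<Suc n. \<Sum>j<i. (x i * y j + x j * y i) * B i j)
      = (\<Sum>i<n. \<Sum>j<i. (x i * y j + x j * y i) * B i j) + ((\<Sum>j<n. x n * y j * B n j) + (\<Sum>j<n. x j * y n * B n j))"
      by (simp add: sum.distrib distrib_right)
    ultimately show ?case unfolding Suc by (simp only: ac_simps)
  qed simp
  moreover have "(x i + y i) * (x j + y j) * B i j
      = x i * x j * B i j + y i * y j * B i j + (x i * y j + x j * y i) * B i j" for i j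
    by (simp add: algebra_simps)
  ultimately show ?thesis by (simp add: quad_form_def sum.distrib)
qed

lemma quad_form_of_alternating:
  assumes sym: "\<And>x y. x \<in> F2n n \<Longrightarrow> y \<in> F2n n \<Longrightarrow> \<beta> x y = \<beta> y x"
    and alt: "\<And>x. x \<in> F2n n \<Longrightarrow> \<beta> x x = 0"
    and ad: "\<And>x y z. x \<in> F2n n \<Longrightarrow> y \<in> F2n n \<Longrightarrow> z \<in> F2n n \<Longrightarrow> \<beta> x (y + z) = \<beta> x y + \<beta> x z"
  obtains B where "\<And>x y. x \<in> F2n n \<Longrightarrow> y \<in> F2n n \<Longrightarrow> quad_form n B (x + y) = quad_form n B x + quad_form n B y + \<beta> x y"
proof -
  define B where "B i j = (if i < n \<and> j < n then \<beta> (unit_vec i) (unit_vec j) else 0)" for i j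
  show ?thesis
  proof (rule that[of B])
    fix x y assume x: "x \<in> F2n n" and y: "y \<in> F2n n"
    have vec: "dot n (vec_of n (\<beta> z)) w = \<beta> z w" if "z \<in> F2n n" "w \<in> F2n n" for z w
      by (rule dot_vec_of[OF ad[OF that(1)] that(2)])
    have "\<beta> x y = dot n (vec_of n (\<beta> x)) y" by (rule vec[OF x y, symmetric])
    also have "\<dots> = (\<Sum>j<n. \<beta> (unit_vec j) x * y j)"
      unfolding dot_def vec_of_def by (rule sum.cong) (use x sym unit_vec_in_F2n in auto)
    also have "\<dots> = (\<Sum>j<n. dot n (vec_of n (\<beta> (unit_vec j))) x * y j)"
      by (rule sum.cong[OF refl], subst vec) (use x unit_vec_in_F2n in auto)
    also have "\<dots> = (\<Sum>j<n. \<Sum>i<n. x i * y j * B i j)"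
      unfolding dot_def vec_of_def sum_distrib_right
      by (intro sum.cong refl) (use sym unit_vec_in_F2n in \<open>auto simp: B_def\<close>)
    also have "\<dots> = (\<Sum>i<n. \<Sum>j<n. x i * y j * B i j)" by (rule sum.swap)
    finally have "\<beta> x y = (\<Sum>i<n. \<Sum>j<n. x i * y j * B i j)" .
    then show "quad_form n B (x + y) = quad_form n B x + quad_form n B y + \<beta> x y"
      using sym alt unit_vec_in_F2n by (subst quad_form_add) (auto simp: B_def)
  qed
qed

context
  fixes n :: nat and F :: "(nat \<Rightarrow> bit) \<Rightarrow> real" and L :: "(nat \<Rightarrow> bit) \<Rightarrow> nat \<Rightarrow> bit"
    and u :: "nat \<Rightarrow> bit" and \<eta> :: real
  assumes F1: "\<And>x. F x * F x = 1"
    and L_in: "\<And>x. x \<in> F2n n \<Longrightarrow> L x \<in> F2n n"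
    and L_add: "\<And>x y. x \<in> F2n n \<Longrightarrow> y \<in> F2n n \<Longrightarrow> L (x + y) = L x + L y"
    and u: "u \<in> F2n n" and \<eta>: "\<eta> \<ge> 0"
    and spec: "\<eta> * real (card (F2n n)) ^ 3 \<le> (\<Sum>y\<in>F2n n. deriv_spec n F (y, L y + u))"
begin

interpretation paired_group "F2n n" "dot n" by (rule paired_group_F2n)

lemma abs_F: "\<bar>F x\<bar> = 1"
  using F1[of x] by (metis abs_mult abs_mult_self_eq abs_one abs_square_eq_1 power2_eq_square)

text \<open>In the variables \<open>s = y + h\<close>, \<open>a = x + y\<close>,
  \<open>c = x + h + y\<close> every factor of the spectral sum depends on \<open>(s, a)\<close> or
  on \<open>(s, c)\<close> alone, apart from the sign of
  \<open>dot n (L a) c + dot n (L c) a\<close>. For fixed \<open>s\<close> that double sum is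
  controlled by the radical of this form.\<close>

lemma symmetric_radical_ge:
  "\<eta>\<^sup>2 * real (card (F2n n)) \<le> real (card {c \<in> F2n n. \<forall>a\<in>F2n n. dot n (L a) c + dot n (L c) a = 0})"
proof -
  let ?V = "F2n n"
  define N where "N = real (card ?V)"
  define R where "R = {c \<in> ?V. \<forall>a\<in>?V. dot n (L a) c + dot n (L c) a = 0}"
  define \<phi> where "\<phi> s a = F a * F (a + s) * sg (dot n (L a) a) * sg (dot n (L s) a) * sg (dot n u a)" for s a
  have N: "N > 0" using card_G_pos by (simp add: N_def)
  have add: "x + y \<in> ?V" if "x \<in> ?V" "y \<in> ?V" for x y using that add_subgroup_add[OF subgroup_G] by blast
  define f where "f = (\<lambda>(y, h, x). F x * F (x + y) * (F (x + h) * F (x + h + y)) * sg (dot n (L y + u) h))"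
  have "(\<Sum>y\<in>?V. deriv_spec n F (y, L y + u)) = (\<Sum>y\<in>?V. \<Sum>h\<in>?V. \<Sum>x\<in>?V. f (y, h, x))"
    using L_in u add by (simp add: deriv_spec_eq_fourier fourier_def deriv_corr_def f_def sum_distrib_right)
  also have "\<dots> = (\<Sum>p\<in>?V \<times> ?V \<times> ?V. f p)"
    by (simp add: sum.cartesian_product)
  also have "\<dots> = (\<Sum>(s, a, c)\<in>?V \<times> ?V \<times> ?V. \<phi> s a * \<phi> s c * sg (dot n (L a) c + dot n (L c) a))"
  proof (rule sum.reindex_bij_witness[where i="\<lambda>(s, a, c). (a + s + c, a + c, s + c)"
        and j="\<lambda>(y, h, x). (y + h, x + y, x + h + y)"], goal_cases)
    case (1 p)
    then show ?case by (auto simp: ac_simps)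
  next
    case (2 p)
    then show ?case using add by auto
  next
    case (3 p)
    then show ?case by (auto simp: ac_simps)
  next
    case (4 p)
    then show ?case using add by auto
  next
    case (5 p)
    then obtain y h x where p: "p = (y, h, x)" "y \<in> ?V" "h \<in> ?V" "x \<in> ?V" by auto
    define s a c where "s = y + h" and "a = x + y" and "c = x + h + y"
    have sac: "s \<in> ?V" "a \<in> ?V" "c \<in> ?V" using p add by (simp_all add: s_def a_def c_def)
    have yhx: "y = a + s + c" "h = a + c" "x = s + c" "x + y = a" "x + h = a + s" "x + h + y = c"
      by (simp_all add: s_def a_def c_def ac_simps)
    have Ly: "L y = L a + L s + L c" using sac yhx(1) add by (simp add: L_add)
    have "f p = F x * F (x + y) * (F (x + h) * F (x + h + y)) * sg (dot n (L y + u) h)"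
      by (simp add: f_def p)
    also have "\<dots> = F (s + c) * F a * (F (a + s) * F c) * sg (dot n (L a + L s + L c + u) (a + c))"
      unfolding Ly yhx(6) unfolding yhx(4,5) by (simp only: yhx(2,3))
    also have "\<dots> = \<phi> s a * \<phi> s c * sg (dot n (L a) c + dot n (L c) a)"
      by (simp add: \<phi>_def e_add_left e_add_right sg_add add.commute[of s c] mult_ac)
    finally show ?case by (simp add: p(1) s_def a_def c_def)
  qed
  also have "\<dots> = (\<Sum>s\<in>?V. \<Sum>a\<in>?V. \<Sum>c\<in>?V. \<phi> s a * \<phi> s c * sg (dot n (L a) c + dot n (L c) a))"
    by (simp add: sum.cartesian_product)
  finally have "\<eta> * N ^ 3 \<le> (\<Sum>s\<in>?V. \<Sum>a\<in>?V. \<Sum>c\<in>?V. \<phi> s a * \<phi> s c * sg (dot n (L a) c + dot n (L c) a))"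
    using spec by (simp add: N_def)
  then have "(\<eta> * N ^ 3)\<^sup>2 \<le> (\<Sum>s\<in>?V. \<Sum>a\<in>?V. \<Sum>c\<in>?V. \<phi> s a * \<phi> s c * sg (dot n (L a) c + dot n (L c) a))\<^sup>2"
    by (rule power_mono) (use \<eta> N in simp)
  also have "\<dots> \<le> N * (\<Sum>s\<in>?V. (\<Sum>a\<in>?V. \<Sum>c\<in>?V. \<phi> s a * \<phi> s c * sg (dot n (L a) c + dot n (L c) a))\<^sup>2)"
    unfolding N_def by (rule power2_sum_le[OF finite_F2n])
  also have "\<dots> \<le> N * (\<Sum>s\<in>?V. N ^ 3 * real (card R))"
  proof (intro mult_left_mono sum_mono)
    fix s assume s: "s \<in> ?V"
    show "(\<Sum>a\<in>?V. \<Sum>c\<in>?V. \<phi> s a * \<phi> s c * sg (dot n (L a) c + dot n (L c) a))\<^sup>2 \<le> N ^ 3 * real (card R)"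
      unfolding N_def R_def
      by (rule bilinear_sign_sum_le[OF finite_G subgroup_G])
        (simp_all add: L_add e_add_left e_add_right ac_simps \<phi>_def abs_mult abs_F)
  qed (use N in simp)
  also have "\<dots> = N ^ 5 * real (card R)" by (simp add: N_def eval_nat_numeral mult_ac)
  finally have "N ^ 5 * (\<eta>\<^sup>2 * N) \<le> N ^ 5 * real (card R)"
    by (simp add: power_mult_distrib eval_nat_numeral mult_ac)
  moreover have "N ^ 5 > 0" using N by simp
  ultimately have "\<eta>\<^sup>2 * N \<le> real (card R)" by (rule mult_left_le_imp_le)
  then show ?thesis by (simp add: N_def R_def)
qed

end

section \<open>From one frequency shared by many derivatives to a quadratic phase\<close>

lemma exists_ge_weighted_average:
  fixes w m :: "'a \<Rightarrow> real"
  assumes A: "finite A" and w: "\<And>a. a \<in> A \<Longrightarrow> 0 \<le> w a" and pos: "0 < sum w A"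
    and le: "s * sum w A \<le> (\<Sum>a\<in>A. w a * m a)"
  shows "\<exists>a\<in>A. s \<le> m a"
proof (rule ccontr)
  assume "\<not> ?thesis"
  then have less: "m a < s" if "a \<in> A" for a using that by force
  obtain b where b: "b \<in> A" "0 < w b"
    using pos sum_nonpos[of A w] by (metis linorder_not_less)
  have "(\<Sum>a\<in>A. w a * m a) < (\<Sum>a\<in>A. w a * s)"
  proof (rule sum_strict_mono_ex1[OF A])
    show "\<forall>a\<in>A. w a * m a \<le> w a * s"
      by (rule ballI, rule mult_left_mono) (use less w in \<open>auto intro: less_imp_le\<close>)
    show "\<exists>a\<in>A. w a * m a < w a * s"
      using b(1) mult_strict_left_mono[OF less[OF b(1)] b(2)] by blast
  qed
  also have "\<dots> = s * sum w A" unfolding sum_distrib_right[symmetric] by (rule mult.commute)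
  finally show False using le by simp
qed

text \<open>With \<open>\<alpha>\<close> fixed, the coefficient for direction \<open>y\<close> is
  the correlation at \<open>y\<close> of \<open>F\<close> with its modulation \<open>g\<close>. The
  sum of squares is an average of squared coefficients of \<open>F\<close>, weighted by those of
  \<open>g\<close>, so one coefficient of \<open>F\<close> reaches the average.\<close>

lemma correlation_of_spectrum:
  assumes F1: "\<And>x. F x * F x = 1" and \<alpha>: "\<alpha> \<in> F2n n"
    and s: "s * real (card (F2n n)) \<le> (\<Sum>y\<in>F2n n. deriv_spec n F (y, \<alpha>))"
  obtains b where "b \<in> F2n n" "s \<le> (\<Sum>x\<in>F2n n. F x * sg (dot n b x))\<^sup>2"
proof -
  interpret paired_group "F2n n" "dot n" by (rule paired_group_F2n)
  let ?V = "F2n n"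
  define N where "N = real (card ?V)"
  have N: "N > 0" using card_G_pos by (simp add: N_def)
  define g where "g x = F x * sg (dot n \<alpha> x)" for x
  have sum_eq: "(\<Sum>y\<in>?V. deriv_spec n F (y, \<alpha>)) = (\<Sum>y\<in>?V. (\<Sum>x\<in>?V. g x * F (x + y))\<^sup>2)"
    by (simp add: deriv_spec_def fourier_def g_def mult_ac)
  have sumg: "(\<Sum>b\<in>?V. (fourier ?V (dot n) g b)\<^sup>2) = N * N"
  proof -
    have "(g x)\<^sup>2 = 1" for x using F1[of x] by (simp add: g_def power_mult_distrib) (simp add: power2_eq_square)
    then show ?thesis by (simp add: parseval N_def)
  qed
  have "s * (N * N) \<le> N * (\<Sum>y\<in>?V. deriv_spec n F (y, \<alpha>))"
    using mult_left_mono[OF s, of N] N by (simp add: N_def mult_ac)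
  also have "\<dots> = (\<Sum>b\<in>?V. (fourier ?V (dot n) g b)\<^sup>2 * (fourier ?V (dot n) F b)\<^sup>2)"
    unfolding sum_eq sum_correlation_power2 using N by (simp add: N_def)
  finally have "s * (\<Sum>b\<in>?V. (fourier ?V (dot n) g b)\<^sup>2)
      \<le> (\<Sum>b\<in>?V. (fourier ?V (dot n) g b)\<^sup>2 * (fourier ?V (dot n) F b)\<^sup>2)"
    unfolding sumg .
  then have "\<exists>b\<in>?V. s \<le> (fourier ?V (dot n) F b)\<^sup>2"
    by (rule exists_ge_weighted_average[OF finite_G, rotated 2]) (use N in \<open>simp_all add: sumg\<close>)
  then show ?thesis using that by (auto simp: fourier_def)
qed

text \<open>
  Multiplying \<open>F\<close> by a quadratic phase with alternating form \<open>\<beta>'\<close> shifts the spectrum by \<open>\<beta>'\<close>. The form of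
  \<open>L\<close> is symmetric on its radical \<open>R\<close> and alternating on a subgroup \<open>R0\<close> of index at most two in \<open>R\<close>;
  for \<open>\<beta>'\<close> we take its restriction to \<open>R0\<close>, extended by a projection onto \<open>R0\<close>.
\<close>

lemma quadratic_correlation:
  assumes F1: "\<And>x. F x * F x = 1"
    and L_in: "\<And>x. x \<in> F2n n \<Longrightarrow> L x \<in> F2n n"
    and L_add: "\<And>x y. x \<in> F2n n \<Longrightarrow> y \<in> F2n n \<Longrightarrow> L (x + y) = L x + L y"
    and u: "u \<in> F2n n" and \<eta>: "\<eta> \<ge> 0"
    and spec: "\<eta> * real (card (F2n n)) ^ 3 \<le> (\<Sum>y\<in>F2n n. deriv_spec n F (y, L y + u))"
  obtains B b where "b \<in> F2n n"
    "\<eta> ^ 5 / 4 * (real (card (F2n n)))\<^sup>2 \<le> (\<Sum>x\<in>F2n n. F x * sg (quad_form n B x) * sg (dot n b x))\<^sup>2"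
proof -
  interpret paired_group "F2n n" "dot n" by (rule paired_group_F2n)
  let ?V = "F2n n"
  define N where "N = real (card ?V)"
  define \<beta> where "\<beta> x y = dot n (L x) y" for x y
  have \<beta>1: "\<beta> (x + y) z = \<beta> x z + \<beta> y z" if "x \<in> ?V" "y \<in> ?V" for x y z
    using that by (simp add: \<beta>_def L_add e_add_left)
  have \<beta>2: "\<beta> z (x + y) = \<beta> z x + \<beta> z y" for x y z
    by (simp add: \<beta>_def e_add_right)
  have N: "N > 0" using card_G_pos by (simp add: N_def)
  have add: "x + y \<in> ?V" if "x \<in> ?V" "y \<in> ?V" for x y using that add_subgroup_add[OF subgroup_G] by blast
  have V0: "0 \<in> ?V" by (rule add_subgroup_0[OF subgroup_G])
  have L0: "L 0 = 0" using L_add[OF V0 V0] by simp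
  define R where "R = {c \<in> ?V. \<forall>a\<in>?V. \<beta> a c + \<beta> c a = 0}"
  have R_ge: "\<eta>\<^sup>2 * N \<le> real (card R)"
    unfolding N_def R_def \<beta>_def by (rule symmetric_radical_ge[OF F1 L_in L_add u \<eta> spec])
  have R_sym: "\<beta> a c = \<beta> c a" if "c \<in> R" "a \<in> ?V" for a c
    using that by (simp add: R_def add_eq_0_iff_eq)
  have R: "add_subgroup R"
    unfolding add_subgroup_def
  proof (intro conjI ballI)
    show "0 \<in> R" using V0 by (simp add: R_def \<beta>_def L0)
    fix x y assume xy: "x \<in> R" "y \<in> R"
    then have "\<beta> a (x + y) + \<beta> (x + y) a = 0" if "a \<in> ?V" for a
      using R_sym[OF xy(1) that] R_sym[OF xy(2) that] by (simp add: R_def \<beta>1 \<beta>2)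
    then show "x + y \<in> R" using xy add by (simp add: R_def)
  qed
  have RV: "R \<subseteq> ?V" by (auto simp: R_def)
  \<comment> \<open>On \<open>R\<close> the form is symmetric, so the cross terms of
    \<open>\<beta> (x + y) (x + y)\<close> cancel and \<open>R0\<close> is the kernel of an additive
    map to bits.\<close>
  define R0 where "R0 = {x \<in> R. \<beta> x x = 0}"
  have diag: "\<beta> (x + y) (x + y) = \<beta> x x + \<beta> y y" if "x \<in> R" "y \<in> R" for x y
  proof -
    have "\<beta> y x = \<beta> x y" by (rule R_sym) (use that RV in auto)
    moreover have "x \<in> ?V" "y \<in> ?V" using that RV by auto
    ultimately show ?thesis by (simp add: \<beta>1 \<beta>2 ac_simps)
  qed
  have R0: "add_subgroup R0"
    unfolding add_subgroup_def
  proof (intro conjI ballI)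
    show "0 \<in> R0" using add_subgroup_0[OF R] by (simp add: R0_def \<beta>_def L0)
    show "x + y \<in> R0" if "x \<in> R0" "y \<in> R0" for x y
      using that add_subgroup_add[OF R] diag by (simp add: R0_def)
  qed
  have R0V: "R0 \<subseteq> ?V" using RV by (auto simp: R0_def)
  have fin: "finite R" "finite R0" using RV R0V finite_G finite_subset by blast+
  have R0_ge: "\<eta>\<^sup>2 / 2 * N \<le> real (card R0)"
  proof -
    have "card R \<le> 2 * card R0"
      unfolding R0_def by (rule card_kernel_ge_half[OF fin(1) R]) (rule diag)
    then show ?thesis using R_ge by linarith
  qed
  have R0_pos: "0 < real (card R0)" using fin add_subgroup_0[OF R0] by (auto simp: card_gt_0_iff)
  obtain \<pi> where \<pi>: "\<And>x. x \<in> ?V \<Longrightarrow> \<pi> x \<in> R0"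
    "\<And>x y. x \<in> ?V \<Longrightarrow> y \<in> ?V \<Longrightarrow> \<pi> (x + y) = \<pi> x + \<pi> y" "\<And>x. x \<in> R0 \<Longrightarrow> \<pi> x = x"
  proof -
    \<comment> \<open>The diagonal of \<open>R0\<close> has trivial vertical part, so the additive
      map obtained from it extends the identity of \<open>R0\<close> to the whole space.\<close>
    define H where "H = {(x, x) | x. x \<in> R0}"
    have H: "add_subgroup H" "H \<subseteq> ?V \<times> R0"
      using R0 R0V by (auto simp: add_subgroup_def zero_prod_def H_def)
    obtain \<pi> where \<pi>: "\<And>x. x \<in> ?V \<Longrightarrow> \<pi> x \<in> R0"
      "\<And>x y. x \<in> ?V \<Longrightarrow> y \<in> ?V \<Longrightarrow> \<pi> (x + y) = \<pi> x + \<pi> y"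
      "\<And>y a. (y, a) \<in> H \<Longrightarrow> (0, a + \<pi> y) \<in> H"
      using additive_of_subgroup[OF finite_G subgroup_G fin(2) R0 H] by metis
    have "\<pi> x = x" if "x \<in> R0" for x
    proof -
      have "(x, x) \<in> H" using that by (simp add: H_def)
      from \<pi>(3)[OF this] have "x + \<pi> x = 0" by (simp add: H_def)
      then show ?thesis by (simp add: add_eq_0_iff_eq)
    qed
    note id = this
    show thesis
    proof (rule that)
      show "\<pi> x \<in> R0" if "x \<in> ?V" for x by (rule \<pi>(1)[OF that])
      show "\<pi> (x + y) = \<pi> x + \<pi> y" if "x \<in> ?V" "y \<in> ?V" for x y by (rule \<pi>(2)[OF that])
      show "\<pi> x = x" if "x \<in> R0" for x by (rule id[OF that])
    qed
  qed
  have R0R: "x \<in> R" if "x \<in> R0" for x using that by (simp add: R0_def)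
  have \<pi>V: "\<pi> x \<in> ?V" if "x \<in> ?V" for x using \<pi>(1)[OF that] R0V by blast
  define \<beta>' where "\<beta>' x y = \<beta> (\<pi> x) (\<pi> y)" for x y
  have \<beta>'_sym: "\<beta>' x y = \<beta>' y x" if "x \<in> ?V" "y \<in> ?V" for x y
    unfolding \<beta>'_def by (rule R_sym[OF R0R[OF \<pi>(1)[OF that(2)]] \<pi>V[OF that(1)]])
  have \<beta>'_add: "\<beta>' x (y + z) = \<beta>' x y + \<beta>' x z" if "y \<in> ?V" "z \<in> ?V" for x y z
    using that by (simp add: \<beta>'_def \<pi>(2) \<beta>2)
  have \<beta>'_add1: "\<beta>' (x + y) z = \<beta>' x z + \<beta>' y z" if "x \<in> ?V" "y \<in> ?V" for x y z
    using that by (simp add: \<beta>'_def \<pi>(2) \<beta>1 \<pi>V)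
  obtain B where B: "\<And>x y. x \<in> ?V \<Longrightarrow> y \<in> ?V \<Longrightarrow> quad_form n B (x + y) = quad_form n B x + quad_form n B y + \<beta>' x y"
  proof (rule quad_form_of_alternating[of n \<beta>'])
    show "\<beta>' x x = 0" if "x \<in> ?V" for x using \<pi>(1)[OF that] by (simp add: \<beta>'_def R0_def)
    show "\<beta>' x y = \<beta>' y x" if "x \<in> ?V" "y \<in> ?V" for x y by (rule \<beta>'_sym[OF that])
    show "\<beta>' x (y + z) = \<beta>' x y + \<beta>' x z" if "x \<in> ?V" "y \<in> ?V" "z \<in> ?V" for x y z by (rule \<beta>'_add[OF that(2,3)])
  qed (rule that)
  define L' where "L' x = vec_of n (\<beta>' x)" for x
  have L'V: "L' x \<in> ?V" for x by (simp add: L'_def vec_of_in_F2n)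
  have L': "dot n (L' x) y = \<beta>' x y" if "y \<in> ?V" for x y
    unfolding L'_def by (rule dot_vec_of[OF \<beta>'_add that])
  define F' where "F' x = F x * sg (quad_form n B x)" for x
  have F'1: "F' x * F' x = 1" for x
  proof -
    have "F' x * F' x = (F x * F x) * (sg (quad_form n B x) * sg (quad_form n B x))"
      by (simp only: F'_def mult_ac)
    then show ?thesis by (simp add: F1)
  qed
  \<comment> \<open>Expanding the quadratic phase at \<open>x + y\<close> leaves the character of
    \<open>L' y\<close> and a sign depending on \<open>y\<close> only, which disappears in the
    square.\<close>
  have shift: "deriv_spec n F' (y, a) = deriv_spec n F (y, a + L' y)" if y: "y \<in> ?V" for y a
  proof -
    have "fourier ?V (dot n) (\<lambda>x. F' x * F' (x + y)) a
        = (\<Sum>x\<in>?V. sg (quad_form n B y) * (F x * F (x + y) * sg (dot n (a + L' y) x)))"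
      unfolding fourier_def
    proof (rule sum.cong[OF refl])
      fix x assume x: "x \<in> ?V"
      have "F' x * F' (x + y) * sg (dot n a x)
          = (sg (quad_form n B x) * sg (quad_form n B x)) * sg (quad_form n B y) * (F x * F (x + y) * (sg (dot n a x) * sg (\<beta>' x y)))"
        using x y by (simp only: F'_def B sg_add mult_ac)
      also have "\<beta>' x y = dot n (L' y) x" using L'[OF x, of y] \<beta>'_sym[OF x y] by simp
      finally show "F' x * F' (x + y) * sg (dot n a x) = sg (quad_form n B y) * (F x * F (x + y) * sg (dot n (a + L' y) x))"
        by (simp only: e_add_left sg_add sg_mult_self mult_1_left mult_ac)
    qed
    then have "fourier ?V (dot n) (\<lambda>x. F' x * F' (x + y)) a
        = sg (quad_form n B y) * fourier ?V (dot n) (\<lambda>x. F x * F (x + y)) (a + L' y)"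
      by (simp add: fourier_def sum_distrib_left)
    then show ?thesis by (simp add: deriv_spec_def power_mult_distrib)
  qed
  define \<gamma> where "\<gamma> x = L x + L' x" for x
  have \<gamma>V: "\<gamma> x \<in> ?V" if "x \<in> ?V" for x using that L_in L'V add by (simp add: \<gamma>_def)
  have L'_add: "L' (x + y) = L' x + L' y" if "x \<in> ?V" "y \<in> ?V" for x y
    using that \<beta>'_add1 by (auto simp: L'_def vec_of_def fun_eq_iff)
  have \<gamma>_add: "\<gamma> (x + y) = \<gamma> x + \<gamma> y" if "x \<in> ?V" "y \<in> ?V" for x y
    using that by (simp add: \<gamma>_def L_add L'_add ac_simps)
  define Z where "Z = {x \<in> ?V. \<pi> x = 0}"
  define An where "An = {a \<in> ?V. \<forall>x\<in>R0. dot n a x = 0}"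
  have finZ: "finite Z" "finite An" using finite_G by (simp_all add: Z_def An_def)
  \<comment> \<open>Write \<open>x\<close> as \<open>x + \<pi> x\<close>, in the kernel of
    \<open>\<pi>\<close>, plus \<open>\<pi> x\<close>, in \<open>R0\<close>. Since
    \<open>\<beta>\<close> and \<open>\<beta>'\<close> agree on \<open>R0\<close>, their sum
    vanishes there, so \<open>\<gamma> (\<pi> x)\<close> annihilates \<open>R0\<close>.\<close>
  have image: "\<gamma> ` ?V \<subseteq> \<gamma> ` Z + An"
  proof
    fix w assume "w \<in> \<gamma> ` ?V"
    then obtain x where x: "x \<in> ?V" "w = \<gamma> x" by blast
    have "\<pi> (\<pi> x) = \<pi> x" using \<pi>(1)[OF x(1)] \<pi>(3) by blast
    then have "x + \<pi> x \<in> Z" using x \<pi>V add by (simp add: Z_def \<pi>(2))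
    moreover have "\<gamma> (\<pi> x) \<in> An"
      unfolding An_def
    proof (intro CollectI conjI ballI)
      show "\<gamma> (\<pi> x) \<in> ?V" using \<gamma>V \<pi>V x by blast
      fix r assume r: "r \<in> R0"
      then have "r \<in> ?V" using R0V by blast
      then show "dot n (\<gamma> (\<pi> x)) r = 0"
        using \<pi>(3)[OF r] \<open>\<pi> (\<pi> x) = \<pi> x\<close> by (simp add: \<gamma>_def e_add_left L' \<beta>'_def flip: \<beta>_def)
    qed
    moreover have "w = \<gamma> (x + \<pi> x) + \<gamma> (\<pi> x)"
      using x \<pi>V by (simp add: \<gamma>_add add.assoc)
    ultimately show "w \<in> \<gamma> ` Z + An" by blast
  qed
  \<comment> \<open>The kernel \<open>Z\<close> and the annihilator \<open>An\<close> each have at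
    most \<open>N / card R0\<close> elements, which bounds the number of values of
    \<open>\<gamma>\<close> by the square of this.\<close>
  have Z_le: "real (card Z) * real (card R0) \<le> N"
  proof -
    have "card (Z + R0) = card Z * card R0"
    proof (rule card_direct_sum[OF _ R0])
      fix a a' assume *: "a \<in> Z" "a' \<in> Z" "a + a' \<in> R0"
      then have "a + a' = 0" using \<pi>(3)[OF *(3)] by (simp add: Z_def \<pi>(2))
      then show "a = a'" by (simp add: add_eq_0_iff_eq)
    qed
    moreover have "card (Z + R0) \<le> card ?V"
      by (rule card_mono[OF finite_G]) (use R0V add in \<open>auto simp: Z_def elim!: set_plus_elim\<close>)
    ultimately show ?thesis by (simp add: N_def flip: of_nat_mult)
  qed
  have An_eq: "real (card An) * real (card R0) = N"
    using card_annihilator[OF R0 R0V] by (simp add: An_def N_def mult.commute flip: of_nat_mult)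
  define I where "I = (\<lambda>w. w + u) ` \<gamma> ` ?V"
  have finI: "finite I" using finite_G by (simp add: I_def)
  have IV: "I \<subseteq> ?V" using \<gamma>V u add by (auto simp: I_def)
  have I0: "I \<noteq> {}" using V0 by (auto simp: I_def)
  have I_le: "real (card I) * (real (card R0))\<^sup>2 \<le> N\<^sup>2"
  proof -
    have "card I \<le> card (\<gamma> ` ?V)" unfolding I_def by (rule card_image_le) (simp add: finite_G)
    also have "\<dots> \<le> card (\<gamma> ` Z + An)"
      by (rule card_mono[OF _ image]) (use finZ in \<open>auto intro: finite_set_plus\<close>)
    also have "\<dots> \<le> card (\<gamma> ` Z) * card An" by (rule card_set_plus_le) (use finZ in auto)
    also have "\<dots> \<le> card Z * card An" using finZ by (intro mult_right_mono card_image_le) auto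
    finally have "real (card I) \<le> real (card Z) * real (card An)" by (simp flip: of_nat_mult)
    then have "real (card I) * (real (card R0))\<^sup>2 \<le> real (card Z) * real (card An) * (real (card R0))\<^sup>2"
      by (rule mult_right_mono) simp
    also have "\<dots> = (real (card Z) * real (card R0)) * (real (card An) * real (card R0))"
      by (simp add: power2_eq_square mult_ac)
    also have "\<dots> \<le> N * N" unfolding An_eq by (rule mult_right_mono[OF Z_le]) (use N in simp)
    finally show ?thesis by (simp add: power2_eq_square)
  qed
  have total: "\<eta> * N ^ 3 \<le> (\<Sum>\<alpha>\<in>I. \<Sum>y\<in>?V. deriv_spec n F' (y, \<alpha>))"
  proof -
    have "\<eta> * N ^ 3 \<le> (\<Sum>y\<in>?V. deriv_spec n F (y, L y + u))" using spec by (simp add: N_def)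
    also have "\<dots> = (\<Sum>y\<in>?V. deriv_spec n F' (y, \<gamma> y + u))"
    proof (rule sum.cong[OF refl])
      fix y assume "y \<in> ?V"
      moreover have "\<gamma> y + u + L' y = L y + u"
        by (simp add: \<gamma>_def ac_simps)
      ultimately show "deriv_spec n F (y, L y + u) = deriv_spec n F' (y, \<gamma> y + u)" by (simp only: shift)
    qed
    also have "\<dots> \<le> (\<Sum>y\<in>?V. \<Sum>\<alpha>\<in>I. deriv_spec n F' (y, \<alpha>))"
    proof (rule sum_mono, rule member_le_sum)
      show "\<gamma> y + u \<in> I" if "y \<in> ?V" for y
        unfolding I_def by (intro imageI that)
    qed (use finI deriv_spec_nonneg in auto)
    also have "\<dots> = (\<Sum>\<alpha>\<in>I. \<Sum>y\<in>?V. deriv_spec n F' (y, \<alpha>))" by (rule sum.swap)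
    finally show ?thesis .
  qed
  \<comment> \<open>As \<open>card I\<close> is at most \<open>N\<^sup>2 / (card R0)\<^sup>2\<close>
    and \<open>card R0\<close> is at least \<open>\<eta>\<^sup>2 / 2 * N\<close>, some frequency
    carries a share \<open>\<eta> ^ 4 / 4\<close> of the total
    \<open>\<eta> * N ^ 3\<close>.\<close>
  have "\<exists>\<alpha>\<in>I. \<eta> ^ 5 / 4 * N\<^sup>2 * N \<le> (\<Sum>y\<in>?V. deriv_spec n F' (y, \<alpha>))"
  proof (rule ccontr)
    assume "\<not> ?thesis"
    then have "(\<Sum>\<alpha>\<in>I. \<Sum>y\<in>?V. deriv_spec n F' (y, \<alpha>)) < (\<Sum>\<alpha>\<in>I. \<eta> ^ 5 / 4 * N\<^sup>2 * N)"
      by (intro sum_strict_mono finI I0) auto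
    then have "\<eta> * N ^ 3 < real (card I) * (\<eta> ^ 5 / 4 * N\<^sup>2 * N)" using total by simp
    also have "\<dots> = \<eta> * N * (real (card I) * (\<eta>\<^sup>2 / 2 * N)\<^sup>2)"
    proof -
      have "(\<eta>\<^sup>2 / 2 * N)\<^sup>2 = \<eta> ^ 4 / 4 * N\<^sup>2"
        by (simp add: power_mult_distrib power_divide flip: power_mult)
      moreover have "\<eta> ^ 5 = \<eta> * \<eta> ^ 4" by (simp flip: power_Suc)
      ultimately show ?thesis by simp
    qed
    also have "\<dots> \<le> \<eta> * N * (real (card I) * (real (card R0))\<^sup>2)"
      by (intro mult_left_mono power_mono R0_ge) (use \<eta> N in auto)
    also have "\<dots> \<le> \<eta> * N * N\<^sup>2" by (rule mult_left_mono[OF I_le]) (use \<eta> N in auto)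
    finally show False by (simp add: power3_eq_cube power2_eq_square)
  qed
  then obtain \<alpha> where \<alpha>: "\<alpha> \<in> I" "\<eta> ^ 5 / 4 * N\<^sup>2 * N \<le> (\<Sum>y\<in>?V. deriv_spec n F' (y, \<alpha>))" by blast
  obtain b where "b \<in> ?V" "\<eta> ^ 5 / 4 * N\<^sup>2 \<le> (\<Sum>x\<in>?V. F' x * sg (dot n b x))\<^sup>2"
    using correlation_of_spectrum[where F=F' and n=n and \<alpha>=\<alpha> and s="\<eta> ^ 5 / 4 * N\<^sup>2"] F'1 \<alpha> IV by (auto simp: N_def)
  then show ?thesis using that[of b B] by (simp add: N_def F'_def)
qed

section \<open>Gowers norms and quadratic polynomials\<close>

lemma sum_lists_length_3:
  assumes "finite V"
  shows "(\<Sum>ys\<in>{ys. set ys \<subseteq> V \<and> length ys = 3}. h ys) = (\<Sum>a\<in>V. \<Sum>b\<in>V. \<Sum>c\<in>V. h [a, b, c])"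
proof -
  have "(\<Sum>ys\<in>{ys. set ys \<subseteq> V \<and> length ys = 3}. h ys) = (\<Sum>(a, b, c)\<in>V \<times> V \<times> V. h [a, b, c])"
  proof (rule sum.reindex_bij_witness[where i="\<lambda>(a, b, c). [a, b, c]" and j="\<lambda>ys. (ys ! 0, ys ! 1, ys ! 2)"])
    fix ys assume "ys \<in> {ys. set ys \<subseteq> V \<and> length ys = 3}"
    then obtain a b c where "ys = [a, b, c]" "a \<in> V" "b \<in> V" "c \<in> V"
      by (auto simp: numeral_3_eq_3 length_Suc_conv)
    then show "(case (ys ! 0, ys ! 1, ys ! 2) of (a, b, c) \<Rightarrow> [a, b, c]) = ys"
      "(ys ! 0, ys ! 1, ys ! 2) \<in> V \<times> V \<times> V"
      "(case (ys ! 0, ys ! 1, ys ! 2) of (a, b, c) \<Rightarrow> h [a, b, c]) = h ys"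
      by simp_all
  qed auto
  then show ?thesis by (simp add: sum.cartesian_product)
qed

lemma sum_sum_translate:
  fixes P :: "'a::exponent_two_group \<Rightarrow> real"
  assumes "add_subgroup G"
  shows "(\<Sum>x\<in>G. \<Sum>c\<in>G. P (x + c) * P x) = (\<Sum>x\<in>G. P x)\<^sup>2"
proof -
  have "(\<Sum>c\<in>G. P (x + c) * P x) = (\<Sum>c\<in>G. P c) * P x" if "x \<in> G" for x
    using sum_translate[OF assms that, of P] by (simp add: add.commute flip: sum_distrib_right)
  then show ?thesis by (simp add: power2_eq_square flip: sum_distrib_left)
qed

lemma iter_deriv_sign_fun:
  "iter_deriv (sign_fun f) [a, b, c] x = complex_of_real (
    (sg (f (x + c)) * sg (f (x + c + a)) * (sg (f (x + c + b)) * sg (f (x + c + b + a))))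
    * (sg (f x) * sg (f (x + a)) * (sg (f (x + b)) * sg (f (x + b + a)))))"
proof -
  have "sign_fun f = (\<lambda>x. complex_of_real (sg (f x)))"
    by (simp add: sign_fun_def sg_def fun_eq_iff)
  then show ?thesis by (simp add: iter_deriv_def mult_deriv_def mult_ac)
qed

text \<open>For fixed \<open>a\<close> and \<open>b\<close>, summing over the base point and the
  last direction \<open>c\<close> decouples the two copies of the second derivative, which leaves
  the square of \<open>deriv_corr\<close>.\<close>

lemma gowers_mean_sign_fun:
  "gowers_mean n 3 (sign_fun f) = complex_of_real
    ((\<Sum>y\<in>F2n n. \<Sum>h\<in>F2n n. (deriv_corr n (\<lambda>x. sg (f x)) y h)\<^sup>2) / real (card (F2n n)) ^ 4)"
proof -
  let ?V = "F2n n" and ?L = "{ys. set ys \<subseteq> F2n n \<and> length ys = 3}"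
  let ?P = "\<lambda>a b x. sg (f x) * sg (f (x + a)) * (sg (f (x + b)) * sg (f (x + b + a)))"
  have finL: "finite ?L" using finite_lists_length_eq[OF finite_F2n] by simp
  have "replicate 3 0 \<in> ?L" using F2.subspace_0[OF subspace_F2n] by auto
  then have ne: "?V \<times> ?L \<noteq> {}" using F2n_nonempty by blast
  have fin: "finite (?V \<times> ?L)" using finL finite_F2n by blast
  have "(\<Sum>(x, ys)\<in>?V \<times> ?L. iter_deriv (sign_fun f) ys x)
    = (\<Sum>x\<in>?V. \<Sum>a\<in>?V. \<Sum>b\<in>?V. \<Sum>c\<in>?V. iter_deriv (sign_fun f) [a, b, c] x)"
    by (simp add: sum_lists_length_3[OF finite_F2n] flip: sum.cartesian_product)
  also have "\<dots> = (\<Sum>a\<in>?V. \<Sum>x\<in>?V. \<Sum>b\<in>?V. \<Sum>c\<in>?V. iter_deriv (sign_fun f) [a, b, c] x)"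
    by (rule sum.swap)
  also have "\<dots> = (\<Sum>a\<in>?V. \<Sum>b\<in>?V. \<Sum>x\<in>?V. \<Sum>c\<in>?V. iter_deriv (sign_fun f) [a, b, c] x)"
    by (rule sum.cong[OF refl]) (rule sum.swap)
  also have "\<dots> = complex_of_real (\<Sum>a\<in>?V. \<Sum>b\<in>?V. \<Sum>x\<in>?V. \<Sum>c\<in>?V. ?P a b (x + c) * ?P a b x)"
    by (simp only: iter_deriv_sign_fun of_real_sum)
  also have "(\<Sum>a\<in>?V. \<Sum>b\<in>?V. \<Sum>x\<in>?V. \<Sum>c\<in>?V. ?P a b (x + c) * ?P a b x)
    = (\<Sum>a\<in>?V. \<Sum>b\<in>?V. (deriv_corr n (\<lambda>x. sg (f x)) a b)\<^sup>2)"
    unfolding deriv_corr_def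
    by (intro sum.cong refl) (rule sum_sum_translate[OF add_subgroup_F2n])
  finally have sum_eq: "(\<Sum>(x, ys)\<in>?V \<times> ?L. iter_deriv (sign_fun f) ys x)
    = complex_of_real (\<Sum>a\<in>?V. \<Sum>b\<in>?V. (deriv_corr n (\<lambda>x. sg (f x)) a b)\<^sup>2)" .
  have "gowers_mean n 3 (sign_fun f)
      = (\<Sum>a\<in>?V \<times> ?L. (1 / card (?V \<times> ?L)) *\<^sub>R (\<lambda>(x, ys). iter_deriv (sign_fun f) ys x) a)"
    unfolding gowers_mean_def
    by (subst integral_measure_pmf[OF fin]) (use fin ne in \<open>simp_all del: card_cartesian_product\<close>)
  also have "\<dots> = (1 / card (?V \<times> ?L)) *\<^sub>R (\<Sum>(x, ys)\<in>?V \<times> ?L. iter_deriv (sign_fun f) ys x)"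
    by (rule scaleR_sum_right[symmetric])
  also have "real (card (?V \<times> ?L)) = real (card ?V) ^ 4"
    by (simp add: card_cartesian_product card_lists_length_eq[OF finite_F2n] eval_nat_numeral)
  finally show ?thesis unfolding sum_eq by (simp add: scaleR_conv_of_real)
qed

lemma gowers_norm_sign_fun_power:
  "gowers_norm n 3 (sign_fun f) ^ 8 = (\<Sum>y\<in>F2n n. \<Sum>h\<in>F2n n. (deriv_corr n (\<lambda>x. sg (f x)) y h)\<^sup>2) / real (card (F2n n)) ^ 4"
  unfolding gowers_norm_def gowers_mean_sign_fun by (simp add: sum_nonneg)

lemma gowers_norm_sign_fun_nonneg: "0 \<le> gowers_norm n 3 (sign_fun f)"
  unfolding gowers_norm_def gowers_mean_sign_fun by (simp add: sum_nonneg)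

section \<open>Quadratic polynomials and their agreement with a function\<close>

lemma poly_of_degree_le_monomial:
  assumes "m \<in> exponents n d" "\<And>x. x \<in> F2n n \<Longrightarrow> p x = (\<Prod>i<n. x i ^ m i)"
  shows "poly_of_degree_le n d p"
  unfolding poly_of_degree_le_def
proof (intro exI[of _ "\<lambda>m'. if m' = m then 1 else 0"] ballI)
  fix x assume "x \<in> F2n n"
  then show "p x = (\<Sum>m'\<in>exponents n d. (if m' = m then 1 else 0) * (\<Prod>i<n. x i ^ m' i))"
    using assms by (simp add: if_distrib[of "\<lambda>c. c * _"] finite_exponents cong: if_cong)
qed

lemma poly_of_degree_le_add:
  assumes "poly_of_degree_le n d p" "poly_of_degree_le n d q"
  shows "poly_of_degree_le n d (\<lambda>x. p x + q x)"
proof -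
  obtain c c' where "\<forall>x\<in>F2n n. p x = (\<Sum>m\<in>exponents n d. c m * (\<Prod>i<n. x i ^ m i))"
    "\<forall>x\<in>F2n n. q x = (\<Sum>m\<in>exponents n d. c' m * (\<Prod>i<n. x i ^ m i))"
    using assms by (auto simp: poly_of_degree_le_def)
  then show ?thesis unfolding poly_of_degree_le_def
    by (intro exI[of _ "\<lambda>m. c m + c' m"]) (simp add: distrib_right sum.distrib)
qed

lemma poly_of_degree_le_mult_right:
  assumes "poly_of_degree_le n d p"
  shows "poly_of_degree_le n d (\<lambda>x. p x * a)"
proof -
  obtain c where "\<forall>x\<in>F2n n. p x = (\<Sum>m\<in>exponents n d. c m * (\<Prod>i<n. x i ^ m i))"
    using assms by (auto simp: poly_of_degree_le_def)
  then show ?thesis unfolding poly_of_degree_le_def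
    by (intro exI[of _ "\<lambda>m. c m * a"]) (simp add: sum_distrib_right mult.assoc mult.commute[of a])
qed

lemma poly_of_degree_le_const: "poly_of_degree_le n d (\<lambda>x. c)"
proof -
  have "poly_of_degree_le n d (\<lambda>x. 1)"
    by (rule poly_of_degree_le_monomial[of "\<lambda>i. 0"]) (simp_all add: exponents_def)
  from poly_of_degree_le_mult_right[OF this, of c] show ?thesis by simp
qed

lemma poly_of_degree_le_sum:
  assumes "finite I" "\<And>i. i \<in> I \<Longrightarrow> poly_of_degree_le n d (p i)"
  shows "poly_of_degree_le n d (\<lambda>x. \<Sum>i\<in>I. p i x)"
  using assms
proof (induction I rule: finite_induct)
  case empty
  then show ?case using poly_of_degree_le_const[of n d 0] by simp
next
  case (insert i I)
  then show ?case using poly_of_degree_le_add[of n d "p i" "\<lambda>x. \<Sum>i\<in>I. p i x"] by simp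
qed

lemma prod_power_indicator:
  fixes x :: "nat \<Rightarrow> bit"
  shows "i < n \<Longrightarrow> (\<Prod>k<n. x k ^ (if k = i then 1 else 0)) = x i"
  by (simp add: if_distrib[of "\<lambda>e. _ ^ e"] cong: if_cong)

lemma poly_of_degree_le_coord: "i < n \<Longrightarrow> poly_of_degree_le n 2 (\<lambda>x. x i)"
  by (rule poly_of_degree_le_monomial[of "\<lambda>k. if k = i then 1 else 0"])
    (auto simp: exponents_def prod_power_indicator)

lemma poly_of_degree_le_mult_coord:
  assumes "i < n" "j < n"
  shows "poly_of_degree_le n 2 (\<lambda>x. x i * x j)"
proof (rule poly_of_degree_le_monomial[of "\<lambda>k. (if k = i then 1 else 0) + (if k = j then 1 else 0)"])
  show "(\<lambda>k. (if k = i then 1 else 0) + (if k = j then 1 else 0)) \<in> exponents n 2"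
    unfolding exponents_def mem_Collect_eq sum.distrib using assms by simp
  show "x i * x j = (\<Prod>k<n. x k ^ ((if k = i then 1 else 0) + (if k = j then 1 else 0)))" for x :: "nat \<Rightarrow> bit"
    unfolding power_add prod.distrib using assms by (simp only: prod_power_indicator)
qed

lemma poly_of_degree_le_quadratic:
  "poly_of_degree_le n 2 (\<lambda>x. quad_form n B x + dot n b x + c)"
proof (intro poly_of_degree_le_add poly_of_degree_le_const)
  show "poly_of_degree_le n 2 (quad_form n B)"
    unfolding quad_form_def[abs_def]
    by (intro poly_of_degree_le_sum poly_of_degree_le_mult_right poly_of_degree_le_mult_coord) auto
  have "poly_of_degree_le n 2 (\<lambda>x. \<Sum>i<n. x i * b i)"
    by (intro poly_of_degree_le_sum poly_of_degree_le_mult_right poly_of_degree_le_coord) auto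
  then show "poly_of_degree_le n 2 (dot n b)"
    by (simp add: dot_def[abs_def] mult.commute)
qed

lemma prob_eq_sign_correlation:
  "measure_pmf.prob (pmf_of_set (F2n n)) {x. f x = p x}
    = 1 / 2 + (\<Sum>x\<in>F2n n. sg (f x) * sg (p x)) / (2 * real (card (F2n n)))"
proof -
  let ?V = "F2n n"
  have "(\<Sum>x\<in>?V. sg (f x) * sg (p x)) = (\<Sum>x\<in>?V. 2 * (if f x = p x then 1 else 0) - 1)"
    by (rule sum.cong) (auto simp: sg_def)
  also have "\<dots> = 2 * real (card (?V \<inter> {x. f x = p x})) - real (card ?V)"
    by (simp add: sum_subtractf sum.If_cases finite_F2n flip: sum_distrib_left)
  finally show ?thesis
    using card_F2n_pos[of n]
    by (simp add: measure_pmf_of_set[OF F2n_nonempty finite_F2n] field_simps)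
qed

section \<open>Freiman--Ruzsa implies the inverse theorem\<close>

definition inverse_u3_constant :: "real \<Rightarrow> bool"
  where "inverse_u3_constant C \<longleftrightarrow> (\<forall>n\<ge>(1::nat). \<forall>\<epsilon>::real. \<forall>f. 0 < \<epsilon> \<and> \<epsilon> \<le> 1 \<and> gowers_norm n 3 (sign_fun f) \<ge> \<epsilon> \<longrightarrow>
          (\<exists>p. poly_of_degree_le n 2 p \<and>
               measure_pmf.prob (pmf_of_set (F2n n)) {x. f x = p x} \<ge> 1 / 2 + inverse C * \<epsilon> powr C))"

theorem inverse_u3_of_pfr:
  assumes C: "pfr_constant C" "0 < C"
  obtains C' where "0 < C'" "inverse_u3_constant C'"
proof -
  obtain D where D: "C \<le> real D" using real_arch_simple by blast
  define M where "M = 3249 * D + 281"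
  \<comment> \<open>The target is \<open>t ^ (3 * M + 2)\<close> with
    \<open>t = \<epsilon> / 2\<close>: the power of 2 supplies the halving, and as \<open>C'\<close>
    exceeds \<open>3 * M + 2\<close>, the exponent of \<open>\<epsilon>\<close> may be lowered to
    that number.\<close>
  define C' where "C' = (2::real) ^ (3 * M + 2)"
  have "inverse_u3_constant C'"
    unfolding inverse_u3_constant_def
  proof (intro allI impI, elim conjE)
    fix n :: nat and \<epsilon> :: real and f
    assume n: "1 \<le> n" and \<epsilon>: "0 < \<epsilon>" "\<epsilon> \<le> 1" "\<epsilon> \<le> gowers_norm n 3 (sign_fun f)"
    let ?V = "F2n n"
    define N where "N = real (card ?V)"
    have N: "N > 0" using card_F2n_pos by (simp add: N_def)
    define F where "F x = sg (f x)" for x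
    have F1: "F x * F x = 1" for x by (simp add: F_def)
    define t where "t = \<epsilon> / 2"
    have t: "0 < t" "t \<le> 1 / 2" using \<epsilon> by (simp_all add: t_def)
    have "t ^ 8 \<le> gowers_norm n 3 (sign_fun f) ^ 8"
      by (rule power_mono) (use \<epsilon> in \<open>auto simp: t_def\<close>)
    then have U3: "t ^ 8 * N ^ 4 \<le> (\<Sum>y\<in>?V. \<Sum>h\<in>?V. (deriv_corr n F y h)\<^sup>2)"
      using N unfolding gowers_norm_sign_fun_power N_def[symmetric] F_def by (simp add: pos_le_divide_eq)
    obtain L u where L: "\<And>x. x \<in> ?V \<Longrightarrow> L x \<in> ?V" "u \<in> ?V"
      "\<And>x y. x \<in> ?V \<Longrightarrow> y \<in> ?V \<Longrightarrow> L (x + y) = L x + L y"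
      "t ^ M * N ^ 3 \<le> (\<Sum>y\<in>?V. deriv_spec n F (y, L y + u))"
    proof (rule additive_function_in_spectrum[OF F1 C D n t U3[unfolded N_def]], goal_cases)
      case (1 L u)
      show ?case by (rule 1(1)[OF 1(2-4) 1(5)[folded M_def N_def]])
    qed
    define \<eta> where "\<eta> = t ^ M"
    have \<eta>: "0 \<le> \<eta>" "\<eta> \<le> 1" using t by (auto simp: \<eta>_def intro: power_le_one)
    obtain B b where B: "b \<in> ?V" "\<eta> ^ 5 / 4 * N\<^sup>2 \<le> (\<Sum>x\<in>?V. F x * sg (quad_form n B x) * sg (dot n b x))\<^sup>2"
      unfolding N_def by (rule quadratic_correlation[OF F1 L(1,3,2) \<eta>(1) L(4)[folded \<eta>_def, unfolded N_def]])
    define s where "s = (\<Sum>x\<in>?V. F x * sg (quad_form n B x) * sg (dot n b x))"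
    \<comment> \<open>The exponent 5 is weakened to 6 so that a square root can be taken.\<close>
    have "(\<eta> ^ 3 / 2 * N)\<^sup>2 = \<eta> ^ 6 / 4 * N\<^sup>2" by (simp add: power_mult_distrib power_divide flip: power_mult)
    also have "\<dots> \<le> \<eta> ^ 5 / 4 * N\<^sup>2"
      using power_decreasing[of 5 6 \<eta>] \<eta> by (intro mult_right_mono divide_right_mono) auto
    also have "\<dots> \<le> s\<^sup>2" unfolding s_def by (rule B(2))
    finally have "\<bar>\<eta> ^ 3 / 2 * N\<bar> \<le> \<bar>s\<bar>" unfolding abs_le_square_iff .
    then have "\<eta> ^ 3 / 2 * N \<le> \<bar>s\<bar>" by linarith
    \<comment> \<open>The constant term of the polynomial makes the correlation positive.\<close>
    moreover define c :: bit where "c = (if s \<ge> 0 then 0 else 1)"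
    ultimately have "\<eta> ^ 3 / 2 * N \<le> s * sg c" by (auto simp: sg_def)
    define p where "p x = quad_form n B x + dot n b x + c" for x
    have "s * sg c = (\<Sum>x\<in>?V. F x * sg (quad_form n B x) * sg (dot n b x) * sg c)"
      unfolding s_def by (rule sum_distrib_right)
    also have "\<dots> = (\<Sum>x\<in>?V. sg (f x) * sg (p x))"
      by (rule sum.cong[OF refl]) (simp only: p_def F_def sg_add mult.assoc)
    finally have "s * sg c = (\<Sum>x\<in>?V. sg (f x) * sg (p x))" .
    then have "\<eta> ^ 3 / 2 * N / (2 * N) \<le> (\<Sum>x\<in>?V. sg (f x) * sg (p x)) / (2 * N)"
      using \<open>\<eta> ^ 3 / 2 * N \<le> s * sg c\<close> N by (intro divide_right_mono) auto
    then have corr: "1 / 2 + \<eta> ^ 3 / 4 \<le> measure_pmf.prob (pmf_of_set ?V) {x. f x = p x}"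
      unfolding prob_eq_sign_correlation N_def[symmetric] using N by simp
    have t2: "t\<^sup>2 \<le> 1 / 4"
      using power_mono[OF t(2), of 2] t by (simp add: power_divide)
    have "real (3 * M + 2) \<le> C'" unfolding C'_def by (rule less_imp_le, rule of_nat_less_two_power)
    then have "\<epsilon> powr C' \<le> \<epsilon> powr real (3 * M + 2)" by (rule powr_mono') (use \<epsilon> in auto)
    also have "\<dots> = \<epsilon> ^ (3 * M + 2)" by (rule powr_realpow[OF \<epsilon>(1)])
    finally have "inverse C' * \<epsilon> powr C' \<le> inverse C' * \<epsilon> ^ (3 * M + 2)"
      by (rule mult_left_mono) (simp add: C'_def)
    also have "\<dots> = t ^ (3 * M + 2)" unfolding C'_def t_def power_divide by (simp only: divide_inverse mult.commute)
    also have "\<dots> = \<eta> ^ 3 * t\<^sup>2" unfolding \<eta>_def power_mult[symmetric] power_add by (simp only: mult.commute[of M])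
    also have "\<eta> ^ 3 * t\<^sup>2 \<le> \<eta> ^ 3 * (1 / 4)"
      by (rule mult_left_mono) (use t2 \<eta> in auto)
    finally show "\<exists>p. poly_of_degree_le n 2 p \<and>
        1 / 2 + inverse C' * \<epsilon> powr C' \<le> measure_pmf.prob (pmf_of_set ?V) {x. f x = p x}"
    proof (intro exI[of _ p] conjI)
      show "poly_of_degree_le n 2 p" unfolding p_def[abs_def] by (rule poly_of_degree_le_quadratic)
    qed (use corr in linarith)
  qed
  then show ?thesis using that[of C'] by (simp add: C'_def)
qed

section \<open>The inverse theorem implies Freiman--Ruzsa\<close>

lemma monomial_degree_le_2:
  fixes m :: "nat \<Rightarrow> nat"
  shows "((\<Sum>i<n. m i) = 0 \<longrightarrow> (\<forall>x::nat \<Rightarrow> bit. (\<Prod>i<n. x i ^ m i) = 1))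
    \<and> ((\<Sum>i<n. m i) = 1 \<longrightarrow> (\<exists>i. \<forall>x::nat \<Rightarrow> bit. (\<Prod>i<n. x i ^ m i) = x i))
    \<and> ((\<Sum>i<n. m i) = 2 \<longrightarrow> (\<exists>i j. \<forall>x::nat \<Rightarrow> bit. (\<Prod>i<n. x i ^ m i) = x i * x j))"
proof (induction n)
  case (Suc n)
  define s where "s = (\<Sum>i<n. m i)"
  note IH = Suc.IH[folded s_def]
  have step: "(\<Sum>i<Suc n. m i) = s + m n" "(\<Prod>i<Suc n. x i ^ m i) = (\<Prod>i<n. x i ^ m i) * x n ^ m n" for x :: "nat \<Rightarrow> bit"
    by (simp_all add: s_def)
  show ?case
    unfolding step
  proof (intro conjI impI)
    assume "s + m n = 0"
    then show "\<forall>x::nat \<Rightarrow> bit. (\<Prod>i<n. x i ^ m i) * x n ^ m n = 1" using IH by simp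
  next
    assume "s + m n = 1"
    then consider "s = 0" "m n = 1" | "s = 1" "m n = 0" by linarith
    then show "\<exists>i. \<forall>x::nat \<Rightarrow> bit. (\<Prod>i<n. x i ^ m i) * x n ^ m n = x i"
    proof cases
      case 1
      then show ?thesis using IH by (intro exI[of _ n]) simp
    next
      case 2
      then show ?thesis using IH by simp
    qed
  next
    assume "s + m n = 2"
    then consider "s = 0" "m n = 2" | "s = 1" "m n = 1" | "s = 2" "m n = 0" by linarith
    then show "\<exists>i j. \<forall>x::nat \<Rightarrow> bit. (\<Prod>i<n. x i ^ m i) * x n ^ m n = x i * x j"
    proof cases
      case 1
      then show ?thesis using IH by (intro exI[of _ n]) (simp add: power2_eq_square)
    next
      case 2
      then obtain i where "\<forall>x::nat \<Rightarrow> bit. (\<Prod>i<n. x i ^ m i) = x i" using IH by auto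
      then show ?thesis using 2 by (intro exI[of _ i] exI[of _ n]) simp
    next
      case 3
      then show ?thesis using IH by simp
    qed
  qed
qed simp

lemma third_difference_mult:
  fixes a b c a' b' c' :: bit
  shows "(a + b + c) * (a' + b' + c') + (a + b) * (a' + b') + (a + c) * (a' + c') + (b + c) * (b' + c')
    + a * a' + b * b' + c * c' = 0"
  by (cases a; cases b; cases c; cases a'; cases b'; cases c'; simp)

lemma third_difference_poly:
  assumes p: "poly_of_degree_le n 2 p" and abc: "a \<in> F2n n" "b \<in> F2n n" "c \<in> F2n n"
  shows "p (a + b + c) + p (a + b) + p (a + c) + p (b + c) + p a + p b + p c + p 0 = 0"
proof -
  obtain d where d: "\<And>x. x \<in> F2n n \<Longrightarrow> p x = (\<Sum>m\<in>exponents n 2. d m * (\<Prod>i<n. x i ^ m i))"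
    using p by (auto simp: poly_of_degree_le_def)
  define \<phi> where "\<phi> m x = (\<Prod>i<n. x i ^ m i)" for m :: "nat \<Rightarrow> nat" and x :: "nat \<Rightarrow> bit"
  have \<phi>: "\<phi> m (a + b + c) + \<phi> m (a + b) + \<phi> m (a + c) + \<phi> m (b + c) + \<phi> m a + \<phi> m b + \<phi> m c + \<phi> m 0 = 0"
    if m: "m \<in> exponents n 2" for m
  proof -
    have "(\<Sum>i<n. m i) \<le> 2" using m by (simp add: exponents_def)
    then consider "(\<Sum>i<n. m i) = 0" | "(\<Sum>i<n. m i) = 1" | "(\<Sum>i<n. m i) = 2" by linarith
    then show ?thesis
    proof cases
      case 1
      then have "\<phi> m x = 1" for x using monomial_degree_le_2[of m n] by (simp add: \<phi>_def)
      then show ?thesis by (simp add: add.assoc)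
    next
      case 2
      then obtain i where "\<phi> m x = x i" for x using monomial_degree_le_2[of m n] by (auto simp: \<phi>_def)
      then show ?thesis by (simp add: ac_simps)
    next
      case 3
      then obtain i j where "\<phi> m x = x i * x j" for x using monomial_degree_le_2[of m n] by (auto simp: \<phi>_def)
      then show ?thesis using third_difference_mult[of "a i" "b i" "c i" "a j" "b j" "c j"] by simp
    qed
  qed
  have V: "a + b + c \<in> F2n n" "a + b \<in> F2n n" "a + c \<in> F2n n" "b + c \<in> F2n n" "0 \<in> F2n n"
    using abc add_subgroup_add[OF add_subgroup_F2n] add_subgroup_0[OF add_subgroup_F2n] by blast+
  have "p (a + b + c) + p (a + b) + p (a + c) + p (b + c) + p a + p b + p c + p 0
    = (\<Sum>m\<in>exponents n 2. d m * (\<phi> m (a + b + c) + \<phi> m (a + b) + \<phi> m (a + c) + \<phi> m (b + c) + \<phi> m a + \<phi> m b + \<phi> m c + \<phi> m 0))"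
    unfolding d[OF V(1)] d[OF V(2)] d[OF V(3)] d[OF V(4)] d[OF V(5)] d[OF abc(1)] d[OF abc(2)] d[OF abc(3)]
    by (simp only: sum.distrib[symmetric] distrib_left[symmetric] \<phi>_def)
  also have "\<dots> = 0" by (rule sum.neutral) (simp add: \<phi>)
  finally show ?thesis .
qed

text \<open>The mixed difference \<open>\<mu>\<close> is additive in each argument, because third
  differences in two directions of one coordinate and one of the other vanish; \<open>M\<close>
  represents it through the pairing.\<close>

lemma poly_interleave_decompose:
  assumes p: "poly_of_degree_le (2 * n) 2 p"
  obtains M where "\<And>x. M x \<in> F2n n"
    "\<And>x y. x \<in> F2n n \<Longrightarrow> y \<in> F2n n \<Longrightarrow> M (x + y) = M x + M y"
    "\<And>x z. x \<in> F2n n \<Longrightarrow> z \<in> F2n n \<Longrightarrow>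
      p (interleave (x, z)) = p (interleave (x, 0)) + (p (interleave (0, z)) + p 0) + dot n (M x) z"
proof -
  let ?V = "F2n n"
  have V0: "0 \<in> ?V" by (rule add_subgroup_0[OF add_subgroup_F2n])
  define \<mu> where "\<mu> x z = p (interleave (x, z)) + p (interleave (x, 0)) + p (interleave (0, z)) + p 0" for x z
  have third: "p (interleave (a + b + c)) + p (interleave (a + b)) + p (interleave (a + c)) + p (interleave (b + c))
      + p (interleave a) + p (interleave b) + p (interleave c) + p 0 = 0"
    if "a \<in> ?V \<times> ?V" "b \<in> ?V \<times> ?V" "c \<in> ?V \<times> ?V" for a b c
    unfolding interleave_add by (rule third_difference_poly[OF p]) (use that interleave_in_F2n in blast)+
  have add1: "\<mu> (x + y) z = \<mu> x z + \<mu> y z" if "x \<in> ?V" "y \<in> ?V" "z \<in> ?V" for x y z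
  proof -
    have "\<mu> (x + y) z + (\<mu> x z + \<mu> y z) = p (interleave (x + y, z)) + p (interleave (x + y, 0)) + p (interleave (x, z))
        + p (interleave (y, z)) + p (interleave (x, 0)) + p (interleave (y, 0)) + p (interleave (0, z)) + p 0"
      unfolding \<mu>_def by (simp add: ac_simps)
    also have "\<dots> = 0" using third[of "(x, 0)" "(y, 0)" "(0, z)"] that V0 by simp
    finally show ?thesis by (simp only: add_eq_0_iff_eq)
  qed
  have add2: "\<mu> z (x + y) = \<mu> z x + \<mu> z y" if "x \<in> ?V" "y \<in> ?V" "z \<in> ?V" for x y z
  proof -
    have "\<mu> z (x + y) + (\<mu> z x + \<mu> z y) = p (interleave (z, x + y)) + p (interleave (0, x + y)) + p (interleave (z, x))
        + p (interleave (z, y)) + p (interleave (0, x)) + p (interleave (0, y)) + p (interleave (z, 0)) + p 0"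
      unfolding \<mu>_def by (simp add: ac_simps)
    also have "\<dots> = 0" using third[of "(0, x)" "(0, y)" "(z, 0)"] that V0 by simp
    finally show ?thesis by (simp only: add_eq_0_iff_eq)
  qed
  define M where "M x = vec_of n (\<mu> x)" for x
  have dot_M: "dot n (M x) z = \<mu> x z" if "x \<in> ?V" "z \<in> ?V" for x z
    unfolding M_def by (rule dot_vec_of[OF add2 that(2)]) (use that in auto)
  have bits: "k = l + (m + s) + (k + l + m + s)" for k l m s :: bit
    by (simp add: ac_simps)
  show ?thesis
  proof (rule that[of M])
    show "M x \<in> ?V" for x by (simp add: M_def vec_of_in_F2n)
    show "M (x + y) = M x + M y" if "x \<in> ?V" "y \<in> ?V" for x y
      using that add1 unit_vec_in_F2n by (auto simp: M_def vec_of_def fun_eq_iff)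
    show "p (interleave (x, z)) = p (interleave (x, 0)) + (p (interleave (0, z)) + p 0) + dot n (M x) z"
      if "x \<in> ?V" "z \<in> ?V" for x z
      unfolding dot_M[OF that] \<mu>_def by (rule bits)
  qed
qed

section \<open>The U3 norm of the phase built from a Freiman homomorphism\<close>

lemma sum_F2n_double:
  "(\<Sum>z\<in>F2n (2 * n). \<phi> z) = (\<Sum>x\<in>F2n n. \<Sum>w\<in>F2n n. \<phi> (interleave (x, w)))"
proof -
  have "(\<Sum>z\<in>F2n (2 * n). \<phi> z) = (\<Sum>q\<in>F2n n \<times> F2n n. \<phi> (interleave q))"
    unfolding interleave_image[symmetric]
    by (rule sum.reindex_cong[OF inj_on_subset[OF inj_interleave]]) auto
  then show ?thesis by (simp add: sum.cartesian_product case_prod_unfold)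
qed

lemma card_F2n_double: "card (F2n (2 * n)) = card (F2n n) * card (F2n n)"
proof -
  have "card (F2n (2 * n)) = card (F2n n \<times> F2n n)"
    unfolding interleave_image[symmetric] by (intro card_image inj_on_subset[OF inj_interleave]) auto
  then show ?thesis by (simp add: card_cartesian_product)
qed

text \<open>Monotonicity of the Gowers norms from U1 to U3: Cauchy--Schwarz over \<open>y\<close>,
  and once more over the pairs \<open>(y, h)\<close>. For the indicator function of a set it gives a
  bound in terms of the density.\<close>

lemma sum_deriv_corr_power2_ge:
  fixes t :: "(nat \<Rightarrow> bit) \<Rightarrow> real"
  shows "(\<Sum>x\<in>F2n n. t x) ^ 8 \<le> real (card (F2n n)) ^ 4 * (\<Sum>y\<in>F2n n. \<Sum>h\<in>F2n n. (deriv_corr n t y h)\<^sup>2)"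
proof -
  let ?V = "F2n n"
  define N where "N = real (card ?V)"
  have N: "N \<ge> 0" by (simp add: N_def)
  have sq: "(\<Sum>x\<in>?V. \<Sum>y\<in>?V. q x * q (x + y)) = (\<Sum>x\<in>?V. q x)\<^sup>2" for q :: "_ \<Rightarrow> real"
    using sum_sum_translate[OF add_subgroup_F2n, of q n] by (simp add: mult.commute)
  have 1: "(\<Sum>y\<in>?V. \<Sum>x\<in>?V. t x * t (x + y)) = (\<Sum>x\<in>?V. t x)\<^sup>2"
    by (subst sum.swap) (rule sq)
  have 2: "(\<Sum>y\<in>?V. \<Sum>h\<in>?V. deriv_corr n t y h) = (\<Sum>y\<in>?V. (\<Sum>x\<in>?V. t x * t (x + y))\<^sup>2)"
  proof (rule sum.cong[OF refl])
    fix y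
    show "(\<Sum>h\<in>?V. deriv_corr n t y h) = (\<Sum>x\<in>?V. t x * t (x + y))\<^sup>2"
      unfolding deriv_corr_def by (subst sum.swap) (rule sq[of "\<lambda>x. t x * t (x + y)"])
  qed
  have "((\<Sum>x\<in>?V. t x)\<^sup>2)\<^sup>2 \<le> N * (\<Sum>y\<in>?V. \<Sum>h\<in>?V. deriv_corr n t y h)"
    unfolding 2 1[symmetric] N_def by (rule power2_sum_le[OF finite_F2n])
  then have "(((\<Sum>x\<in>?V. t x)\<^sup>2)\<^sup>2)\<^sup>2 \<le> (N * (\<Sum>y\<in>?V. \<Sum>h\<in>?V. deriv_corr n t y h))\<^sup>2"
    by (rule power_mono) simp
  also have "\<dots> \<le> N\<^sup>2 * (N\<^sup>2 * (\<Sum>y\<in>?V. \<Sum>h\<in>?V. (deriv_corr n t y h)\<^sup>2))"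
  proof -
    have "(\<Sum>q\<in>?V \<times> ?V. deriv_corr n t (fst q) (snd q))\<^sup>2
      \<le> real (card (?V \<times> ?V)) * (\<Sum>q\<in>?V \<times> ?V. (deriv_corr n t (fst q) (snd q))\<^sup>2)"
      by (rule power2_sum_le) (simp add: finite_F2n)
    then have "(\<Sum>y\<in>?V. \<Sum>h\<in>?V. deriv_corr n t y h)\<^sup>2 \<le> N\<^sup>2 * (\<Sum>y\<in>?V. \<Sum>h\<in>?V. (deriv_corr n t y h)\<^sup>2)"
      by (simp add: sum.cartesian_product case_prod_unfold card_cartesian_product N_def power2_eq_square)
    then show ?thesis unfolding power_mult_distrib by (rule mult_left_mono) simp
  qed
  finally show ?thesis by (simp add: N_def flip: power_mult power_add mult.assoc)
qed

lemma sum_swap_3: "(\<Sum>a\<in>A. \<Sum>b\<in>B. \<Sum>c\<in>C. f a b c) = (\<Sum>c\<in>C. \<Sum>a\<in>A. \<Sum>b\<in>B. f a b c)"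
proof -
  have "(\<Sum>a\<in>A. \<Sum>b\<in>B. \<Sum>c\<in>C. f a b c) = (\<Sum>a\<in>A. \<Sum>c\<in>C. \<Sum>b\<in>B. f a b c)"
    by (rule sum.cong[OF refl]) (rule sum.swap)
  also have "\<dots> = (\<Sum>c\<in>C. \<Sum>a\<in>A. \<Sum>b\<in>B. f a b c)"
    by (rule sum.swap)
  finally show ?thesis .
qed

text \<open>Parseval on the square of \<open>G\<close>: orthogonality in \<open>b\<close> and
  \<open>c\<close> keeps the pairs at which both \<open>U\<close> and \<open>W\<close>
  coincide.\<close>

lemma (in paired_group) sum_character_sums_power2:
  assumes UW: "\<And>x. x \<in> G \<Longrightarrow> U x \<in> G" "\<And>x. x \<in> G \<Longrightarrow> W x \<in> G"
  shows "(\<Sum>b\<in>G. \<Sum>c\<in>G. (\<Sum>x\<in>G. a x * (sg (e (U x) b) * sg (e (W x) c)))\<^sup>2)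
    = (real (card G))\<^sup>2 * (\<Sum>x\<in>G. \<Sum>x'\<in>G. a x * a x' * (if U x = U x' \<and> W x = W x' then 1 else 0))"
proof -
  define \<theta> where "\<theta> x x' b c = a x * a x' * (sg (e (U x + U x') b) * sg (e (W x + W x') c))" for x x' b c
  have "(\<Sum>b\<in>G. \<Sum>c\<in>G. (\<Sum>x\<in>G. a x * (sg (e (U x) b) * sg (e (W x) c)))\<^sup>2)
    = (\<Sum>b\<in>G. \<Sum>c\<in>G. \<Sum>x\<in>G. \<Sum>x'\<in>G. \<theta> x x' b c)"
  proof (rule sum.cong[OF refl], rule sum.cong[OF refl])
    fix b c
    define \<psi> where "\<psi> x = a x * (sg (e (U x) b) * sg (e (W x) c))" for x
    have "\<psi> x * \<psi> x' = \<theta> x x' b c" for x x'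
      unfolding \<psi>_def \<theta>_def e_add_left sg_add by (simp only: mult_ac)
    moreover have "(\<Sum>x\<in>G. \<psi> x)\<^sup>2 = (\<Sum>x\<in>G. \<Sum>x'\<in>G. \<psi> x * \<psi> x')"
      unfolding power2_eq_square by (rule sum_product)
    ultimately show "(\<Sum>x\<in>G. a x * (sg (e (U x) b) * sg (e (W x) c)))\<^sup>2 = (\<Sum>x\<in>G. \<Sum>x'\<in>G. \<theta> x x' b c)"
      unfolding \<psi>_def by simp
  qed
  also have "\<dots> = (\<Sum>x\<in>G. \<Sum>b\<in>G. \<Sum>c\<in>G. \<Sum>x'\<in>G. \<theta> x x' b c)"
    by (rule sum_swap_3[of "\<lambda>b c x. \<Sum>x'\<in>G. \<theta> x x' b c" G G G])
  also have "\<dots> = (\<Sum>x\<in>G. \<Sum>x'\<in>G. \<Sum>b\<in>G. \<Sum>c\<in>G. \<theta> x x' b c)"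
  proof (rule sum.cong[OF refl])
    fix x
    show "(\<Sum>b\<in>G. \<Sum>c\<in>G. \<Sum>x'\<in>G. \<theta> x x' b c) = (\<Sum>x'\<in>G. \<Sum>b\<in>G. \<Sum>c\<in>G. \<theta> x x' b c)"
      by (rule sum_swap_3[of "\<lambda>b c x'. \<theta> x x' b c" G G G])
  qed
  also have "\<dots> = (\<Sum>x\<in>G. \<Sum>x'\<in>G. (real (card G))\<^sup>2 * (a x * a x' * (if U x = U x' \<and> W x = W x' then 1 else 0)))"
  proof (rule sum.cong[OF refl], rule sum.cong[OF refl])
    fix x x' assume x: "x \<in> G" "x' \<in> G"
    have in_G: "U x + U x' \<in> G" "W x + W x' \<in> G"
      by (intro add_subgroup_add[OF subgroup_G] UW x)+
    have "(\<Sum>b\<in>G. \<Sum>c\<in>G. \<theta> x x' b c)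
        = a x * a x' * (\<Sum>b\<in>G. \<Sum>c\<in>G. sg (e (U x + U x') b) * sg (e (W x + W x') c))"
      unfolding \<theta>_def by (simp only: sum_distrib_left)
    also have "(\<Sum>b\<in>G. \<Sum>c\<in>G. sg (e (U x + U x') b) * sg (e (W x + W x') c))
        = (\<Sum>b\<in>G. sg (e (U x + U x') b)) * (\<Sum>c\<in>G. sg (e (W x + W x') c))"
      by (rule sum_product[symmetric])
    also have "\<dots> = (real (card G))\<^sup>2 * (if U x = U x' \<and> W x = W x' then 1 else 0)"
      unfolding sum_sg_e[OF in_G(1)] sum_sg_e[OF in_G(2)] add_eq_0_iff_eq
      by (cases "U x = U x'"; cases "W x = W x'") (simp_all only: power2_eq_square if_True if_False mult_zero_left mult_zero_right mult_1_right simp_thms)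
    finally show "(\<Sum>b\<in>G. \<Sum>c\<in>G. \<theta> x x' b c)
        = (real (card G))\<^sup>2 * (a x * a x' * (if U x = U x' \<and> W x = W x' then 1 else 0))"
      by (simp only: mult_ac)
  qed
  also have "\<dots> = (real (card G))\<^sup>2 * (\<Sum>x\<in>G. \<Sum>x'\<in>G. a x * a x' * (if U x = U x' \<and> W x = W x' then 1 else 0))"
    by (simp only: sum_distrib_left)
  finally show ?thesis .
qed

text \<open>The norm of the phase is compared with that of the indicator function \<open>t\<close>
  of \<open>T\<close>, one pair of directions \<open>y\<close>, \<open>h\<close> at a time. The
  second coordinates of the directions supply the orthogonality.\<close>

lemma gowers_norm_bilinear_phase_ge:
  assumes g: "\<And>x. x \<in> F2n n \<Longrightarrow> g x \<in> F2n n" and T: "T \<subseteq> F2n n"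
    and hom: "\<And>a b c d. a \<in> T \<Longrightarrow> b \<in> T \<Longrightarrow> c \<in> T \<Longrightarrow> d \<in> T \<Longrightarrow> a + b + (c + d) = 0 \<Longrightarrow> g a + g b + (g c + g d) = 0"
  shows "real (card T) / real (card (F2n n))
    \<le> gowers_norm (2 * n) 3 (sign_fun (\<lambda>z. dot n (g (fst (deinterleave z))) (snd (deinterleave z))))"
proof -
  interpret paired_group "F2n n" "dot n" by (rule paired_group_F2n)
  let ?V = "F2n n"
  define N where "N = real (card ?V)"
  have N: "N > 0" using card_G_pos by (simp add: N_def)
  define f where "f z = dot n (g (fst (deinterleave z))) (snd (deinterleave z))" for z
  define F where "F z = sg (f z)" for z
  have F: "F (interleave (x, w)) = sg (dot n (g x) w)" for x w by (simp add: F_def f_def)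
  have add: "x + y \<in> ?V" if "x \<in> ?V" "y \<in> ?V" for x y using that add_subgroup_add[OF subgroup_G] by blast
  define t :: "(nat \<Rightarrow> bit) \<Rightarrow> real" where "t x = (if x \<in> T then 1 else 0)" for x
  have block: "N ^ 4 * (deriv_corr n t y h)\<^sup>2
      \<le> (\<Sum>b\<in>?V. \<Sum>c\<in>?V. (deriv_corr (2 * n) F (interleave (y, b)) (interleave (h, c)))\<^sup>2)"
    if y: "y \<in> ?V" and h: "h \<in> ?V" for y h
  proof -
    \<comment> \<open>In directions \<open>(y, b)\<close> and \<open>(h, c)\<close>,
      \<open>A x\<close> is the frequency of the variable \<open>w\<close> and \<open>U x\<close>,
      \<open>W x\<close> are those of \<open>b\<close> and \<open>c\<close>. Summing over
      \<open>w\<close> keeps only those \<open>x\<close> with \<open>A x = 0\<close>.\<close>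
    define A where "A x = g x + g (x + y) + (g (x + h) + g (x + h + y))" for x
    define U where "U x = g (x + y) + g (x + h + y)" for x
    define W where "W x = g (x + h) + g (x + h + y)" for x
    define a :: "(nat \<Rightarrow> bit) \<Rightarrow> real" where "a x = (if A x = 0 then 1 else 0)" for x
    define \<tau> where "\<tau> x = t x * t (x + y) * (t (x + h) * t (x + h + y))" for x
    have in_V: "A x \<in> ?V" "U x \<in> ?V" "W x \<in> ?V" if "x \<in> ?V" for x
      unfolding A_def U_def W_def by (intro add g that y h)+
    have corr: "deriv_corr (2 * n) F (interleave (y, b)) (interleave (h, c))
        = N * (\<Sum>x\<in>?V. a x * (sg (dot n (U x) b) * sg (dot n (W x) c)))" for b c
    proof -
      have "deriv_corr (2 * n) F (interleave (y, b)) (interleave (h, c))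
        = (\<Sum>x\<in>?V. \<Sum>w\<in>?V. sg (dot n (g x) w) * sg (dot n (g (x + y)) (w + b))
            * (sg (dot n (g (x + h)) (w + c)) * sg (dot n (g (x + h + y)) (w + c + b))))"
        unfolding deriv_corr_def sum_F2n_double interleave_add[symmetric] by (simp add: F)
      also have "\<dots> = (\<Sum>x\<in>?V. \<Sum>w\<in>?V. sg (dot n (U x) b) * sg (dot n (W x) c) * sg (dot n (A x) w))"
        by (intro sum.cong refl) (simp only: A_def U_def W_def e_add_left e_add_right sg_add mult_ac)
      also have "\<dots> = (\<Sum>x\<in>?V. sg (dot n (U x) b) * sg (dot n (W x) c) * (\<Sum>w\<in>?V. sg (dot n (A x) w)))"
        by (simp only: sum_distrib_left)
      also have "\<dots> = (\<Sum>x\<in>?V. N * (a x * (sg (dot n (U x) b) * sg (dot n (W x) c))))"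
        by (intro sum.cong refl) (simp add: sum_sg_e[OF in_V(1)] a_def N_def)
      finally show ?thesis by (simp only: sum_distrib_left)
    qed
    have "(\<Sum>x\<in>?V. \<tau> x)\<^sup>2 = (\<Sum>x\<in>?V. \<Sum>x'\<in>?V. \<tau> x * \<tau> x')"
      by (simp add: power2_eq_square sum_product)
    also have "\<dots> \<le> (\<Sum>x\<in>?V. \<Sum>x'\<in>?V. a x * a x' * (if U x = U x' \<and> W x = W x' then 1 else 0))"
    proof (intro sum_mono)
      fix x x'
      show "\<tau> x * \<tau> x' \<le> a x * a x' * (if U x = U x' \<and> W x = W x' then 1 else 0)"
      \<comment> \<open>If both parallelograms lie in \<open>T\<close>, each sum in question adds
        four values of \<open>g\<close> at points of \<open>T\<close> that sum to zero, so
        \<open>hom\<close> applies to all four conditions.\<close>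
      proof (cases "x \<in> T \<and> x + y \<in> T \<and> x + h \<in> T \<and> x + h + y \<in> T \<and> x' \<in> T \<and> x' + y \<in> T \<and> x' + h \<in> T \<and> x' + h + y \<in> T")
        case True
        have "A x = 0" "A x' = 0"
          unfolding A_def by (rule hom; use True in \<open>simp add: ac_simps\<close>)+
        moreover have "U x + U x' = 0" "W x + W x' = 0"
          unfolding U_def W_def by (rule hom; use True in \<open>simp add: ac_simps\<close>)+
        ultimately show ?thesis by (simp add: a_def \<tau>_def t_def add_eq_0_iff_eq)
      next
        case False
        then have eq: "\<tau> x * \<tau> x' = 0" by (auto simp: \<tau>_def t_def)
        show ?thesis unfolding eq by (simp add: a_def)
      qed
    qed
    finally have "N ^ 4 * (\<Sum>x\<in>?V. \<tau> x)\<^sup>2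
        \<le> N ^ 4 * (\<Sum>x\<in>?V. \<Sum>x'\<in>?V. a x * a x' * (if U x = U x' \<and> W x = W x' then 1 else 0))"
      by (rule mult_left_mono) simp
    also have "\<dots> = N\<^sup>2 * (\<Sum>b\<in>?V. \<Sum>c\<in>?V. (\<Sum>x\<in>?V. a x * (sg (dot n (U x) b) * sg (dot n (W x) c)))\<^sup>2)"
    proof -
      have "(\<Sum>b\<in>?V. \<Sum>c\<in>?V. (\<Sum>x\<in>?V. a x * (sg (dot n (U x) b) * sg (dot n (W x) c)))\<^sup>2)
        = N\<^sup>2 * (\<Sum>x\<in>?V. \<Sum>x'\<in>?V. a x * a x' * (if U x = U x' \<and> W x = W x' then 1 else 0))"
        unfolding N_def by (rule sum_character_sums_power2) (rule in_V, assumption)+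
      moreover have "N ^ 4 * r = N\<^sup>2 * (N\<^sup>2 * r)" for r by (simp flip: mult.assoc power_add)
      ultimately show ?thesis by simp
    qed
    finally show ?thesis
      unfolding corr power_mult_distrib sum_distrib_left[symmetric] by (simp add: deriv_corr_def \<tau>_def)
  qed
  have "real (card T) ^ 8 = (\<Sum>x\<in>?V. t x) ^ 8"
    using T finite_F2n by (simp add: t_def sum.If_cases Int_absorb1)
  also have "\<dots> \<le> N ^ 4 * (\<Sum>y\<in>?V. \<Sum>h\<in>?V. (deriv_corr n t y h)\<^sup>2)"
    unfolding N_def by (rule sum_deriv_corr_power2_ge)
  also have "\<dots> \<le> (\<Sum>y\<in>?V. \<Sum>h\<in>?V. \<Sum>b\<in>?V. \<Sum>c\<in>?V. (deriv_corr (2 * n) F (interleave (y, b)) (interleave (h, c)))\<^sup>2)"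
    unfolding sum_distrib_left by (intro sum_mono block)
  also have "\<dots> = (\<Sum>y\<in>?V. \<Sum>b\<in>?V. \<Sum>h\<in>?V. \<Sum>c\<in>?V. (deriv_corr (2 * n) F (interleave (y, b)) (interleave (h, c)))\<^sup>2)"
    by (rule sum.cong[OF refl]) (rule sum.swap)
  also have "\<dots> = (\<Sum>q\<in>F2n (2 * n). \<Sum>r\<in>F2n (2 * n). (deriv_corr (2 * n) F q r)\<^sup>2)"
    by (simp only: sum_F2n_double)
  finally have "(real (card T) / N) ^ 8 \<le> (\<Sum>q\<in>F2n (2 * n). \<Sum>r\<in>F2n (2 * n). (deriv_corr (2 * n) F q r)\<^sup>2) / N ^ 8"
    unfolding power_divide by (rule divide_right_mono) (use N in simp)
  also have "\<dots> = gowers_norm (2 * n) 3 (sign_fun f) ^ 8"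
    unfolding gowers_norm_sign_fun_power F_def card_F2n_double N_def
    by (simp flip: power2_eq_square power_mult)
  finally have "real (card T) / N \<le> gowers_norm (2 * n) 3 (sign_fun f)"
    using N gowers_norm_sign_fun_nonneg by (subst (asm) power_mono_iff) auto
  then show ?thesis by (simp add: N_def f_def[abs_def])
qed

text \<open>Once the bilinear part of \<open>p\<close> is moved to \<open>g\<close>, the sum over
  \<open>z\<close> is a Fourier coefficient at \<open>g x + M x\<close> of a function
  \<open>\<psi>\<close> of \<open>z\<close> alone. After Cauchy--Schwarz over \<open>x\<close>,
  Parseval for \<open>\<psi>\<close> shows that some frequency \<open>v\<close> is taken
  often.\<close>

lemma affine_agreement:
  assumes p: "poly_of_degree_le (2 * n) 2 p" and c: "c > 0"
    and g: "\<And>x. x \<in> F2n n \<Longrightarrow> g x \<in> F2n n"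
    and corr: "c * (real (card (F2n n)))\<^sup>2 \<le> (\<Sum>x\<in>F2n n. \<Sum>z\<in>F2n n. sg (dot n (g x) z) * sg (p (interleave (x, z))))"
  obtains M v where "\<And>x. M x \<in> F2n n"
    "\<And>x y. x \<in> F2n n \<Longrightarrow> y \<in> F2n n \<Longrightarrow> M (x + y) = M x + M y"
    "c\<^sup>2 * real (card (F2n n)) \<le> real (card {x \<in> F2n n. g x + M x = v})"
proof -
  interpret paired_group "F2n n" "dot n" by (rule paired_group_F2n)
  let ?V = "F2n n"
  define N where "N = real (card ?V)"
  have N: "N > 0" using card_G_pos by (simp add: N_def)
  obtain M where M: "\<And>x. M x \<in> ?V" "\<And>x y. x \<in> ?V \<Longrightarrow> y \<in> ?V \<Longrightarrow> M (x + y) = M x + M y"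
    "\<And>x z. x \<in> ?V \<Longrightarrow> z \<in> ?V \<Longrightarrow>
      p (interleave (x, z)) = p (interleave (x, 0)) + (p (interleave (0, z)) + p 0) + dot n (M x) z"
  proof (rule poly_interleave_decompose[OF p], goal_cases)
    case (1 M)
    show ?case by (rule 1(1)[OF 1(2-4)])
  qed
  define \<psi> where "\<psi> z = sg (p (interleave (0, z)) + p 0)" for z
  define w where "w x = g x + M x" for x
  define m where "m v = real (card {x \<in> ?V. w x = v})" for v
  have wV: "w x \<in> ?V" if "x \<in> ?V" for x
    using that g M(1) add_subgroup_add[OF subgroup_G] by (simp add: w_def)
  have "c * N\<^sup>2 \<le> (\<Sum>x\<in>?V. \<Sum>z\<in>?V. sg (dot n (g x) z) * sg (p (interleave (x, z))))"
    using corr by (simp add: N_def)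
  also have "\<dots> = (\<Sum>x\<in>?V. \<Sum>z\<in>?V. sg (p (interleave (x, 0))) * (\<psi> z * sg (dot n (w x) z)))"
    by (intro sum.cong refl) (simp only: M(3) \<psi>_def w_def e_add_left sg_add mult_ac)
  also have "\<dots> = (\<Sum>x\<in>?V. sg (p (interleave (x, 0))) * fourier ?V (dot n) \<psi> (w x))"
    by (simp only: fourier_def sum_distrib_left)
  finally have "(c * N\<^sup>2)\<^sup>2 \<le> (\<Sum>x\<in>?V. sg (p (interleave (x, 0))) * fourier ?V (dot n) \<psi> (w x))\<^sup>2"
    by (rule power_mono) (use c N in simp)
  also have "\<dots> \<le> N * (\<Sum>x\<in>?V. (sg (p (interleave (x, 0))) * fourier ?V (dot n) \<psi> (w x))\<^sup>2)"
    unfolding N_def by (rule power2_sum_le[OF finite_G])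
  also have "(\<Sum>x\<in>?V. (sg (p (interleave (x, 0))) * fourier ?V (dot n) \<psi> (w x))\<^sup>2)
      = (\<Sum>x\<in>?V. (fourier ?V (dot n) \<psi> (w x))\<^sup>2)"
    by (simp add: power_mult_distrib)
  also have "\<dots> = (\<Sum>v\<in>?V. \<Sum>x\<in>{x \<in> ?V. w x = v}. (fourier ?V (dot n) \<psi> (w x))\<^sup>2)"
    by (rule sum.group[symmetric]) (use finite_G wV in auto)
  also have "\<dots> = (\<Sum>v\<in>?V. (fourier ?V (dot n) \<psi> v)\<^sup>2 * m v)"
    by (rule sum.cong[OF refl]) (simp add: m_def)
  finally have "(c * N\<^sup>2)\<^sup>2 \<le> N * (\<Sum>v\<in>?V. (fourier ?V (dot n) \<psi> v)\<^sup>2 * m v)" .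
  moreover have "(c * N\<^sup>2)\<^sup>2 = N * (c\<^sup>2 * N * (N * N))" by (simp add: power_mult_distrib power2_eq_square mult_ac)
  moreover have pars: "(\<Sum>v\<in>?V. (fourier ?V (dot n) \<psi> v)\<^sup>2) = N * N"
    by (simp add: parseval \<psi>_def N_def)
  ultimately have "c\<^sup>2 * N * (\<Sum>v\<in>?V. (fourier ?V (dot n) \<psi> v)\<^sup>2) \<le> (\<Sum>v\<in>?V. (fourier ?V (dot n) \<psi> v)\<^sup>2 * m v)"
    using N by (simp only: mult_le_cancel_left_pos)
  then have "\<exists>v\<in>?V. c\<^sup>2 * N \<le> m v"
    by (rule exists_ge_weighted_average[OF finite_G, rotated 2]) (use N in \<open>simp_all add: pars\<close>)
  then obtain v where "c\<^sup>2 * N \<le> m v" by blast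
  then show ?thesis
    using that[of M v, OF M(1,2)] by (simp add: N_def m_def w_def)
qed

text \<open>Every \<open>s\<close> in \<open>S\<close> is carried into \<open>P\<close> by exactly
  \<open>card P\<close> translations, all of them in \<open>S + P\<close>; take the best
  one.\<close>

lemma popular_translate:
  fixes S P :: "'a::exponent_two_group set"
  assumes S: "finite S" "S \<noteq> {}" and P: "finite P" "P \<noteq> {}"
  obtains t where "card S * card P \<le> card (S + P) * card {s \<in> S. s + t \<in> P}"
proof -
  have fin: "finite (S + P)" using S P by (intro finite_set_plus)
  have "S + P \<noteq> {}" using S P by (auto simp: set_plus_def)
  have fib: "card {t \<in> S + P. s + t \<in> P} = card P" if "s \<in> S" for s
  proof -
    have "{t \<in> S + P. s + t \<in> P} = (+) s ` P"
    proof
      show "{t \<in> S + P. s + t \<in> P} \<subseteq> (+) s ` P"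
        by (auto intro: image_eqI[where x="s + _"])
      show "(+) s ` P \<subseteq> {t \<in> S + P. s + t \<in> P}"
        using that by auto
    qed
    then show ?thesis by (simp add: card_translate)
  qed
  have "(\<Sum>t\<in>S + P. card {s \<in> S. s + t \<in> P}) = (\<Sum>s\<in>S. card {t \<in> S + P. s + t \<in> P})"
    by (rule sum_card_swap[OF fin S(1)])
  also have "\<dots> = card S * card P" by (simp add: fib)
  finally have eq: "(\<Sum>t\<in>S + P. card {s \<in> S. s + t \<in> P}) = card S * card P" .
  have "\<exists>t\<in>S + P. card S * card P \<le> card (S + P) * card {s \<in> S. s + t \<in> P}"
  proof (rule ccontr)
    assume "\<not> ?thesis"
    then have "(\<Sum>t\<in>S + P. card (S + P) * card {s \<in> S. s + t \<in> P}) < (\<Sum>t\<in>S + P. card S * card P)"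
      by (intro sum_strict_mono fin \<open>S + P \<noteq> {}\<close>) auto
    then show False by (simp add: eq flip: sum_distrib_left)
  qed
  then show ?thesis using that by blast
qed

text \<open>The subgroup together with its coset is again a subgroup.\<close>

lemma card_span_coset_le:
  assumes W: "finite W" "add_subgroup W" and S: "S \<subseteq> (+) d ` W"
  shows "card (F2.span S) \<le> 2 * card W"
proof -
  have closed: "x + y \<in> W" if "x \<in> W" "y \<in> W" for x y using add_subgroup_add[OF W(2)] that .
  have "add_subgroup (W \<union> (+) d ` W)"
    unfolding add_subgroup_def
  proof (intro conjI ballI)
    show "0 \<in> W \<union> (+) d ` W" using add_subgroup_0[OF W(2)] by simp
    fix x y assume "x \<in> W \<union> (+) d ` W" "y \<in> W \<union> (+) d ` W"
    then obtain a b where ab: "a \<in> W" "b \<in> W" "x = a \<or> x = d + a" "y = b \<or> y = d + b" by auto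
    have "(d + a) + (d + b) = a + b" "a + (d + b) = d + (a + b)" "(d + a) + b = d + (a + b)"
      by (simp_all add: ac_simps)
    then have "x + y = a + b \<or> x + y = d + (a + b)" using ab by metis
    then show "x + y \<in> W \<union> (+) d ` W" using closed[OF ab(1,2)] by auto
  qed
  then have "F2.span S \<subseteq> W \<union> (+) d ` W"
    using S by (intro F2.span_minimal) (auto simp: subspace_iff_add_subgroup)
  then have "card (F2.span S) \<le> card (W \<union> (+) d ` W)" by (rule card_mono[rotated]) (use W in simp)
  also have "\<dots> \<le> card W + card ((+) d ` W)" by (rule card_Un_le)
  finally show ?thesis by (simp add: card_translate)
qed

section \<open>The Freiman model and its values on an affine slice\<close>

lemma set_plus_subset_subgroup:
  assumes "add_subgroup V" "A \<subseteq> V" "B \<subseteq> V"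
  shows "A + B \<subseteq> V"
proof
  fix x assume "x \<in> A + B"
  then obtain a b where "a \<in> A" "b \<in> B" "x = a + b" by (auto simp: set_plus_def)
  then show "x \<in> V" using add_subgroup_add[OF assms(1)] assms(2,3) by blast
qed

lemma iter_sumset_subset_subgroup:
  assumes V: "add_subgroup V" and S: "S \<subseteq> V"
  shows "iter_sumset k S \<subseteq> V"
proof (induction k)
  case 0
  then show ?case using add_subgroup_0[OF V] by simp
next
  case (Suc k)
  then show ?case using set_plus_subset_subgroup[OF V S] by simp
qed

lemma add_four_in_iter_sumset:
  assumes "a \<in> S" "b \<in> S" "c \<in> S" "d \<in> S"
  shows "a + b + (c + d) \<in> iter_sumset 4 S"
proof -
  have "a + (b + (c + (d + 0))) \<in> S + (S + (S + (S + {0})))"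
    using assms by (intro set_plus_intro) auto
  then show ?thesis by (simp add: numeral_eq_Suc add.assoc)
qed

text \<open>
  A maximal subgroup \<open>H\<close> avoiding \<open>4S\<close> makes \<open>S\<close> a set of coset representatives on the dense set
  \<open>S + H\<close>, and \<open>g\<close> picks the representative: a Freiman model of \<open>S\<close>.
\<close>

lemma freiman_model:
  assumes S: "S \<subseteq> F2n n" "S \<noteq> {}"
  obtains H g T where "add_subgroup H" "H \<subseteq> F2n n" "T \<subseteq> F2n n"
    "card T = card S * card H" "card (F2n n) \<le> card (iter_sumset 4 S) * card H"
    "\<And>x. x \<in> F2n n \<Longrightarrow> g x \<in> S \<union> iter_sumset 4 S" "\<And>x. x \<in> F2n n \<Longrightarrow> x + g x \<in> H"
    "\<And>a b c d. a \<in> T \<Longrightarrow> b \<in> T \<Longrightarrow> c \<in> T \<Longrightarrow> d \<in> T \<Longrightarrow> a + b + (c + d) = 0 \<Longrightarrow> g a + g b + (g c + g d) = 0"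
proof -
  let ?V = "F2n n" and ?S4 = "iter_sumset 4 S"
  obtain s0 where s0: "s0 \<in> S" using S by blast
  have zero: "0 \<in> ?S4" using add_four_in_iter_sumset[OF s0 s0 s0 s0] by simp
  have finS: "finite S" using S finite_F2n finite_subset by blast
  have finS4: "finite ?S4" by (rule finite_iter_sumset[OF finS])
  have sub0: "add_subgroup {0 :: nat \<Rightarrow> bit}" by (simp add: add_subgroup_def)
  have "{0} \<subseteq> ?V" using add_subgroup_0[OF add_subgroup_F2n] by blast
  then obtain H where H: "add_subgroup H" "H \<subseteq> ?V" "H \<inter> ?S4 \<subseteq> {0}"
    "\<And>v. v \<in> ?V \<Longrightarrow> \<exists>p\<in>insert 0 ?S4. v + p \<in> H"
    using subgroup_avoiding[OF finite_F2n add_subgroup_F2n sub0, of n ?S4] by (metis Int_lower1)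
  have finH: "finite H" using H finite_F2n finite_subset by blast
  define T where "T = S + H"
  \<comment> \<open>On \<open>T\<close> the representative is taken from \<open>S\<close>. Elsewhere
    one from \<open>4S\<close> keeps \<open>x + g x\<close> in \<open>H\<close> and the values in a
    set of controlled doubling.\<close>
  define g where "g x = (if \<exists>s\<in>S. x + s \<in> H then SOME s. s \<in> S \<and> x + s \<in> H else SOME p. p \<in> ?S4 \<and> x + p \<in> H)" for x
  have ex: "\<exists>p. p \<in> ?S4 \<and> x + p \<in> H" if "x \<in> ?V" for x
    using H(4)[OF that] zero by auto
  have gS: "g x \<in> S \<and> x + g x \<in> H" if "\<exists>s\<in>S. x + s \<in> H" for x
  proof -
    have "g x = (SOME s. s \<in> S \<and> x + s \<in> H)" using that by (simp add: g_def)
    moreover have "\<exists>s. s \<in> S \<and> x + s \<in> H" using that by blast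
    ultimately show ?thesis using someI_ex[of "\<lambda>s. s \<in> S \<and> x + s \<in> H"] by metis
  qed
  have gV: "g x \<in> S \<union> ?S4 \<and> x + g x \<in> H" if "x \<in> ?V" for x
  proof (cases "\<exists>s\<in>S. x + s \<in> H")
    case False
    then have "g x = (SOME p. p \<in> ?S4 \<and> x + p \<in> H)" by (simp only: g_def if_False)
    then show ?thesis using someI_ex[OF ex[OF that]] by simp
  qed (use gS in blast)
  have gT: "g x \<in> S \<and> x + g x \<in> H" if x: "x \<in> T" for x
  proof (rule gS)
    obtain s h where "s \<in> S" "h \<in> H" "x = s + h" using x by (auto simp: T_def elim: set_plus_elim)
    then have "x + s = h" by (metis add.commute add_self_left)
    then show "\<exists>s\<in>S. x + s \<in> H" using \<open>s \<in> S\<close> \<open>h \<in> H\<close> by blast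
  qed
  have inj: "s = s'" if "s \<in> S" "s' \<in> S" "s + s' \<in> H" for s s'
  proof -
    have "s + s' \<in> ?S4" using add_four_in_iter_sumset[OF that(1,2) s0 s0] by simp
    then have "s + s' = 0" using H(3) that(3) by blast
    then show ?thesis by (simp only: add_eq_0_iff_eq)
  qed
  show ?thesis
  proof (rule that[OF H(1,2)])
    show "T \<subseteq> ?V"
      unfolding T_def by (rule set_plus_subset_subgroup[OF add_subgroup_F2n S(1) H(2)])
    show "card T = card S * card H"
      unfolding T_def by (rule card_direct_sum[OF inj H(1)])
    have "?V \<subseteq> ?S4 + H"
    proof
      fix v assume "v \<in> ?V"
      then obtain p where p: "p \<in> ?S4" "v + p \<in> H" using ex by blast
      then have "p + (v + p) \<in> ?S4 + H" by (rule set_plus_intro)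
      moreover have "p + (v + p) = v" by (simp add: ac_simps)
      ultimately show "v \<in> ?S4 + H" by simp
    qed
    then have "card ?V \<le> card (?S4 + H)" by (rule card_mono[rotated]) (intro finite_set_plus finS4 finH)
    also have "\<dots> \<le> card ?S4 * card H" by (rule card_set_plus_le[OF finS4 finH])
    finally show "card ?V \<le> card ?S4 * card H" .
    show "g x \<in> S \<union> ?S4" "x + g x \<in> H" if "x \<in> ?V" for x using gV[OF that] by blast+
    fix a b c d assume T: "a \<in> T" "b \<in> T" "c \<in> T" "d \<in> T" and 0: "a + b + (c + d) = 0"
    note g = gT[OF T(1)] gT[OF T(2)] gT[OF T(3)] gT[OF T(4)]
    \<comment> \<open>As the arguments sum to zero, the sum of the four values lies in
      \<open>H\<close>; it also lies in \<open>4S\<close>, which meets \<open>H\<close> only in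
      zero.\<close>
    have "((a + g a) + (b + g b)) + ((c + g c) + (d + g d)) \<in> H"
      by (rule add_subgroup_add[OF H(1) add_subgroup_add[OF H(1) g(1,2)[THEN conjunct2]]
            add_subgroup_add[OF H(1) g(3,4)[THEN conjunct2]]])
    moreover have "((a + g a) + (b + g b)) + ((c + g c) + (d + g d)) = (a + b + (c + d)) + (g a + g b + (g c + g d))"
      by (simp only: ac_simps)
    ultimately have "g a + g b + (g c + g d) \<in> H" unfolding 0 by simp
    moreover have "g a + g b + (g c + g d) \<in> ?S4" using g by (intro add_four_in_iter_sumset) auto
    ultimately show "g a + g b + (g c + g d) = 0" using H(3) by blast
  qed
qed

text \<open>
  If \<open>g\<close> agrees with an affine map on \<open>X\<close>, then a translate of a complement of \<open>H\<close> contains many points of \<open>X\<close>,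
  on which \<open>g\<close> is injective with values in a coset of a small subgroup.
\<close>

lemma affine_values:
  assumes H: "add_subgroup H" "H \<subseteq> F2n n" and gH: "\<And>x. x \<in> F2n n \<Longrightarrow> x + g x \<in> H"
    and M: "\<And>x y. x \<in> F2n n \<Longrightarrow> y \<in> F2n n \<Longrightarrow> M (x + y) = M x + M y"
  obtains P W d where "P \<subseteq> g ` F2n n" "P \<subseteq> (+) d ` W" "add_subgroup W" "finite W"
    "card W * card H \<le> card (F2n n)" "card {x \<in> F2n n. g x + M x = v} \<le> card P * card H"
proof -
  let ?V = "F2n n"
  define X where "X = {x \<in> F2n n. g x + M x = v}"
  have finH: "finite H" using H finite_F2n finite_subset by blast
  have sub0: "add_subgroup {0 :: nat \<Rightarrow> bit}" by (simp add: add_subgroup_def)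
  have "{0} \<subseteq> ?V" using add_subgroup_0[OF add_subgroup_F2n] by blast
  \<comment> \<open>Avoiding the subgroup \<open>H\<close> makes \<open>Q\<close> a complement of
    it.\<close>
  then obtain Q where Q: "add_subgroup Q" "Q \<subseteq> ?V" "Q \<inter> H \<subseteq> {0}"
    "\<And>v. v \<in> ?V \<Longrightarrow> \<exists>p\<in>insert 0 H. v + p \<in> Q"
    using subgroup_avoiding[OF finite_F2n add_subgroup_F2n sub0, of n H] by (metis Int_lower1)
  have finQ: "finite Q" using Q finite_F2n finite_subset by blast
  have Q_inj: "x = y" if "x \<in> Q" "y \<in> Q" "x + y \<in> H" for x y
  proof -
    have "x + y \<in> Q" by (rule add_subgroup_add[OF Q(1) that(1,2)])
    then have "x + y = 0" using Q(3) that(3) by blast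
    then show ?thesis by (simp only: add_eq_0_iff_eq)
  qed
  have "Q + H \<subseteq> ?V" by (rule set_plus_subset_subgroup[OF add_subgroup_F2n Q(2) H(2)])
  then have QH: "card Q * card H \<le> card ?V"
    using card_mono[OF finite_F2n] card_direct_sum[OF Q_inj H(1)] by metis
  have finX: "finite X" by (simp add: X_def finite_F2n)
  define Y where "Y h = {x \<in> X. x + h \<in> Q}" for h
  have finY: "finite (Y h)" for h using finX by (simp add: Y_def)
  have "X \<subseteq> (\<Union>h\<in>H. Y h)"
  proof
    fix x assume x: "x \<in> X"
    then have "x \<in> ?V" by (simp add: X_def)
    then obtain h where "h \<in> H" "x + h \<in> Q" using Q(4) add_subgroup_0[OF H(1)] by blast
    then show "x \<in> (\<Union>h\<in>H. Y h)" using x by (auto simp: Y_def)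
  qed
  then have "card X \<le> card (\<Union>h\<in>H. Y h)" by (rule card_mono[rotated]) (use finH finY in auto)
  also have "\<dots> \<le> (\<Sum>h\<in>H. card (Y h))" by (rule card_UN_le[OF finH])
  finally have XY: "card X \<le> (\<Sum>h\<in>H. card (Y h))" .
  have "\<exists>h\<in>H. card X \<le> card (Y h) * card H"
  proof (rule ccontr)
    assume "\<not> ?thesis"
    then have "(\<Sum>h\<in>H. card (Y h) * card H) < (\<Sum>h\<in>H. card X)"
      using finH add_subgroup_0[OF H(1)] by (intro sum_strict_mono) auto
    then have "(\<Sum>h\<in>H. card (Y h)) * card H < card X * card H"
      by (simp only: sum_distrib_right sum_constant of_nat_id mult.commute[of "card X"])
    then have "(\<Sum>h\<in>H. card (Y h)) < card X" by (rule mult_less_cancel2[THEN iffD1, THEN conjunct2])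
    then show False using XY by simp
  qed
  then obtain h where h: "h \<in> H" "card X \<le> card (Y h) * card H" by blast
  have hV: "h \<in> ?V" using h H by blast
  have YV: "Y h \<subseteq> ?V" by (auto simp: Y_def X_def)
  \<comment> \<open>Modulo \<open>H\<close>, \<open>g x\<close> is congruent to \<open>x\<close>,
    and a translate of \<open>Q\<close> contains one point of each class.\<close>
  have "inj_on g (Y h)"
  proof (rule inj_onI)
    fix x y assume xy: "x \<in> Y h" "y \<in> Y h" "g x = g y"
    have "(x + g x) + (y + g y) \<in> H" by (rule add_subgroup_add[OF H(1) gH gH]) (use YV xy in auto)
    moreover have "(x + g x) + (y + g y) = (x + h) + (y + h)" using xy(3) by (simp add: ac_simps)
    ultimately have "(x + h) + (y + h) \<in> H" by (simp only:)
    then have "x + h = y + h" by (rule Q_inj[rotated 2]) (use xy in \<open>simp_all add: Y_def\<close>)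
    then show "x = y" by simp
  qed
  then have card_P: "card (g ` Y h) = card (Y h)" by (rule card_image)
  \<comment> \<open>The affine map sends the slice into a coset of \<open>M\<close> applied to
    \<open>Q\<close>, and \<open>Q\<close> has at most \<open>card (F2n n) / card H\<close>
    elements.\<close>
  define W where "W = M ` Q"
  have "add_subgroup W"
    unfolding add_subgroup_def
  proof (intro conjI ballI)
    have "0 \<in> ?V" using \<open>{0} \<subseteq> ?V\<close> by simp
    then have "M 0 = 0" using M[of 0 0] by simp
    then show "0 \<in> W" unfolding W_def by (metis add_subgroup_0[OF Q(1)] imageI)
    fix x y assume "x \<in> W" "y \<in> W"
    then obtain a b where ab: "a \<in> Q" "b \<in> Q" "x = M a" "y = M b" by (auto simp: W_def)
    then have "x + y = M (a + b)" using M Q(2) by (metis subsetD)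
    then show "x + y \<in> W" unfolding W_def using add_subgroup_add[OF Q(1) ab(1,2)] by simp
  qed
  moreover have "g ` Y h \<subseteq> (+) (M h + v) ` W"
  proof
    fix p assume "p \<in> g ` Y h"
    then obtain x where x: "x \<in> Y h" "p = g x" by blast
    then have xV: "x \<in> ?V" and eq: "g x + M x = v" and xQ: "x + h \<in> Q" by (auto simp: Y_def X_def)
    have "M h + v + M (x + h) = g x"
      unfolding M[OF xV hV] eq[symmetric] by (simp add: ac_simps)
    then show "p \<in> (+) (M h + v) ` W" unfolding W_def using x xQ by (metis imageI)
  qed
  moreover have "card W * card H \<le> card ?V"
    using QH card_image_le[OF finQ, of M] unfolding W_def by (meson le_trans mult_le_mono1)
  moreover have "finite W" using finQ by (simp add: W_def)
  ultimately show ?thesis using that[of "g ` Y h" "M h + v" W] YV h(2) card_P by (auto simp: X_def)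
qed

text \<open>The factor \<open>card H\<close> by which the model thickens \<open>S\<close> cancels at
  the end: the structured set \<open>P\<close> and the subgroup \<open>W\<close> are both measured
  against \<open>card S\<close>.\<close>

theorem pfr_of_inverse_u3:
  assumes C: "inverse_u3_constant C" "0 < C"
  obtains C' where "0 < C'" "pfr_constant C'"
proof -
  \<comment> \<open>\<open>C\<^sup>2\<close> comes from squaring \<open>inverse C\<close>, and
    \<open>8 * C + 5\<close> from the square of \<open>\<epsilon> powr C\<close> with
    \<open>\<epsilon> = inverse (K ^ 4)\<close> and from the cost \<open>K ^ 5\<close> of
    translating back to \<open>S\<close>. The bounds 4 and 2 serve the span, of size at most
    \<open>2 * K ^ 4 * card S\<close>.\<close>
  define C' where "C' = C\<^sup>2 + 8 * C + 5"
  have C': "C' > 0" "C\<^sup>2 \<le> C'" "8 * C + 5 \<le> C'" "4 \<le> C'" "2 \<le> C'" using C by (simp_all add: C'_def add_nonneg_pos)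
  have "pfr_constant C'"
    unfolding pfr_constant_def
  proof (intro allI impI, elim conjE)
    fix n :: nat and K :: real and S
    assume n: "1 \<le> n" and K: "1 \<le> K" and S: "S \<subseteq> F2n n" "S \<noteq> {}" and SS: "real (card (S + S)) \<le> K * real (card S)"
    let ?V = "F2n n" and ?S4 = "iter_sumset 4 S"
    have finS: "finite S" using S finite_F2n finite_subset by blast
    have cS: "0 < real (card S)" using S finS by (simp add: card_gt_0_iff)
    note kS = card_iter_sumset_le[OF finS S(2) SS K]
    obtain H g T where H: "add_subgroup H" "H \<subseteq> ?V" and T: "T \<subseteq> ?V" "card T = card S * card H"
      and V_le: "card ?V \<le> card ?S4 * card H"
      and gP: "\<And>x. x \<in> ?V \<Longrightarrow> g x \<in> S \<union> ?S4" and gH: "\<And>x. x \<in> ?V \<Longrightarrow> x + g x \<in> H"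
      and hom: "\<And>a b c d. a \<in> T \<Longrightarrow> b \<in> T \<Longrightarrow> c \<in> T \<Longrightarrow> d \<in> T \<Longrightarrow> a + b + (c + d) = 0 \<Longrightarrow> g a + g b + (g c + g d) = 0"
    proof (rule freiman_model[OF S], goal_cases)
      case (1 H g T)
      show ?case by (rule 1(1)[OF 1(2-9)])
    qed
    have PV: "S \<union> ?S4 \<subseteq> ?V" using S iter_sumset_subset_subgroup[OF add_subgroup_F2n S(1)] by blast
    have gV: "g x \<in> ?V" if "x \<in> ?V" for x using gP[OF that] PV by blast
    define N where "N = real (card ?V)"
    have N: "N > 0" using card_F2n_pos by (simp add: N_def)
    have finH: "finite H" using H finite_F2n finite_subset by blast
    have cH: "0 < real (card H)" using finH add_subgroup_0[OF H(1)] by (auto simp: card_gt_0_iff)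
    \<comment> \<open>A lower bound for the density of \<open>T\<close>, since the fourfold sumset
      has at most \<open>K ^ 4 * card S\<close> elements.\<close>
    define \<epsilon> where "\<epsilon> = inverse (K ^ 4)"
    have \<epsilon>: "0 < \<epsilon>" "\<epsilon> \<le> 1" using K by (simp_all add: \<epsilon>_def inverse_le_1_iff)
    have "N \<le> real (card ?S4) * real (card H)" using V_le unfolding N_def by (simp flip: of_nat_mult)
    also have "\<dots> \<le> K ^ 4 * real (card S) * real (card H)" by (rule mult_right_mono[OF kS]) simp
    finally have N_le: "N \<le> K ^ 4 * real (card S) * real (card H)" .
    have T_le: "real (card S) * real (card H) \<le> N"
      using card_mono[OF finite_F2n T(1)] unfolding T(2) N_def by (simp flip: of_nat_mult)
    have K4: "0 < K ^ 4" using K by simp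
    have "\<epsilon> * N \<le> \<epsilon> * (K ^ 4 * real (card S) * real (card H))" by (rule mult_left_mono[OF N_le]) (use \<epsilon> in simp)
    also have "\<dots> = real (card T)" using K4 by (simp add: \<epsilon>_def T(2))
    finally have "\<epsilon> \<le> real (card T) / N" using N by (simp add: pos_le_divide_eq)
    define f where "f z = dot n (g (fst (deinterleave z))) (snd (deinterleave z))" for z
    have "real (card T) / N \<le> gowers_norm (2 * n) 3 (sign_fun f)"
      unfolding N_def f_def[abs_def] by (rule gowers_norm_bilinear_phase_ge[OF gV T(1) hom])
    then have "\<epsilon> \<le> gowers_norm (2 * n) 3 (sign_fun f)" using \<open>\<epsilon> \<le> real (card T) / N\<close> by linarith
    moreover have "1 \<le> 2 * n" using n by simp
    ultimately obtain p where p: "poly_of_degree_le (2 * n) 2 p"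
      "1 / 2 + inverse C * \<epsilon> powr C \<le> measure_pmf.prob (pmf_of_set (F2n (2 * n))) {x. f x = p x}"
      using C(1)[unfolded inverse_u3_constant_def, rule_format, of "2 * n" \<epsilon> f] \<epsilon> by metis
    define e where "e = inverse C * \<epsilon> powr C"
    have e: "0 < e" using C \<epsilon> by (simp add: e_def)
    have "e \<le> (\<Sum>z\<in>F2n (2 * n). sg (f z) * sg (p z)) / (2 * real (card (F2n (2 * n))))"
      using p(2) unfolding prob_eq_sign_correlation e_def by linarith
    also have "(\<Sum>z\<in>F2n (2 * n). sg (f z) * sg (p z))
        = (\<Sum>x\<in>?V. \<Sum>z\<in>?V. sg (dot n (g x) z) * sg (p (interleave (x, z))))"
      unfolding sum_F2n_double by (simp add: f_def)
    also have "real (card (F2n (2 * n))) = N\<^sup>2" by (simp add: card_F2n_double N_def power2_eq_square)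
    finally have corr: "2 * e * (real (card ?V))\<^sup>2 \<le> (\<Sum>x\<in>?V. \<Sum>z\<in>?V. sg (dot n (g x) z) * sg (p (interleave (x, z))))"
      using N by (simp add: pos_le_divide_eq N_def)
    obtain M v where M: "\<And>x. M x \<in> ?V" "\<And>x y. x \<in> ?V \<Longrightarrow> y \<in> ?V \<Longrightarrow> M (x + y) = M x + M y"
      and X: "(2 * e)\<^sup>2 * N \<le> real (card {x \<in> ?V. g x + M x = v})"
    proof (rule affine_agreement[OF p(1) _ _ corr], goal_cases)
      case 1
      show ?case using e by simp
    next
      case (2 x)
      show ?case by (rule gV[OF 2(2)])
    next
      case (3 M v)
      show ?case by (rule 3(1)[OF 3(2,3) 3(4)[folded N_def]])
    qed
    obtain P W d where P: "P \<subseteq> g ` ?V" "P \<subseteq> (+) d ` W" and W: "add_subgroup W" "finite W"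
      and W_le: "card W * card H \<le> card ?V" and X_le: "card {x \<in> ?V. g x + M x = v} \<le> card P * card H"
    proof (rule affine_values[OF H gH M(2), of v], goal_cases)
      case (4 P W d)
      show ?case by (rule 4(1)[OF 4(2-7)])
    qed
    have finP: "finite P" using P(1) finite_F2n finite_subset by blast
    have P_ge: "(2 * e)\<^sup>2 * real (card S) \<le> real (card P)"
    proof -
      have "(2 * e)\<^sup>2 * real (card S) * real (card H) \<le> (2 * e)\<^sup>2 * N"
        using mult_left_mono[OF T_le, of "(2 * e)\<^sup>2"] by (simp add: mult.assoc)
      also have "\<dots> \<le> real (card {x \<in> ?V. g x + M x = v})" by (rule X)
      also have "\<dots> \<le> real (card P) * real (card H)"
        unfolding of_nat_mult[symmetric] by (rule of_nat_mono[OF X_le])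
      finally show ?thesis using cH by simp
    qed
    have "0 < (2 * e)\<^sup>2 * real (card S)" using e cS by simp
    then have P0: "P \<noteq> {}" using P_ge by auto
    have W_le': "real (card W) \<le> K ^ 4 * real (card S)"
    proof -
      have "real (card W) * real (card H) \<le> N" using W_le unfolding N_def by (simp flip: of_nat_mult)
      then have "real (card W) * real (card H) \<le> K ^ 4 * real (card S) * real (card H)" using N_le by linarith
      then show ?thesis using cH by simp
    qed
    obtain t where t: "card S * card P \<le> card (S + P) * card {s \<in> S. s + t \<in> P}"
      by (rule popular_translate[OF finS S(2) finP P0])
    define S' where "S' = {s \<in> S. s + t \<in> P}"
    \<comment> \<open>As \<open>P\<close> lies in the union of \<open>S\<close> and
      \<open>4S\<close>, the sum \<open>S + P\<close> lies in that of \<open>2S\<close> and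
      \<open>5S\<close>.\<close>
    have SP: "real (card (S + P)) \<le> 2 * K ^ 5 * real (card S)"
    proof -
      have "P \<subseteq> S \<union> ?S4" using P(1) gP by blast
      then have "S + P \<subseteq> S + (S \<union> ?S4)" by (intro set_plus_mono2) auto
      also have "\<dots> = (S + S) \<union> iter_sumset 5 S" by (simp add: set_plus_Un eval_nat_numeral)
      finally have "card (S + P) \<le> card ((S + S) \<union> iter_sumset 5 S)"
        by (rule card_mono[rotated]) (intro finite_UnI finite_set_plus finite_iter_sumset finS)
      also have "\<dots> \<le> card (S + S) + card (iter_sumset 5 S)" by (rule card_Un_le)
      finally have "real (card (S + P)) \<le> real (card (S + S)) + real (card (iter_sumset 5 S))" by simp
      also have "\<dots> \<le> K * real (card S) + K ^ 5 * real (card S)" using SS kS[of 5] by linarith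
      also have "\<dots> \<le> K ^ 5 * real (card S) + K ^ 5 * real (card S)"
        using power_increasing[of 1 5 K] K by (intro add_right_mono mult_right_mono) auto
      finally show ?thesis by (simp add: mult_ac)
    qed
    have K5: "0 < K ^ 5" using K by simp
    have "real (card S) * real (card P) \<le> 2 * K ^ 5 * real (card S) * real (card S')"
    proof -
      have "real (card S) * real (card P) \<le> real (card (S + P)) * real (card S')"
        unfolding S'_def of_nat_mult[symmetric] by (rule of_nat_mono[OF t])
      also have "\<dots> \<le> 2 * K ^ 5 * real (card S) * real (card S')" by (rule mult_right_mono[OF SP]) simp
      finally show ?thesis .
    qed
    then have "real (card S) * real (card P) \<le> real (card S) * (2 * K ^ 5 * real (card S'))" by (simp only: mult_ac)
    then have "real (card P) \<le> 2 * K ^ 5 * real (card S')" using cS by (simp only: mult_le_cancel_left_pos)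
    then have "(2 * e)\<^sup>2 * real (card S) \<le> 2 * K ^ 5 * real (card S')" using P_ge by linarith
    then have S'_ge: "2 * e\<^sup>2 * inverse (K ^ 5) * real (card S) \<le> real (card S')"
      using K5 by (simp add: power_mult_distrib field_simps)
    have "inverse C' * K powr (- C') \<le> 2 * e\<^sup>2 * inverse (K ^ 5)"
    proof -
      have "inverse C' \<le> inverse (C\<^sup>2)" by (rule le_imp_inverse_le) (use C C' in auto)
      moreover have "K powr (- C') \<le> K powr (- (8 * C + 5))" by (rule powr_mono) (use C' K in auto)
      ultimately have "inverse C' * K powr (- C') \<le> inverse (C\<^sup>2) * K powr (- (8 * C + 5))"
        by (intro mult_mono) auto
      also have "K powr (- (8 * C + 5)) = (\<epsilon> powr C)\<^sup>2 * inverse (K ^ 5)"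
      proof -
        have "K ^ 4 = K powr 4" "K ^ 5 = K powr 5" using K by (simp_all add: powr_numeral)
        then have eq: "\<epsilon> = K powr (- 4)" "inverse (K ^ 5) = K powr (- 5)" by (simp_all add: \<epsilon>_def powr_minus)
        show ?thesis unfolding eq power2_eq_square powr_powr powr_add[symmetric] by simp
      qed
      also have "inverse (C\<^sup>2) * ((\<epsilon> powr C)\<^sup>2 * inverse (K ^ 5)) = e\<^sup>2 * inverse (K ^ 5)"
        by (simp add: e_def power_mult_distrib power_inverse)
      also have "\<dots> \<le> 2 * e\<^sup>2 * inverse (K ^ 5)" using K5 by simp
      finally show ?thesis .
    qed
    then have "inverse C' * K powr (- C') * real (card S) \<le> 2 * e\<^sup>2 * inverse (K ^ 5) * real (card S)"
      by (rule mult_right_mono) simp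
    then have 1: "inverse C' * K powr (- C') * real (card S) \<le> real (card S')" using S'_ge by linarith
    have "S' \<subseteq> (+) (t + d) ` W"
    proof
      fix s assume "s \<in> S'"
      then obtain w where w: "w \<in> W" "s + t = d + w" using P(2) by (auto simp: S'_def)
      have "t + d + w = s + t + t" unfolding w(2) by (simp add: ac_simps)
      then have "s = (t + d) + w" by (simp add: add.assoc)
      then show "s \<in> (+) (t + d) ` W" using w(1) by blast
    qed
    then have "real (card (F2.span S')) \<le> 2 * real (card W)"
      using of_nat_mono[OF card_span_coset_le[OF W(2,1)], where 'a=real] by simp
    also have "\<dots> \<le> 2 * (K ^ 4 * real (card S))" using W_le' by simp
    also have "\<dots> = 2 * K powr 4 * real (card S)" using K by (simp add: powr_numeral)
    also have "\<dots> \<le> C' * K powr C' * real (card S)"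
      by (intro mult_right_mono mult_mono powr_mono) (use C' K in auto)
    finally have 2: "real (card (F2.span S')) \<le> C' * K powr C' * real (card S)" .
    have "S' \<subseteq> S" by (auto simp: S'_def)
    then show "\<exists>S'\<subseteq>S. inverse C' * K powr (- C') * real (card S) \<le> real (card S')
        \<and> real (card (F2.span S')) \<le> C' * K powr C' * real (card S)"
      using 1 2 by blast
  qed
  then show ?thesis using that C'(1) by blast
qed

theorem theorem10:
  shows
    "(\<exists>C::real. C > 0 \<and>
        (\<forall>n\<ge>(1::nat). \<forall>K::real. \<forall>S. K \<ge> 1 \<and> S \<subseteq> F2n n \<and> S \<noteq> {} \<and>
            real (card (S + S)) \<le> K * real (card S) \<longrightarrow>
          (\<exists>S'\<subseteq>S. real (card S') \<ge> inverse C * K powr (- C) * real (card S) \<and>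
                   real (card (F2.span S')) \<le> C * K powr C * real (card S))))
     \<longleftrightarrow>
     (\<exists>C::real. C > 0 \<and>
        (\<forall>n\<ge>(1::nat). \<forall>\<epsilon>::real. \<forall>f. 0 < \<epsilon> \<and> \<epsilon> \<le> 1 \<and> gowers_norm n 3 (sign_fun f) \<ge> \<epsilon> \<longrightarrow>
          (\<exists>p. poly_of_degree_le n 2 p \<and>
               measure_pmf.prob (pmf_of_set (F2n n)) {x. f x = p x} \<ge> 1 / 2 + inverse C * \<epsilon> powr C)))"
  unfolding pfr_constant_def[symmetric] inverse_u3_constant_def[symmetric]
  using inverse_u3_of_pfr pfr_of_inverse_u3 by metis

end
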